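(* Let $\Sigma[Y]$ be the free symmetric 2-rig on one generator $Y$, and let $\Sigma\llbracket Y\rrbracket$ be its cocompletion with respect to arbitrary coproducts. Each of $\Sigma[Y]$ and $\Sigma\llbracket Y\rrbracket$ admits at least one nontrivial derivation, which is uniquely determined by the requirement that the generator $Y$ be sent to the monoidal unit (the unit of Day convolution).
   Context: A symmetric 2-rig is a symmetric monoidal category $(\mathcal R,\otimes,I)$ with finite coproducts (written $+$, initial object $0$) such that $\otimes$ preserves finite coproducts in each variable separately; when arbitrary coproducts are considered, $\otimes$ preserves these in each variable. Morphisms are strong symmetric monoidal functors preserving the coproducts in question. The free symmetric 2-rig $\Sigma[Y]$ on one generator is obtained by freely adjoining finite coproducts to $\Sigma$, the category of finite sets and bijections (the free symmetric monoidal category on one object), with the Day convolution monoidal structure; equivalently it is the closure under finite coproducts of the representables in $[\Sigma^{op},\mathsf{Set}]$, with $Y=\Sigma(-,1)$. $\Sigma\llbracket Y\rrbracket$ is the analogous category with arbitrary small coproducts. A derivation on $\mathcal R$ is a functor $\partial:\mathcal R\to\mathcal R$ preserving the coproducts in question, equipped with a left strength $R\otimes\partial C\to\partial(R\otimes C)$ and a right strength $\partial C\otimes R\to\partial(C\otimes R)$, natural, satisfying the usual unit and associativity axioms for tensorial strengths and compatible with each other, such that the induced map $\partial C\otimes C'+C\otimes\partial C'\to\partial(C\otimes C')$ and the map $0\to\partial(I)$ are isomorphisms. A derivation is trivial if it is constantly $0$. Uniqueness is meant in the essential sense (up to isomorphism). *)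

theory Defs
  imports Main "HOL-Library.FuncSet" "HOL-Library.Nat_Bijection"
begin

section \<open>Categories, functors, coproducts\<close>

record ('o, 'a) cat =
  ob :: "'o set"
  ar :: "'a set"
  src :: "'a \<Rightarrow> 'o"
  tgt :: "'a \<Rightarrow> 'o"
  idn :: "'o \<Rightarrow> 'a"
  cmp :: "'a \<Rightarrow> 'a \<Rightarrow> 'a"  (infixr "\<cdot>\<index>" 55)

definition hom :: "('o, 'a, 'z) cat_scheme \<Rightarrow> 'o \<Rightarrow> 'o \<Rightarrow> 'a set" where
  "hom C A B = {f \<in> ar C. src C f = A \<and> tgt C f = B}"

locale category =
  fixes C :: "('o, 'a, 'z) cat_scheme" (structure)
  assumes src_ob: "f \<in> ar C \<Longrightarrow> src C f \<in> ob C"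
    and tgt_ob: "f \<in> ar C \<Longrightarrow> tgt C f \<in> ob C"
    and idn_hom: "A \<in> ob C \<Longrightarrow> idn C A \<in> hom C A A"
    and cmp_hom: "f \<in> hom C A B \<Longrightarrow> g \<in> hom C B D \<Longrightarrow> g \<cdot> f \<in> hom C A D"
    and idn_left: "f \<in> hom C A B \<Longrightarrow> idn C B \<cdot> f = f"
    and idn_right: "f \<in> hom C A B \<Longrightarrow> f \<cdot> idn C A = f"
    and cmp_assoc: "f \<in> hom C A B \<Longrightarrow> g \<in> hom C B D \<Longrightarrow> h \<in> hom C D E
      \<Longrightarrow> (h \<cdot> g) \<cdot> f = h \<cdot> (g \<cdot> f)"

definition is_iso :: "('o, 'a, 'z) cat_scheme \<Rightarrow> 'o \<Rightarrow> 'o \<Rightarrow> 'a \<Rightarrow> bool" where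
  "is_iso C A B f \<longleftrightarrow> f \<in> hom C A B \<and>
     (\<exists>g \<in> hom C B A. g \<cdot>\<^bsub>C\<^esub> f = idn C A \<and> f \<cdot>\<^bsub>C\<^esub> g = idn C B)"

definition isomorphic :: "('o, 'a, 'z) cat_scheme \<Rightarrow> 'o \<Rightarrow> 'o \<Rightarrow> bool" where
  "isomorphic C A B \<longleftrightarrow> (\<exists>f. is_iso C A B f)"

locale cat_functor =
  fixes C :: "('o, 'a, 'y) cat_scheme" and D :: "('p, 'b, 'z) cat_scheme"
    and Fo :: "'o \<Rightarrow> 'p" and Fa :: "'a \<Rightarrow> 'b"
  assumes fun_ob: "A \<in> ob C \<Longrightarrow> Fo A \<in> ob D"
    and fun_hom: "f \<in> hom C A B \<Longrightarrow> Fa f \<in> hom D (Fo A) (Fo B)"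
    and fun_idn: "A \<in> ob C \<Longrightarrow> Fa (idn C A) = idn D (Fo A)"
    and fun_cmp: "f \<in> hom C A B \<Longrightarrow> g \<in> hom C B E
      \<Longrightarrow> Fa (g \<cdot>\<^bsub>C\<^esub> f) = Fa g \<cdot>\<^bsub>D\<^esub> Fa f"

definition is_coproduct ::
  "('o, 'a, 'z) cat_scheme \<Rightarrow> 'k set \<Rightarrow> ('k \<Rightarrow> 'o) \<Rightarrow> 'o \<Rightarrow> ('k \<Rightarrow> 'a) \<Rightarrow> bool" where
  "is_coproduct C K X P i \<longleftrightarrow>
     P \<in> ob C \<and> (\<forall>k\<in>K. X k \<in> ob C) \<and> (\<forall>k\<in>K. i k \<in> hom C (X k) P) \<and>
     (\<forall>Z \<in> ob C. \<forall>f. (\<forall>k\<in>K. f k \<in> hom C (X k) Z) \<longrightarrow>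
        (\<exists>!h. h \<in> hom C P Z \<and> (\<forall>k\<in>K. h \<cdot>\<^bsub>C\<^esub> i k = f k)))"

definition is_binary_coproduct ::
  "('o, 'a, 'z) cat_scheme \<Rightarrow> 'o \<Rightarrow> 'o \<Rightarrow> 'o \<Rightarrow> 'a \<Rightarrow> 'a \<Rightarrow> bool" where
  "is_binary_coproduct C A B P i j \<longleftrightarrow>
     is_coproduct C (UNIV :: bool set) (\<lambda>b. if b then A else B) P (\<lambda>b. if b then i else j)"

definition is_initial :: "('o, 'a, 'z) cat_scheme \<Rightarrow> 'o \<Rightarrow> bool" where
  "is_initial C Z \<longleftrightarrow> Z \<in> ob C \<and> (\<forall>A \<in> ob C. \<exists>!f. f \<in> hom C Z A)"

text \<open>
  "The coproducts in question" are those of families indexed by the members of a given class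
  of index sets, represented by a set of sets.
\<close>

definition has_coproducts :: "'k set set \<Rightarrow> ('o, 'a, 'z) cat_scheme \<Rightarrow> bool" where
  "has_coproducts \<K> C \<longleftrightarrow>
     (\<forall>K \<in> \<K>. \<forall>X. (\<forall>k\<in>K. X k \<in> ob C) \<longrightarrow> (\<exists>P i. is_coproduct C K X P i))"

definition preserves_coproducts ::
  "'k set set \<Rightarrow> ('o, 'a, 'y) cat_scheme \<Rightarrow> ('p, 'b, 'z) cat_scheme
    \<Rightarrow> ('o \<Rightarrow> 'p) \<Rightarrow> ('a \<Rightarrow> 'b) \<Rightarrow> bool" where
  "preserves_coproducts \<K> C D Fo Fa \<longleftrightarrow>
     (\<forall>K \<in> \<K>. \<forall>X P i. is_coproduct C K X P i
        \<longrightarrow> is_coproduct D K (\<lambda>k. Fo (X k)) (Fo P) (\<lambda>k. Fa (i k)))"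


section \<open>Symmetric monoidal categories and symmetric 2-rigs\<close>

record ('o, 'a) moncat = "('o, 'a) cat" +
  unt :: "'o"
  tens :: "'o \<Rightarrow> 'o \<Rightarrow> 'o"  (infixr "\<otimes>\<index>" 70)
  tensa :: "'a \<Rightarrow> 'a \<Rightarrow> 'a"  (infixr "\<boxtimes>\<index>" 70)
  asc :: "'o \<Rightarrow> 'o \<Rightarrow> 'o \<Rightarrow> 'a"
  lun :: "'o \<Rightarrow> 'a"
  run :: "'o \<Rightarrow> 'a"
  brd :: "'o \<Rightarrow> 'o \<Rightarrow> 'a"

locale symmetric_monoidal_category = category C
  for C :: "('o, 'a, 'z) moncat_scheme" (structure) +
  assumes unt_ob: "unt C \<in> ob C"
    and tens_ob: "A \<in> ob C \<Longrightarrow> B \<in> ob C \<Longrightarrow> A \<otimes> B \<in> ob C"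
    and tensa_hom: "f \<in> hom C A A' \<Longrightarrow> g \<in> hom C B B' \<Longrightarrow> f \<boxtimes> g \<in> hom C (A \<otimes> B) (A' \<otimes> B')"
    and tensa_idn: "A \<in> ob C \<Longrightarrow> B \<in> ob C \<Longrightarrow> idn C A \<boxtimes> idn C B = idn C (A \<otimes> B)"
    and tensa_cmp: "f \<in> hom C A A' \<Longrightarrow> f' \<in> hom C A' A'' \<Longrightarrow>
        g \<in> hom C B B' \<Longrightarrow> g' \<in> hom C B' B'' \<Longrightarrow>
        (f' \<cdot> f) \<boxtimes> (g' \<cdot> g) = (f' \<boxtimes> g') \<cdot> (f \<boxtimes> g)"
    and asc_iso: "A \<in> ob C \<Longrightarrow> B \<in> ob C \<Longrightarrow> D \<in> ob C \<Longrightarrow>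
        is_iso C ((A \<otimes> B) \<otimes> D) (A \<otimes> (B \<otimes> D)) (asc C A B D)"
    and asc_natural: "f \<in> hom C A A' \<Longrightarrow> g \<in> hom C B B' \<Longrightarrow> h \<in> hom C D D' \<Longrightarrow>
        asc C A' B' D' \<cdot> ((f \<boxtimes> g) \<boxtimes> h) = (f \<boxtimes> (g \<boxtimes> h)) \<cdot> asc C A B D"
    and lun_iso: "A \<in> ob C \<Longrightarrow> is_iso C (unt C \<otimes> A) A (lun C A)"
    and lun_natural: "f \<in> hom C A A' \<Longrightarrow> lun C A' \<cdot> (idn C (unt C) \<boxtimes> f) = f \<cdot> lun C A"
    and run_iso: "A \<in> ob C \<Longrightarrow> is_iso C (A \<otimes> unt C) A (run C A)"
    and run_natural: "f \<in> hom C A A' \<Longrightarrow> run C A' \<cdot> (f \<boxtimes> idn C (unt C)) = f \<cdot> run C A"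
    and brd_hom: "A \<in> ob C \<Longrightarrow> B \<in> ob C \<Longrightarrow> brd C A B \<in> hom C (A \<otimes> B) (B \<otimes> A)"
    and brd_natural: "f \<in> hom C A A' \<Longrightarrow> g \<in> hom C B B' \<Longrightarrow>
        brd C A' B' \<cdot> (f \<boxtimes> g) = (g \<boxtimes> f) \<cdot> brd C A B"
    and brd_brd: "A \<in> ob C \<Longrightarrow> B \<in> ob C \<Longrightarrow> brd C B A \<cdot> brd C A B = idn C (A \<otimes> B)"
    and pentagon: "A \<in> ob C \<Longrightarrow> B \<in> ob C \<Longrightarrow> D \<in> ob C \<Longrightarrow> E \<in> ob C \<Longrightarrow>
        asc C A B (D \<otimes> E) \<cdot> asc C (A \<otimes> B) D E
        = (idn C A \<boxtimes> asc C B D E) \<cdot> asc C A (B \<otimes> D) E \<cdot> (asc C A B D \<boxtimes> idn C E)"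
    and triangle: "A \<in> ob C \<Longrightarrow> B \<in> ob C \<Longrightarrow>
        (idn C A \<boxtimes> lun C B) \<cdot> asc C A (unt C) B = run C A \<boxtimes> idn C B"
    and hexagon: "A \<in> ob C \<Longrightarrow> B \<in> ob C \<Longrightarrow> D \<in> ob C \<Longrightarrow>
        asc C B D A \<cdot> brd C A (B \<otimes> D) \<cdot> asc C A B D
        = (idn C B \<boxtimes> brd C A D) \<cdot> asc C B A D \<cdot> (brd C A B \<boxtimes> idn C D)"

locale symmetric_2rig = symmetric_monoidal_category C
  for C :: "('o, 'a, 'z) moncat_scheme" (structure) +
  fixes \<K> :: "'k set set"
  assumes coproducts: "has_coproducts \<K> C"
    and tens_left_coproducts: "A \<in> ob C \<Longrightarrow>
        preserves_coproducts \<K> C C (\<lambda>X. A \<otimes> X) (\<lambda>f. idn C A \<boxtimes> f)"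
    and tens_right_coproducts: "A \<in> ob C \<Longrightarrow>
        preserves_coproducts \<K> C C (\<lambda>X. X \<otimes> A) (\<lambda>f. f \<boxtimes> idn C A)"


section \<open>Derivations\<close>

text \<open>
  \<open>lstr D R A\<close> is the left strength from \<open>R \<otimes> \<partial>A\<close> to \<open>\<partial>(R \<otimes> A)\<close>, and \<open>rstr D A R\<close> is the
  right strength from \<open>\<partial>A \<otimes> R\<close> to \<open>\<partial>(A \<otimes> R)\<close>.
\<close>

record ('o, 'a) deriv =
  dob :: "'o \<Rightarrow> 'o"
  dar :: "'a \<Rightarrow> 'a"
  lstr :: "'o \<Rightarrow> 'o \<Rightarrow> 'a"
  rstr :: "'o \<Rightarrow> 'o \<Rightarrow> 'a"

locale derivation = symmetric_2rig C \<K> + cat_functor C C "dob D" "dar D"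
  for C :: "('o, 'a, 'z) moncat_scheme" (structure) and \<K> :: "'k set set"
    and D :: "('o, 'a) deriv" +
  assumes d_coproducts: "preserves_coproducts \<K> C C (dob D) (dar D)"
    and lstr_hom: "R \<in> ob C \<Longrightarrow> A \<in> ob C \<Longrightarrow>
        lstr D R A \<in> hom C (R \<otimes> dob D A) (dob D (R \<otimes> A))"
    and rstr_hom: "A \<in> ob C \<Longrightarrow> R \<in> ob C \<Longrightarrow>
        rstr D A R \<in> hom C (dob D A \<otimes> R) (dob D (A \<otimes> R))"
    and lstr_natural: "r \<in> hom C R R' \<Longrightarrow> f \<in> hom C A A' \<Longrightarrow>
        lstr D R' A' \<cdot> (r \<boxtimes> dar D f) = dar D (r \<boxtimes> f) \<cdot> lstr D R A"
    and rstr_natural: "f \<in> hom C A A' \<Longrightarrow> r \<in> hom C R R' \<Longrightarrow>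
        rstr D A' R' \<cdot> (dar D f \<boxtimes> r) = dar D (f \<boxtimes> r) \<cdot> rstr D A R"
    and lstr_unit: "A \<in> ob C \<Longrightarrow>
        dar D (lun C A) \<cdot> lstr D (unt C) A = lun C (dob D A)"
    and rstr_unit: "A \<in> ob C \<Longrightarrow>
        dar D (run C A) \<cdot> rstr D A (unt C) = run C (dob D A)"
    and lstr_assoc: "R \<in> ob C \<Longrightarrow> S \<in> ob C \<Longrightarrow> A \<in> ob C \<Longrightarrow>
        dar D (asc C R S A) \<cdot> lstr D (R \<otimes> S) A
        = lstr D R (S \<otimes> A) \<cdot> (idn C R \<boxtimes> lstr D S A) \<cdot> asc C R S (dob D A)"
    and rstr_assoc: "A \<in> ob C \<Longrightarrow> R \<in> ob C \<Longrightarrow> S \<in> ob C \<Longrightarrow>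
        rstr D A (R \<otimes> S) \<cdot> asc C (dob D A) R S
        = dar D (asc C A R S) \<cdot> rstr D (A \<otimes> R) S \<cdot> (rstr D A R \<boxtimes> idn C S)"
    and lstr_rstr: "R \<in> ob C \<Longrightarrow> A \<in> ob C \<Longrightarrow> S \<in> ob C \<Longrightarrow>
        dar D (asc C R A S) \<cdot> rstr D (R \<otimes> A) S \<cdot> (lstr D R A \<boxtimes> idn C S)
        = lstr D R (A \<otimes> S) \<cdot> (idn C R \<boxtimes> rstr D A S) \<cdot> asc C R (dob D A) S"
    and leibniz: "A \<in> ob C \<Longrightarrow> B \<in> ob C \<Longrightarrow>
        is_binary_coproduct C (dob D A \<otimes> B) (A \<otimes> dob D B) P i j \<Longrightarrow>
        h \<in> hom C P (dob D (A \<otimes> B)) \<Longrightarrow> h \<cdot> i = rstr D A B \<Longrightarrow> h \<cdot> j = lstr D A B \<Longrightarrow>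
        is_iso C P (dob D (A \<otimes> B)) h"
    and d_unit: "is_initial C Z \<Longrightarrow> h \<in> hom C Z (dob D (unt C)) \<Longrightarrow>
        is_iso C Z (dob D (unt C)) h"

definition trivial_derivation ::
  "('o, 'a, 'z) moncat_scheme \<Rightarrow> ('o, 'a) deriv \<Rightarrow> bool" where
  "trivial_derivation C D \<longleftrightarrow> (\<forall>A \<in> ob C. is_initial C (dob D A))"

definition derivation_iso ::
  "('o, 'a, 'z) moncat_scheme \<Rightarrow> ('o, 'a) deriv \<Rightarrow> ('o, 'a) deriv \<Rightarrow> ('o \<Rightarrow> 'a) \<Rightarrow> bool" where
  "derivation_iso C D D' \<theta> \<longleftrightarrow>
     (\<forall>A \<in> ob C. is_iso C (dob D A) (dob D' A) (\<theta> A)) \<and>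
     (\<forall>A B. \<forall>f \<in> hom C A B. \<theta> B \<cdot>\<^bsub>C\<^esub> dar D f = dar D' f \<cdot>\<^bsub>C\<^esub> \<theta> A) \<and>
     (\<forall>R \<in> ob C. \<forall>A \<in> ob C.
        \<theta> (R \<otimes>\<^bsub>C\<^esub> A) \<cdot>\<^bsub>C\<^esub> lstr D R A = lstr D' R A \<cdot>\<^bsub>C\<^esub> (idn C R \<boxtimes>\<^bsub>C\<^esub> \<theta> A)) \<and>
     (\<forall>A \<in> ob C. \<forall>R \<in> ob C.
        \<theta> (A \<otimes>\<^bsub>C\<^esub> R) \<cdot>\<^bsub>C\<^esub> rstr D A R = rstr D' A R \<cdot>\<^bsub>C\<^esub> (\<theta> A \<boxtimes>\<^bsub>C\<^esub> idn C R))"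

definition derivations_isomorphic ::
  "('o, 'a, 'z) moncat_scheme \<Rightarrow> ('o, 'a) deriv \<Rightarrow> ('o, 'a) deriv \<Rightarrow> bool" where
  "derivations_isomorphic C D D' \<longleftrightarrow> (\<exists>\<theta>. derivation_iso C D D' \<theta>)"


section \<open>Finite sets and bijections\<close>

datatype ('o, 'm) arrow = Arrow (asrc: 'o) (atgt: 'o) (amap: 'm)

text \<open>
  The category of finite sets and bijections, on the finite subsets of the natural numbers
  (which represent every finite set up to bijection).  Its tensor product is disjoint union,
  coded back into the natural numbers by \<^const>\<open>sum_encode\<close>.
\<close>

definition dsum :: "nat set \<Rightarrow> nat set \<Rightarrow> nat set" where
  "dsum A B = sum_encode ` (A <+> B)"

definition inl :: "nat \<Rightarrow> nat" where "inl a = sum_encode (Inl a)"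

definition inr :: "nat \<Rightarrow> nat" where "inr b = sum_encode (Inr b)"

definition dcase :: "(nat \<Rightarrow> 'c) \<Rightarrow> (nat \<Rightarrow> 'c) \<Rightarrow> nat \<Rightarrow> 'c" where
  "dcase f g x = case_sum f g (sum_decode x)"

definition map_arrow ::
  "nat set \<Rightarrow> nat set \<Rightarrow> (nat \<Rightarrow> nat) \<Rightarrow> (nat set, nat \<Rightarrow> nat) arrow" where
  "map_arrow A B f = Arrow A B (restrict f A)"

definition FinBij :: "(nat set, (nat set, nat \<Rightarrow> nat) arrow) moncat" where
  "FinBij =
    \<lparr> ob = {A. finite A},
      ar = {map_arrow A B f | A B f. finite A \<and> finite B \<and> bij_betw f A B},
      src = asrc,
      tgt = atgt,
      idn = (\<lambda>A. map_arrow A A (\<lambda>x. x)),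
      cmp = (\<lambda>g f. map_arrow (asrc f) (atgt g) (\<lambda>x. amap g (amap f x))),
      unt = {},
      tens = dsum,
      tensa = (\<lambda>f g. map_arrow (dsum (asrc f) (asrc g)) (dsum (atgt f) (atgt g))
                 (dcase (\<lambda>a. inl (amap f a)) (\<lambda>b. inr (amap g b)))),
      asc = (\<lambda>A B C. map_arrow (dsum (dsum A B) C) (dsum A (dsum B C))
               (dcase (dcase inl (\<lambda>b. inr (inl b))) (\<lambda>c. inr (inr c)))),
      lun = (\<lambda>A. map_arrow (dsum {} A) A (dcase undefined (\<lambda>a. a))),
      run = (\<lambda>A. map_arrow (dsum A {}) A (dcase (\<lambda>a. a) undefined)),
      brd = (\<lambda>A B. map_arrow (dsum A B) (dsum B A) (dcase inr inl)) \<rparr>"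


section \<open>Free coproduct completion with Day convolution\<close>

text \<open>
  The completion of \<open>C\<close> under coproducts indexed by the members of \<open>\<K>\<close> is the category of
  families of objects of \<open>C\<close>.  An object \<open>(I, X)\<close> stands for the formal coproduct of the \<open>X i\<close>,
  i.e. for the presheaf given by the coproduct of the representables \<open>C(-, X i)\<close>, and since
  (by Yoneda) a natural transformation from \<open>C(-, X i)\<close> to the coproduct of the \<open>C(-, Y j)\<close> is
  an index \<open>j\<close> with an arrow \<open>X i \<rightarrow> Y j\<close>, an arrow \<open>(I, X) \<rightarrow> (J, Y)\<close> consists of a function
  \<open>u : I \<rightarrow> J\<close> and arrows \<open>t i : X i \<rightarrow> Y (u i)\<close>.

  Day convolution preserves coproducts in each variable and satisfies
  \<open>C(-, A) \<otimes> C(-, B) = C(-, A \<otimes> B)\<close>, so on families it is indexed by the cartesian product of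
  the index sets.  That product is coded back into the type of indices by an injection \<open>p\<close>, and
  \<open>s\<close> is the index of the one-element families.
\<close>

type_synonym ('i, 'o) family = "'i set \<times> ('i \<Rightarrow> 'o)"

type_synonym ('i, 'o, 'a) family_arrow =
  "(('i, 'o) family, ('i \<Rightarrow> 'i) \<times> ('i \<Rightarrow> 'a)) arrow"

abbreviation "idx X \<equiv> fst X"
abbreviation "fib X \<equiv> snd X"

definition fam :: "'i set \<Rightarrow> ('i \<Rightarrow> 'o) \<Rightarrow> ('i, 'o) family" where
  "fam I X = (I, restrict X I)"

definition fam_arrow :: "('i, 'o) family \<Rightarrow> ('i, 'o) family \<Rightarrow> ('i \<Rightarrow> 'i) \<Rightarrow> ('i \<Rightarrow> 'a)
    \<Rightarrow> ('i, 'o, 'a) family_arrow" where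
  "fam_arrow X Y u t = Arrow X Y (restrict u (idx X), restrict t (idx X))"

abbreviation "reindex F \<equiv> fst (amap F)"
abbreviation "comp_at F \<equiv> snd (amap F)"

text \<open>First and second component of an encoded pair.\<close>

abbreviation "cfst p k \<equiv> fst (inv p k)"
abbreviation "csnd p k \<equiv> snd (inv p k)"

definition fam_single :: "'i \<Rightarrow> 'o \<Rightarrow> ('i, 'o) family" where
  "fam_single s A = fam {s} (\<lambda>_. A)"

definition fam_tens :: "('i \<times> 'i \<Rightarrow> 'i) \<Rightarrow> ('o, 'a, 'z) moncat_scheme
    \<Rightarrow> ('i, 'o) family \<Rightarrow> ('i, 'o) family \<Rightarrow> ('i, 'o) family" where
  "fam_tens p C X Y =
     fam (p ` (idx X \<times> idx Y)) (\<lambda>k. fib X (cfst p k) \<otimes>\<^bsub>C\<^esub> fib Y (csnd p k))"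

definition Fam :: "'i set set \<Rightarrow> ('i \<times> 'i \<Rightarrow> 'i) \<Rightarrow> 'i \<Rightarrow> ('o, 'a, 'z) moncat_scheme
    \<Rightarrow> (('i, 'o) family, ('i, 'o, 'a) family_arrow) moncat" where
  "Fam \<K> p s C =
    \<lparr> ob = {fam I X | I X. I \<in> \<K> \<and> (\<forall>i\<in>I. X i \<in> ob C)},
      ar = {fam_arrow (fam I X) (fam J Y) u t | I X J Y u t.
              I \<in> \<K> \<and> (\<forall>i\<in>I. X i \<in> ob C) \<and> J \<in> \<K> \<and> (\<forall>j\<in>J. Y j \<in> ob C) \<and>
              (\<forall>i\<in>I. u i \<in> J \<and> t i \<in> hom C (X i) (Y (u i)))},
      src = asrc,
      tgt = atgt,
      idn = (\<lambda>X. fam_arrow X X (\<lambda>i. i) (\<lambda>i. idn C (fib X i))),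
      cmp = (\<lambda>G F. fam_arrow (asrc F) (atgt G)
               (\<lambda>i. reindex G (reindex F i))
               (\<lambda>i. comp_at G (reindex F i) \<cdot>\<^bsub>C\<^esub> comp_at F i)),
      unt = fam_single s (unt C),
      tens = fam_tens p C,
      tensa = (\<lambda>F G. fam_arrow (fam_tens p C (asrc F) (asrc G)) (fam_tens p C (atgt F) (atgt G))
                 (\<lambda>k. p (reindex F (cfst p k), reindex G (csnd p k)))
                 (\<lambda>k. comp_at F (cfst p k) \<boxtimes>\<^bsub>C\<^esub> comp_at G (csnd p k))),
      asc = (\<lambda>X Y Z. fam_arrow (fam_tens p C (fam_tens p C X Y) Z) (fam_tens p C X (fam_tens p C Y Z))
               (\<lambda>l. p (cfst p (cfst p l), p (csnd p (cfst p l), csnd p l)))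
               (\<lambda>l. asc C (fib X (cfst p (cfst p l))) (fib Y (csnd p (cfst p l))) (fib Z (csnd p l)))),
      lun = (\<lambda>X. fam_arrow (fam_tens p C (fam_single s (unt C)) X) X
               (\<lambda>k. csnd p k) (\<lambda>k. lun C (fib X (csnd p k)))),
      run = (\<lambda>X. fam_arrow (fam_tens p C X (fam_single s (unt C))) X
               (\<lambda>k. cfst p k) (\<lambda>k. run C (fib X (cfst p k)))),
      brd = (\<lambda>X Y. fam_arrow (fam_tens p C X Y) (fam_tens p C Y X)
               (\<lambda>k. p (csnd p k, cfst p k))
               (\<lambda>k. brd C (fib X (cfst p k)) (fib Y (csnd p k)))) \<rparr>"


section \<open>The free symmetric 2-rigs on one generator\<close>

definition finite_sets :: "nat set set" where
  "finite_sets = {I. finite I}"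

definition SigmaFin ::
  "((nat, nat set) family, (nat, nat set, (nat set, nat \<Rightarrow> nat) arrow) family_arrow) moncat" where
  "SigmaFin = Fam finite_sets prod_encode 0 FinBij"

definition Y_Fin :: "(nat, nat set) family" where
  "Y_Fin = fam_single 0 {0}"

text \<open>
  The type \<open>'u\<close> plays the role of a universe: a set is small if its cardinality is less than that
  of \<open>'u\<close>.  For \<open>'u\<close> of strongly inaccessible cardinality these are, up to bijection, the
  elements of a Grothendieck universe; for the closure of small sets under small unions it is
  enough that the cardinality is infinite and regular.  An injection \<open>'u \<times> 'u \<Rightarrow> 'u\<close> exists
  because \<open>'u\<close> is infinite; all choices of it, and of the index of one-element families, give
  equivalent categories.
\<close>

definition small_sets :: "'u set set" where
  "small_sets = {I :: 'u set. (card_of I, card_of (UNIV :: 'u set)) \<in> ordLess}"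

definition upair :: "'u \<times> 'u \<Rightarrow> 'u" where
  "upair = (SOME p. inj p)"

definition upoint :: "'u" where
  "upoint = (SOME x. True)"

definition SigmaSmall ::
  "(('u, nat set) family, ('u, nat set, (nat set, nat \<Rightarrow> nat) arrow) family_arrow) moncat" where
  "SigmaSmall = Fam small_sets upair upoint FinBij"

definition Y_Small :: "('u, nat set) family" where
  "Y_Small = fam_single upoint {0}"

end

theory Submission
  imports Defs
begin

text \<open>
  Existence: the derivative of a species, which sends the representable at a finite set \<open>A\<close> to
  the coproduct, over \<open>a \<in> A\<close>, of the representables at \<open>A - {a}\<close>.

  Uniqueness: let \<open>\<partial>\<close> be a derivation with an isomorphism \<open>\<phi> : I \<rightarrow> \<partial>Y\<close>.  An arrow
  \<open>g : R \<otimes> Y \<rightarrow> A\<close> induces \<open>kap g = \<partial>g \<cdot> lstr R Y \<cdot> (R \<otimes> \<phi>) : R \<otimes> I \<rightarrow> \<partial>A\<close>, naturally and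
  compatibly with left strengths.  For the derivative of species, the arrows \<open>kap g\<close> from
  representables form a coproduct cocone on each \<open>\<partial>A\<close>, so matching the arrows \<open>kap g\<close> of the
  two derivations defines a comparison with any other derivation.  By Leibniz's rule and preservation of coproducts the comparison is an
  isomorphism once it is known to be compatible with right strengths too.  As the axioms do not
  relate strengths to the symmetry, this needs an argument: the right strength of \<open>Y\<close> and \<open>Y\<close>
  must be the image of the left one under \<open>\<partial>(brd Y Y)\<close>.  Since \<open>\<partial>(Y \<otimes> Y)\<close> is a coproduct of two
  copies of \<open>Y\<close>, the only alternative is that \<open>\<partial>(brd Y Y)\<close> fixes the left one.  Then, among the
  two adjacent transpositions of \<open>Y \<otimes> Y \<otimes> Y\<close>, one would act on \<open>kap id\<close> trivially and the other as the
  swap of \<open>Y \<otimes> Y\<close>, contradicting the braid relation.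
\<close>

section \<open>Isomorphisms and coproducts\<close>

text \<open>The universal property of \<open>\<Sigma>[Y]\<close> does not apply directly, because a
  derivation is not a morphism of 2-rigs; hence the explicit comparison. For species,
  \<open>\<partial>A\<close> at \<open>R\<close> is \<open>A\<close> at \<open>R + 1\<close>, and
  \<open>kap g\<close> is the element of \<open>\<partial>A\<close> that corresponds to
  \<open>g\<close>. Connectedness by itself only yields some factorisation; it becomes an equation
  because the unit and \<open>Y\<close> have no endomorphism but the identity. The braid argument is
  made at \<open>Y\<close> alone: associativity of strengths and the hexagon carry its conclusion to
  all tensor powers, and compatibility of the comparison with strengths then passes to all objects
  through coproducts. Two features of the definitions shape the bookkeeping. Preservation quantifies
  over all coproduct cocones, so these must be described concretely and not merely constructed; and
  Leibniz's rule speaks of cocones indexed by \<open>bool\<close>, while index sets live in another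
  type. Finite and small coproducts are treated together, for a class of index sets closed under
  unions over its members.\<close>

lemma homI: "f \<in> ar C \<Longrightarrow> src C f = A \<Longrightarrow> tgt C f = B \<Longrightarrow> f \<in> hom C A B"
  by (simp add: hom_def)

lemma homD:
  assumes "f \<in> hom C A B"
  shows "f \<in> ar C" "src C f = A" "tgt C f = B"
  using assms by (simp_all add: hom_def)

context category
begin

lemma hom_ob: assumes "f \<in> hom C A B" shows "A \<in> ob C" "B \<in> ob C"
  using assms src_ob tgt_ob by (auto simp: hom_def)

lemma ar_cmp [simp]: "f \<in> ar C \<Longrightarrow> g \<in> ar C \<Longrightarrow> tgt C f = src C g \<Longrightarrow> g \<cdot> f \<in> ar C"
  and src_cmp [simp]: "f \<in> ar C \<Longrightarrow> g \<in> ar C \<Longrightarrow> tgt C f = src C g \<Longrightarrow> src C (g \<cdot> f) = src C f"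
  and tgt_cmp [simp]: "f \<in> ar C \<Longrightarrow> g \<in> ar C \<Longrightarrow> tgt C f = src C g \<Longrightarrow> tgt C (g \<cdot> f) = tgt C g"
  using cmp_hom[of f "src C f" "tgt C f" g "tgt C g"] by (auto simp: hom_def)

lemma idn_simps [simp]:
  assumes "A \<in> ob C"
  shows "idn C A \<in> ar C" "src C (idn C A) = A" "tgt C (idn C A) = A"
  using idn_hom[OF assms] by (auto simp: hom_def)

lemma idn_cmp [simp]: "f \<in> ar C \<Longrightarrow> tgt C f = A \<Longrightarrow> idn C A \<cdot> f = f"
  and cmp_idn [simp]: "f \<in> ar C \<Longrightarrow> src C f = A \<Longrightarrow> f \<cdot> idn C A = f"
  using idn_left[of f "src C f" A] idn_right[of f A "tgt C f"] by (auto simp: hom_def)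

lemma assoc [simp]:
  "f \<in> ar C \<Longrightarrow> g \<in> ar C \<Longrightarrow> h \<in> ar C \<Longrightarrow> tgt C f = src C g \<Longrightarrow> tgt C g = src C h
    \<Longrightarrow> (h \<cdot> g) \<cdot> f = h \<cdot> g \<cdot> f"
  by (rule cmp_assoc[of f "src C f" "tgt C f" g "tgt C g" h "tgt C h"]) (auto simp: hom_def)

declare src_ob [simp] tgt_ob [simp]

lemma is_isoE:
  assumes "is_iso C A B f"
  obtains g where "f \<in> ar C" "src C f = A" "tgt C f = B" "g \<in> ar C" "src C g = B" "tgt C g = A"
    "g \<cdot> f = idn C A" "f \<cdot> g = idn C B" "A \<in> ob C" "B \<in> ob C"
  using assms src_ob tgt_ob unfolding is_iso_def hom_def by blast

lemma is_isoI:
  assumes "f \<in> hom C A B" "g \<in> hom C B A" "g \<cdot> f = idn C A" "f \<cdot> g = idn C B"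
  shows "is_iso C A B f"
  using assms unfolding is_iso_def by blast

lemma is_iso_hom: "is_iso C A B f \<Longrightarrow> f \<in> hom C A B"
  unfolding is_iso_def by blast

lemma idn_iso: "A \<in> ob C \<Longrightarrow> is_iso C A A (idn C A)"
  by (rule is_isoI[where g = "idn C A"]) (simp_all add: hom_def)

text \<open>Rewriting with \<open>assoc\<close> nests composites to the right, so an inverse pair is
  usually followed by a third factor; this is the shape in which it has to be cancelled.\<close>

lemma cancel_left:
  assumes "f \<in> ar C" "g \<in> ar C" "h \<in> ar C" "tgt C f = src C g" "tgt C g = src C h"
    "h \<cdot> g = idn C (tgt C f)"
  shows "h \<cdot> g \<cdot> f = f"
  using assms by (metis assoc idn_cmp)

lemma is_iso_cmp:
  assumes "is_iso C A B f" "is_iso C B D g"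
  shows "is_iso C A D (g \<cdot> f)"
proof -
  obtain f' where f: "f \<in> ar C" "src C f = A" "tgt C f = B" "f' \<in> ar C" "src C f' = B" "tgt C f' = A"
    "f' \<cdot> f = idn C A" "f \<cdot> f' = idn C B" "A \<in> ob C" "B \<in> ob C"
    using assms(1) by (rule is_isoE)
  obtain g' where g: "g \<in> ar C" "src C g = B" "tgt C g = D" "g' \<in> ar C" "src C g' = D" "tgt C g' = B"
    "g' \<cdot> g = idn C B" "g \<cdot> g' = idn C D" "B \<in> ob C" "D \<in> ob C"
    using assms(2) by (rule is_isoE)
  show ?thesis
    by (rule is_isoI[where g = "f' \<cdot> g'"]) (simp_all add: f g hom_def cancel_left)
qed

lemma iso_inverse:
  assumes "is_iso C A B f"
  obtains g where "is_iso C B A g" "g \<cdot> f = idn C A" "f \<cdot> g = idn C B"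
proof -
  obtain g where "f \<in> ar C" "src C f = A" "tgt C f = B" "g \<in> ar C" "src C g = B" "tgt C g = A"
    "g \<cdot> f = idn C A" "f \<cdot> g = idn C B" "A \<in> ob C" "B \<in> ob C"
    using assms by (rule is_isoE)
  then show ?thesis
    by (intro that[of g] is_isoI[where g = f]) (simp_all add: hom_def)
qed

lemma iso_epi:
  assumes "is_iso C A B f" "g \<in> hom C B D" "h \<in> hom C B D" "g \<cdot> f = h \<cdot> f"
  shows "g = h"
proof -
  obtain k where f: "f \<in> ar C" "src C f = A" "tgt C f = B" "k \<in> ar C" "src C k = B" "tgt C k = A"
    "k \<cdot> f = idn C A" "f \<cdot> k = idn C B" "A \<in> ob C" "B \<in> ob C"
    using assms(1) by (rule is_isoE)
  have "(g \<cdot> f) \<cdot> k = (h \<cdot> f) \<cdot> k" by (simp add: assms(4))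
  then show ?thesis using assms(2,3) f by (simp add: hom_def)
qed

lemma iso_mono:
  assumes "is_iso C A B f" "g \<in> hom C D A" "h \<in> hom C D A" "f \<cdot> g = f \<cdot> h"
  shows "g = h"
proof -
  obtain k where f: "f \<in> ar C" "src C f = A" "tgt C f = B" "k \<in> ar C" "src C k = B" "tgt C k = A"
    "k \<cdot> f = idn C A" "f \<cdot> k = idn C B" "A \<in> ob C" "B \<in> ob C"
    using assms(1) by (rule is_isoE)
  have "k \<cdot> f \<cdot> g = k \<cdot> f \<cdot> h" by (simp add: assms(4))
  then show ?thesis using assms(2,3) f by (simp add: hom_def cancel_left)
qed

lemma coproductD:
  assumes "is_coproduct C K X P i"
  shows "P \<in> ob C" "k \<in> K \<Longrightarrow> X k \<in> ob C" "k \<in> K \<Longrightarrow> i k \<in> hom C (X k) P"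
  using assms unfolding is_coproduct_def by blast+

lemma coproduct_epi:
  assumes "is_coproduct C K X P i" "f \<in> hom C P Z" "g \<in> hom C P Z"
    "\<And>k. k \<in> K \<Longrightarrow> f \<cdot> i k = g \<cdot> i k"
  shows "f = g"
proof -
  have "\<forall>k\<in>K. g \<cdot> i k \<in> hom C (X k) Z"
    using cmp_hom coproductD(3)[OF assms(1)] assms(3) by blast
  moreover have "Z \<in> ob C" using assms(2) hom_ob by blast
  ultimately have "\<exists>!h. h \<in> hom C P Z \<and> (\<forall>k\<in>K. h \<cdot> i k = g \<cdot> i k)"
    using assms(1) unfolding is_coproduct_def by simp
  then show ?thesis using assms by blast
qed

lemma coproduct_factor:
  assumes "is_coproduct C K X P i" "Z \<in> ob C" "\<And>k. k \<in> K \<Longrightarrow> f k \<in> hom C (X k) Z"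
  obtains h where "h \<in> hom C P Z" "\<And>k. k \<in> K \<Longrightarrow> h \<cdot> i k = f k"
  using assms unfolding is_coproduct_def by metis

text \<open>The inverse is induced by the inverses of the \<open>t k\<close>, and both composites
  are identities because coproduct injections are jointly epic. The comparison \<open>theta\<close>
  is inverted on sums and on tensor products in this way.\<close>

lemma coproduct_comparison_iso:
  assumes P: "is_coproduct C K X P i" and P': "is_coproduct C K X' P' i'"
    and t: "\<And>k. k \<in> K \<Longrightarrow> is_iso C (X k) (X' k) (t k)"
    and h: "h \<in> hom C P P'" "\<And>k. k \<in> K \<Longrightarrow> h \<cdot> i k = i' k \<cdot> t k"
  shows "is_iso C P P' h"
proof -
  have "\<forall>k\<in>K. \<exists>s. is_iso C (X' k) (X k) s \<and> s \<cdot> t k = idn C (X k) \<and> t k \<cdot> s = idn C (X' k)"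
    using t iso_inverse by metis
  then obtain s where s: "\<And>k. k \<in> K \<Longrightarrow> is_iso C (X' k) (X k) (s k)"
    "\<And>k. k \<in> K \<Longrightarrow> s k \<cdot> t k = idn C (X k)" "\<And>k. k \<in> K \<Longrightarrow> t k \<cdot> s k = idn C (X' k)"
    by metis
  have homs: "\<And>k. k \<in> K \<Longrightarrow> i k \<in> hom C (X k) P" "\<And>k. k \<in> K \<Longrightarrow> i' k \<in> hom C (X' k) P'"
    "\<And>k. k \<in> K \<Longrightarrow> t k \<in> hom C (X k) (X' k)" "\<And>k. k \<in> K \<Longrightarrow> s k \<in> hom C (X' k) (X k)"
    using coproductD(3)[OF P] coproductD(3)[OF P'] t s(1) is_iso_hom by auto
  note ob = coproductD(1)[OF P] coproductD(1)[OF P']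
  obtain g where g: "g \<in> hom C P' P" "\<And>k. k \<in> K \<Longrightarrow> g \<cdot> i' k = i k \<cdot> s k"
    using coproduct_factor[OF P' ob(1), of "\<lambda>k. i k \<cdot> s k"] homs cmp_hom by metis
  have "g \<cdot> h = idn C P"
  proof (rule coproduct_epi[OF P])
    fix k assume k: "k \<in> K"
    note hk = homD[OF homs(1)[OF k]] homD[OF homs(2)[OF k]] homD[OF homs(3)[OF k]]
      homD[OF homs(4)[OF k]] homD[OF g(1)] homD[OF h(1)]
    have "g \<cdot> h \<cdot> i k = (g \<cdot> i' k) \<cdot> t k" by (simp add: h(2) k hk)
    also have "\<dots> = i k" by (simp add: g(2) k hk s)
    finally show "(g \<cdot> h) \<cdot> i k = idn C P \<cdot> i k" using ob by (simp add: hk)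
  qed (use g(1) h(1) ob in \<open>auto simp: hom_def\<close>)
  moreover have "h \<cdot> g = idn C P'"
  proof (rule coproduct_epi[OF P'])
    fix k assume k: "k \<in> K"
    note hk = homD[OF homs(1)[OF k]] homD[OF homs(2)[OF k]] homD[OF homs(3)[OF k]]
      homD[OF homs(4)[OF k]] homD[OF g(1)] homD[OF h(1)]
    have "h \<cdot> g \<cdot> i' k = (h \<cdot> i k) \<cdot> s k" by (simp add: g(2) k hk)
    also have "\<dots> = i' k" by (simp add: h(2) k hk s)
    finally show "(h \<cdot> g) \<cdot> i' k = idn C P' \<cdot> i' k" using ob by (simp add: hk)
  qed (use g(1) h(1) ob in \<open>auto simp: hom_def\<close>)
  ultimately show ?thesis using h(1) g(1) by (intro is_isoI)
qed

lemma coproduct_cmp_iso: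
  assumes P: "is_coproduct C K X P i" and h: "is_iso C P P' h"
  shows "is_coproduct C K X P' (\<lambda>k. h \<cdot> i k)"
  unfolding is_coproduct_def
proof (intro conjI ballI allI impI)
  obtain g where hg: "h \<in> ar C" "src C h = P" "tgt C h = P'" "g \<in> ar C" "src C g = P'" "tgt C g = P"
    "g \<cdot> h = idn C P" "h \<cdot> g = idn C P'" "P \<in> ob C" "P' \<in> ob C"
    using h by (rule is_isoE)
  show "P' \<in> ob C" by fact
  fix k assume k: "k \<in> K"
  then show "X k \<in> ob C" "h \<cdot> i k \<in> hom C (X k) P'"
    using coproductD[OF P] hg by (auto simp: hom_def)
next
  obtain g where hg: "h \<in> ar C" "src C h = P" "tgt C h = P'" "g \<in> ar C" "src C g = P'" "tgt C g = P"
    "g \<cdot> h = idn C P" "h \<cdot> g = idn C P'" "P \<in> ob C" "P' \<in> ob C"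
    using h by (rule is_isoE)
  note i = homD[OF coproductD(3)[OF P]]
  fix Z f assume Z: "Z \<in> ob C" and f: "\<forall>k\<in>K. f k \<in> hom C (X k) Z"
  obtain m where m: "m \<in> hom C P Z" "\<And>k. k \<in> K \<Longrightarrow> m \<cdot> i k = f k"
    using coproduct_factor[OF P Z] f by metis
  show "\<exists>!h'. h' \<in> hom C P' Z \<and> (\<forall>k\<in>K. h' \<cdot> h \<cdot> i k = f k)"
  proof (rule ex1I[of _ "m \<cdot> g"])
    show "m \<cdot> g \<in> hom C P' Z \<and> (\<forall>k\<in>K. (m \<cdot> g) \<cdot> h \<cdot> i k = f k)"
      using homD[OF m(1)] m(2) hg i by (auto simp: hom_def cancel_left)
  next
    fix n assume n: "n \<in> hom C P' Z \<and> (\<forall>k\<in>K. n \<cdot> h \<cdot> i k = f k)"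
    then have nh: "n \<in> ar C" "src C n = P'" "tgt C n = Z" by (auto simp: hom_def)
    have "n \<cdot> h = m"
    proof (rule coproduct_epi[OF P _ m(1)])
      show "n \<cdot> h \<in> hom C P Z" using nh hg by (simp add: hom_def)
      show "(n \<cdot> h) \<cdot> i k = m \<cdot> i k" if "k \<in> K" for k
        using n that by (simp add: nh hg i m(2))
    qed
    then have "m \<cdot> g = (n \<cdot> h) \<cdot> g" by simp
    also have "\<dots> = n" using n hg by (auto simp: hom_def)
    finally show "n = m \<cdot> g" by simp
  qed
qed

lemma initial_ex:
  assumes "is_initial C A" "Z \<in> ob C"
  obtains f where "f \<in> hom C A Z"
  using assms unfolding is_initial_def by metis

lemma initial_unique:
  assumes "is_initial C A" "f \<in> hom C A Z" "g \<in> hom C A Z"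
  shows "f = g"
  using assms hom_ob(2)[OF assms(2)] unfolding is_initial_def by metis

lemma initial_iso:
  assumes "is_initial C A" "is_initial C B" "h \<in> hom C A B"
  shows "is_iso C A B h"
proof -
  obtain g where g: "g \<in> hom C B A" using initial_ex[OF assms(2) hom_ob(1)[OF assms(3)]] .
  have "g \<cdot> h = idn C A"
    by (rule initial_unique[OF assms(1) cmp_hom[OF assms(3) g] idn_hom]) (rule hom_ob(1)[OF assms(3)])
  moreover have "h \<cdot> g = idn C B"
    by (rule initial_unique[OF assms(2) cmp_hom[OF g assms(3)] idn_hom]) (rule hom_ob(2)[OF assms(3)])
  ultimately show ?thesis using assms(3) g by (intro is_isoI)
qed

lemma initial_transfer:
  assumes "is_initial C A" "is_iso C A B h"
  shows "is_initial C B"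
proof -
  obtain g where hg: "h \<in> ar C" "src C h = A" "tgt C h = B" "g \<in> ar C" "src C g = B" "tgt C g = A"
    "g \<cdot> h = idn C A" "h \<cdot> g = idn C B" "A \<in> ob C" "B \<in> ob C"
    using assms(2) by (rule is_isoE)
  have "\<exists>!f. f \<in> hom C B Z" if Z: "Z \<in> ob C" for Z
  proof -
    obtain f where f: "f \<in> hom C A Z" using initial_ex[OF assms(1) Z] .
    have "f \<cdot> g \<in> hom C B Z" using f hg by (auto simp: hom_def)
    moreover have "u = v" if "u \<in> hom C B Z" "v \<in> hom C B Z" for u v
    proof (rule iso_epi[OF assms(2) that])
      have "u \<cdot> h \<in> hom C A Z" "v \<cdot> h \<in> hom C A Z" using that hg by (auto simp: hom_def)
      then show "u \<cdot> h = v \<cdot> h" by (rule initial_unique[OF assms(1)])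
    qed
    ultimately show ?thesis by blast
  qed
  then show ?thesis using hg unfolding is_initial_def by blast
qed

end

lemma (in symmetric_monoidal_category) tensa_simps [simp]:
  assumes "f \<in> ar C" "g \<in> ar C"
  shows "f \<boxtimes> g \<in> ar C" "src C (f \<boxtimes> g) = src C f \<otimes> src C g" "tgt C (f \<boxtimes> g) = tgt C f \<otimes> tgt C g"
  using tensa_hom[of f "src C f" "tgt C f" g "src C g" "tgt C g"] assms by (auto simp: hom_def)

declare (in symmetric_monoidal_category) tens_ob [simp] unt_ob [simp]

context symmetric_monoidal_category
begin

lemma tensa_cmp':
  "f \<in> ar C \<Longrightarrow> f' \<in> ar C \<Longrightarrow> g \<in> ar C \<Longrightarrow> g' \<in> ar C \<Longrightarrow> tgt C f = src C f' \<Longrightarrow> tgt C g = src C g'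
    \<Longrightarrow> (f' \<boxtimes> g') \<cdot> (f \<boxtimes> g) = (f' \<cdot> f) \<boxtimes> (g' \<cdot> g)"
  by (rule tensa_cmp[symmetric]) (auto simp: hom_def)

lemma tensa_iso:
  assumes "is_iso C A A' f" "is_iso C B B' g"
  shows "is_iso C (A \<otimes> B) (A' \<otimes> B') (f \<boxtimes> g)"
proof -
  obtain f' where f: "f \<in> ar C" "src C f = A" "tgt C f = A'" "f' \<in> ar C" "src C f' = A'" "tgt C f' = A"
    "f' \<cdot> f = idn C A" "f \<cdot> f' = idn C A'" "A \<in> ob C" "A' \<in> ob C"
    using assms(1) by (rule is_isoE)
  obtain g' where g: "g \<in> ar C" "src C g = B" "tgt C g = B'" "g' \<in> ar C" "src C g' = B'" "tgt C g' = B"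
    "g' \<cdot> g = idn C B" "g \<cdot> g' = idn C B'" "B \<in> ob C" "B' \<in> ob C"
    using assms(2) by (rule is_isoE)
  show ?thesis
    by (rule is_isoI[where g = "f' \<boxtimes> g'"]) (simp_all add: f g hom_def tensa_cmp' tensa_idn)
qed

lemma asc_simps [simp]:
  assumes "A \<in> ob C" "B \<in> ob C" "D \<in> ob C"
  shows "asc C A B D \<in> ar C" "src C (asc C A B D) = (A \<otimes> B) \<otimes> D" "tgt C (asc C A B D) = A \<otimes> B \<otimes> D"
  using asc_iso[OF assms] by (auto simp: is_iso_def hom_def)

lemma brd_simps [simp]:
  assumes "A \<in> ob C" "B \<in> ob C"
  shows "brd C A B \<in> ar C" "src C (brd C A B) = A \<otimes> B" "tgt C (brd C A B) = B \<otimes> A"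
  using brd_hom[OF assms] by (auto simp: hom_def)

lemma brd_iso: "A \<in> ob C \<Longrightarrow> B \<in> ob C \<Longrightarrow> is_iso C (A \<otimes> B) (B \<otimes> A) (brd C A B)"
  by (rule is_isoI[where g = "brd C B A"]) (simp_all add: brd_hom brd_brd)

end

section \<open>Finite sets and bijections\<close>

lemma inl_eq [simp]: "inl a = inl b \<longleftrightarrow> a = b"
  and inr_eq [simp]: "inr a = inr b \<longleftrightarrow> a = b"
  and inl_neq_inr [simp]: "inl a \<noteq> inr b"
  and inr_neq_inl [simp]: "inr b \<noteq> inl a"
  by (auto simp: inl_def inr_def sum_encode_eq)

lemma dcase_simps [simp]: "dcase f g (inl a) = f a" "dcase f g (inr b) = g b"
  by (simp_all add: dcase_def inl_def inr_def)

lemma mem_dsum: "x \<in> dsum A B \<longleftrightarrow> (\<exists>a\<in>A. x = inl a) \<or> (\<exists>b\<in>B. x = inr b)"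
  by (auto simp: dsum_def inl_def inr_def Plus_def)

text \<open>Together with \<open>map_arrow_eq\<close> this reduces an equation between bijections of
  iterated disjoint unions to one equation per summand; coherence in \<open>FinBij\<close> is proved
  like that.\<close>

lemma ball_dsum: "(\<forall>x\<in>dsum A B. P x) \<longleftrightarrow> (\<forall>a\<in>A. P (inl a)) \<and> (\<forall>b\<in>B. P (inr b))"
  by (auto simp: mem_dsum)

lemma inl_dsum [simp]: "inl a \<in> dsum A B \<longleftrightarrow> a \<in> A"
  and inr_dsum [simp]: "inr b \<in> dsum A B \<longleftrightarrow> b \<in> B"
  by (auto simp: mem_dsum)

lemma finite_dsum [simp]: "finite A \<Longrightarrow> finite B \<Longrightarrow> finite (dsum A B)"
  by (simp add: dsum_def)

lemma bij_betw_ballI: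
  assumes "\<forall>x\<in>A. f x \<in> B" "\<forall>y\<in>B. g y \<in> A" "\<forall>x\<in>A. g (f x) = x" "\<forall>y\<in>B. f (g y) = y"
  shows "bij_betw f A B"
  by (rule bij_betwI[where g = g]) (use assms in auto)

lemma bij_betw_dcase:
  assumes "bij_betw f A A'" "bij_betw g B B'"
  shows "bij_betw (dcase (\<lambda>a. inl (f a)) (\<lambda>b. inr (g b))) (dsum A B) (dsum A' B')"
proof -
  note maps = bij_betwE[OF assms(1)] bij_betwE[OF assms(2)]
    bij_betwE[OF bij_betw_inv_into[OF assms(1)]] bij_betwE[OF bij_betw_inv_into[OF assms(2)]]
  show ?thesis
    by (rule bij_betw_ballI[where g = "dcase (\<lambda>a. inl (inv_into A f a)) (\<lambda>b. inr (inv_into B g b))"])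
      (use maps assms in \<open>auto simp: ball_dsum bij_betw_inv_into_left bij_betw_inv_into_right\<close>)
qed

lemma map_arrow_eq: "map_arrow A B f = map_arrow A B g \<longleftrightarrow> (\<forall>x\<in>A. f x = g x)"
  by (auto simp: map_arrow_def restrict_def fun_eq_iff)

lemma map_arrow_sel [simp]: "asrc (map_arrow A B f) = A" "atgt (map_arrow A B f) = B"
  by (simp_all add: map_arrow_def)

lemma amap_map_arrow [simp]: "x \<in> A \<Longrightarrow> amap (map_arrow A B f) x = f x"
  by (simp add: map_arrow_def)

lemma FinBij_simps [simp]:
  "ob FinBij = {A. finite A}"
  "src FinBij = asrc" "tgt FinBij = atgt"
  "idn FinBij A = map_arrow A A (\<lambda>x. x)"
  "unt FinBij = {}" "tens FinBij = dsum"
  "asc FinBij A B D = map_arrow (dsum (dsum A B) D) (dsum A (dsum B D))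
      (dcase (dcase inl (\<lambda>b. inr (inl b))) (\<lambda>c. inr (inr c)))"
  "lun FinBij A = map_arrow (dsum {} A) A (dcase undefined (\<lambda>a. a))"
  "run FinBij A = map_arrow (dsum A {}) A (dcase (\<lambda>a. a) undefined)"
  "brd FinBij A B = map_arrow (dsum A B) (dsum B A) (dcase inr inl)"
  by (simp_all add: FinBij_def)

lemma FinBij_cmp [simp]:
  "\<forall>x\<in>A. f x \<in> B \<Longrightarrow> cmp FinBij (map_arrow B D g) (map_arrow A B f) = map_arrow A D (\<lambda>x. g (f x))"
  by (auto simp: FinBij_def map_arrow_eq)

lemma FinBij_tensa [simp]:
  "tensa FinBij (map_arrow A A' f) (map_arrow B B' g) =
     map_arrow (dsum A B) (dsum A' B') (dcase (\<lambda>a. inl (f a)) (\<lambda>b. inr (g b)))"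
  by (auto simp: FinBij_def map_arrow_eq ball_dsum)

text \<open>The function representing an arrow matters only on the domain, so membership in
  \<open>ar\<close> first yields another representative, which agrees with \<open>f\<close> on
  \<open>A\<close>.\<close>

lemma map_arrow_hom [simp]:
  "map_arrow A B f \<in> hom FinBij A' B' \<longleftrightarrow> A = A' \<and> B = B' \<and> finite A \<and> finite B \<and> bij_betw f A B"
proof
  assume "map_arrow A B f \<in> hom FinBij A' B'"
  then have AB: "A = A'" "B = B'" and "map_arrow A B f \<in> ar FinBij"
    by (auto simp: hom_def)
  then obtain A1 B1 g where "map_arrow A B f = map_arrow A1 B1 g" "finite A1" "finite B1" "bij_betw g A1 B1"
    by (auto simp: FinBij_def)
  moreover from this have "A1 = A" "B1 = B" by (metis map_arrow_sel)+
  moreover from calculation have "bij_betw g A B \<longleftrightarrow> bij_betw f A B"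
    by (intro bij_betw_cong) (simp add: map_arrow_eq)
  ultimately show "A = A' \<and> B = B' \<and> finite A \<and> finite B \<and> bij_betw f A B"
    using AB by simp
next
  assume "A = A' \<and> B = B' \<and> finite A \<and> finite B \<and> bij_betw f A B"
  then show "map_arrow A B f \<in> hom FinBij A' B'"
    by (auto simp: hom_def) (auto simp: FinBij_def)
qed

lemma FinBij_homE:
  assumes "f \<in> hom FinBij A B"
  obtains f' where "f = map_arrow A B f'" "finite A" "finite B" "bij_betw f' A B" "\<forall>x\<in>A. f' x \<in> B"
  using assms by (auto simp: FinBij_def hom_def bij_betw_def)

lemma FinBij_hom_dest:
  assumes "f \<in> hom FinBij A B"
  shows "f = map_arrow A B (amap f)" "finite A" "finite B" "bij_betw (amap f) A B"
    "x \<in> A \<Longrightarrow> amap f x \<in> B"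
proof -
  obtain f' where f: "f = map_arrow A B f'" "finite A" "finite B" "bij_betw f' A B" "\<forall>x\<in>A. f' x \<in> B"
    using assms by (rule FinBij_homE)
  show "f = map_arrow A B (amap f)" "finite A" "finite B" "bij_betw (amap f) A B"
    "x \<in> A \<Longrightarrow> amap f x \<in> B"
    using f by (auto simp: map_arrow_eq cong: bij_betw_cong)
qed

text \<open>\<open>\<Sigma>\<close> is a groupoid. Fibre components of arrows between families of
  finite sets are therefore invertible at no further cost.\<close>

lemma FinBij_iso:
  assumes "f \<in> hom FinBij A B"
  shows "is_iso FinBij A B f"
proof -
  obtain f' where f: "f = map_arrow A B f'" "finite A" "finite B" "bij_betw f' A B" "\<forall>x\<in>A. f' x \<in> B"
    using assms by (rule FinBij_homE)
  have g: "bij_betw (inv_into A f') B A" using f(4) by (rule bij_betw_inv_into)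
  then have g': "\<forall>x\<in>B. inv_into A f' x \<in> A" by (auto simp: bij_betw_def)
  show ?thesis
    unfolding is_iso_def
    using f g g' by (intro conjI bexI[of _ "map_arrow B A (inv_into A f')"])
      (auto simp: map_arrow_eq bij_betw_inv_into_left bij_betw_inv_into_right)
qed

interpretation FinBij: symmetric_monoidal_category FinBij
proof (unfold_locales, goal_cases)
  case (1 f) then show ?case by (auto simp: FinBij_def)
next
  case (2 f) then show ?case by (auto simp: FinBij_def)
next
  case (3 A) then show ?case by (simp add: bij_betw_id[unfolded id_def])
next
  case (4 f A B g D)
  then show ?case by (auto elim!: FinBij_homE intro: bij_betw_trans[unfolded comp_def])
next
  case (5 f A B)
  then show ?case by (auto elim!: FinBij_homE)
next
  case (6 f A B)
  then show ?case by (auto elim!: FinBij_homE)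
next
  case (7 f A B g D h E)
  then show ?case by (auto elim!: FinBij_homE)
next
  case 8 show ?case by simp
next
  case 9 then show ?case by simp
next
  case 10 then show ?case by (auto elim!: FinBij_homE intro: bij_betw_dcase)
next
  case 11 then show ?case by (simp add: map_arrow_eq ball_dsum)
next
  case 12 then show ?case by (auto elim!: FinBij_homE simp: map_arrow_eq ball_dsum)
next
  case (13 A B D)
  have "bij_betw (dcase (dcase inl (\<lambda>b. inr (inl b))) (\<lambda>c. inr (inr c)))
      (dsum (dsum A B) D) (dsum A (dsum B D))"
    by (rule bij_betw_ballI[where g = "dcase (\<lambda>a. inl (inl a)) (dcase (\<lambda>b. inl (inr b)) inr)"])
      (simp_all add: ball_dsum)
  with 13 show ?case by (intro FinBij_iso) simp
next
  case 14 then show ?case by (auto elim!: FinBij_homE simp: map_arrow_eq ball_dsum)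
next
  case (15 A)
  have "bij_betw (dcase undefined (\<lambda>a. a)) (dsum {} A) A"
    by (rule bij_betw_ballI[where g = inr]) (simp_all add: ball_dsum)
  with 15 show ?case by (intro FinBij_iso) simp
next
  case 16 then show ?case by (auto elim!: FinBij_homE simp: map_arrow_eq ball_dsum)
next
  case (17 A)
  have "bij_betw (dcase (\<lambda>a. a) undefined) (dsum A {}) A"
    by (rule bij_betw_ballI[where g = inl]) (simp_all add: ball_dsum)
  with 17 show ?case by (intro FinBij_iso) simp
next
  case 18 then show ?case by (auto elim!: FinBij_homE simp: map_arrow_eq ball_dsum)
next
  case (19 A B)
  have "bij_betw (dcase inr inl) (dsum A B) (dsum B A)"
    by (rule bij_betw_ballI[where g = "dcase inr inl"]) (simp_all add: ball_dsum)
  with 19 show ?case by simp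
next
  case 20 then show ?case by (auto elim!: FinBij_homE simp: map_arrow_eq ball_dsum)
next
  case 21 then show ?case by (simp add: map_arrow_eq ball_dsum)
next
  case 22 then show ?case by (simp add: map_arrow_eq ball_dsum)
next
  case 23 then show ?case by (simp add: map_arrow_eq ball_dsum)
next
  case 24 then show ?case by (simp add: map_arrow_eq ball_dsum)
qed

section \<open>The family completion\<close>

lemma fam_simps [simp]: "idx (fam I X) = I" "i \<in> I \<Longrightarrow> fib (fam I X) i = X i"
  by (simp_all add: fam_def)

lemma fam_single_simps [simp]: "idx (fam_single s A) = {s}" "fib (fam_single s A) s = A"
  by (simp_all add: fam_single_def)

lemma fam_arrow_sel [simp]: "asrc (fam_arrow X Y u t) = X" "atgt (fam_arrow X Y u t) = Y"
  by (simp_all add: fam_arrow_def)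

lemma fam_arrow_eval [simp]:
  "i \<in> idx X \<Longrightarrow> reindex (fam_arrow X Y u t) i = u i"
  "i \<in> idx X \<Longrightarrow> comp_at (fam_arrow X Y u t) i = t i"
  by (simp_all add: fam_arrow_def)

lemma fam_arrow_eq:
  "fam_arrow X Y u t = fam_arrow X Y u' t' \<longleftrightarrow> (\<forall>i\<in>idx X. u i = u' i \<and> t i = t' i)"
  by (auto simp: fam_arrow_def restrict_def fun_eq_iff)

lemma Fam_simps [simp]:
  "src (Fam \<K> p s C) = asrc" "tgt (Fam \<K> p s C) = atgt"
  "idn (Fam \<K> p s C) X = fam_arrow X X (\<lambda>i. i) (\<lambda>i. idn C (fib X i))"
  "unt (Fam \<K> p s C) = fam_single s (unt C)"
  "tens (Fam \<K> p s C) = fam_tens p C"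
  "asc (Fam \<K> p s C) X Y Z = fam_arrow (fam_tens p C (fam_tens p C X Y) Z) (fam_tens p C X (fam_tens p C Y Z))
     (\<lambda>l. p (cfst p (cfst p l), p (csnd p (cfst p l), csnd p l)))
     (\<lambda>l. asc C (fib X (cfst p (cfst p l))) (fib Y (csnd p (cfst p l))) (fib Z (csnd p l)))"
  "lun (Fam \<K> p s C) X = fam_arrow (fam_tens p C (fam_single s (unt C)) X) X
     (\<lambda>k. csnd p k) (\<lambda>k. lun C (fib X (csnd p k)))"
  "run (Fam \<K> p s C) X = fam_arrow (fam_tens p C X (fam_single s (unt C))) X
     (\<lambda>k. cfst p k) (\<lambda>k. run C (fib X (cfst p k)))"
  "brd (Fam \<K> p s C) X Y = fam_arrow (fam_tens p C X Y) (fam_tens p C Y X)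
     (\<lambda>k. p (csnd p k, cfst p k)) (\<lambda>k. brd C (fib X (cfst p k)) (fib Y (csnd p k)))"
  by (simp_all add: Fam_def)

text \<open>The restriction in \<open>fam\<close> makes the fibre function \<open>undefined\<close>
  off the index set; extensionality says this without an existential witness.\<close>

lemma Fam_ob: "X \<in> ob (Fam \<K> p s C) \<longleftrightarrow>
    idx X \<in> \<K> \<and> (\<forall>i\<in>idx X. fib X i \<in> ob C) \<and> fib X \<in> extensional (idx X)"
proof
  assume "X \<in> ob (Fam \<K> p s C)"
  then show "idx X \<in> \<K> \<and> (\<forall>i\<in>idx X. fib X i \<in> ob C) \<and> fib X \<in> extensional (idx X)"
    by (auto simp: Fam_def fam_def)
next
  assume *: "idx X \<in> \<K> \<and> (\<forall>i\<in>idx X. fib X i \<in> ob C) \<and> fib X \<in> extensional (idx X)"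
  then have "X = fam (idx X) (fib X)"
    by (simp add: fam_def extensional_restrict)
  with * show "X \<in> ob (Fam \<K> p s C)" by (auto simp: Fam_def)
qed

lemma fam_ob: "fam I X \<in> ob (Fam \<K> p s C) \<longleftrightarrow> I \<in> \<K> \<and> (\<forall>i\<in>I. X i \<in> ob C)"
  by (auto simp: Fam_ob fam_def)

lemma Fam_cmp [simp]:
  "\<forall>i\<in>idx X. u i \<in> idx Y \<Longrightarrow> cmp (Fam \<K> p s C) (fam_arrow Y Z v w) (fam_arrow X Y u t) =
     fam_arrow X Z (\<lambda>i. v (u i)) (\<lambda>i. w (u i) \<cdot>\<^bsub>C\<^esub> t i)"
  by (auto simp: Fam_def fam_arrow_eq)

lemma Fam_hom_iff [simp]:
  "fam_arrow X Y u t \<in> hom (Fam \<K> p s C) X' Y' \<longleftrightarrow>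
     X = X' \<and> Y = Y' \<and> X \<in> ob (Fam \<K> p s C) \<and> Y \<in> ob (Fam \<K> p s C) \<and>
     (\<forall>i\<in>idx X. u i \<in> idx Y \<and> t i \<in> hom C (fib X i) (fib Y (u i)))" (is "?L \<longleftrightarrow> ?R")
proof
  assume ?L
  then have XY: "X = X'" "Y = Y'" and "fam_arrow X Y u t \<in> ar (Fam \<K> p s C)"
    by (auto simp: hom_def)
  then obtain I X1 J Y1 v w where eq: "fam_arrow X Y u t = fam_arrow (fam I X1) (fam J Y1) v w"
    and *: "I \<in> \<K>" "\<forall>i\<in>I. X1 i \<in> ob C" "J \<in> \<K>" "\<forall>j\<in>J. Y1 j \<in> ob C"
      "\<forall>i\<in>I. v i \<in> J \<and> w i \<in> hom C (X1 i) (Y1 (v i))"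
    by (auto simp: Fam_def)
  from eq have XY': "X = fam I X1" "Y = fam J Y1" by (metis fam_arrow_sel)+
  with eq have "\<forall>i\<in>I. u i = v i \<and> t i = w i" by (simp add: fam_arrow_eq)
  with * XY' show ?R unfolding XY[symmetric] by (simp add: fam_ob)
next
  assume R: ?R
  then obtain I X1 J Y1 where XY: "X = fam I X1" "Y = fam J Y1" "I \<in> \<K>" "\<forall>i\<in>I. X1 i \<in> ob C"
    "J \<in> \<K>" "\<forall>j\<in>J. Y1 j \<in> ob C"
    by (auto simp: Fam_def)
  with R have "\<forall>i\<in>I. u i \<in> J \<and> t i \<in> hom C (X1 i) (Y1 (u i))" by auto
  with XY(3-6) have "fam_arrow X Y u t \<in> ar (Fam \<K> p s C)"
    unfolding XY(1,2) Fam_def by simp blast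
  with R show ?L by (simp add: hom_def)
qed

lemma Fam_arE:
  assumes "f \<in> ar (Fam \<K> p s C)"
  obtains X Y u t where "f = fam_arrow X Y u t" "X \<in> ob (Fam \<K> p s C)" "Y \<in> ob (Fam \<K> p s C)"
proof -
  obtain I X J Y u t where "f = fam_arrow (fam I X) (fam J Y) u t"
    "I \<in> \<K>" "\<forall>i\<in>I. X i \<in> ob C" "J \<in> \<K>" "\<forall>j\<in>J. Y j \<in> ob C"
    using assms by (auto simp: Fam_def)
  then show ?thesis by (intro that[of "fam I X" "fam J Y" u t]) (auto simp: fam_ob)
qed

lemma Fam_homD:
  assumes "f \<in> hom (Fam \<K> p s C) X Y"
  shows "f = fam_arrow X Y (reindex f) (comp_at f)"
    "X \<in> ob (Fam \<K> p s C)" "Y \<in> ob (Fam \<K> p s C)"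
    "i \<in> idx X \<Longrightarrow> reindex f i \<in> idx Y"
    "i \<in> idx X \<Longrightarrow> comp_at f i \<in> hom C (fib X i) (fib Y (reindex f i))"
proof -
  have ar: "f \<in> ar (Fam \<K> p s C)" and XY: "asrc f = X" "atgt f = Y"
    using assms by (auto simp: hom_def)
  obtain X1 Y1 u t where "f = fam_arrow X1 Y1 u t"
    using Fam_arE[OF ar] .
  with XY have f: "f = fam_arrow X Y u t" by auto
  then show "f = fam_arrow X Y (reindex f) (comp_at f)" by (simp add: fam_arrow_eq)
  show "X \<in> ob (Fam \<K> p s C)" "Y \<in> ob (Fam \<K> p s C)"
    "i \<in> idx X \<Longrightarrow> reindex f i \<in> idx Y"
    "i \<in> idx X \<Longrightarrow> comp_at f i \<in> hom C (fib X i) (fib Y (reindex f i))"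
    using assms unfolding f by auto
qed

lemma Fam_homE:
  assumes "f \<in> hom (Fam \<K> p s C) X Y"
  obtains u t where "f = fam_arrow X Y u t" "X \<in> ob (Fam \<K> p s C)" "Y \<in> ob (Fam \<K> p s C)"
    "\<forall>i\<in>idx X. u i \<in> idx Y" "\<forall>i\<in>idx X. t i \<in> hom C (fib X i) (fib Y (u i))"
  using Fam_homD[OF assms] by (intro that[of "reindex f" "comp_at f"]) auto

lemma Fam_ext:
  assumes "f \<in> hom (Fam \<K> p s C) X Y" "g \<in> hom (Fam \<K> p s C) X Y"
    "\<And>i. i \<in> idx X \<Longrightarrow> reindex f i = reindex g i" "\<And>i. i \<in> idx X \<Longrightarrow> comp_at f i = comp_at g i"
  shows "f = g"
proof -
  have "fam_arrow X Y (reindex f) (comp_at f) = fam_arrow X Y (reindex g) (comp_at g)"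
    using assms(3,4) by (simp add: fam_arrow_eq)
  then show ?thesis using Fam_homD(1)[OF assms(1)] Fam_homD(1)[OF assms(2)] by simp
qed

lemma Fam_cmp_eval:
  assumes "f \<in> hom (Fam \<K> p s C) X Y" "g \<in> hom (Fam \<K> p s C) Y Z" "i \<in> idx X"
  shows "reindex (g \<cdot>\<^bsub>Fam \<K> p s C\<^esub> f) i = reindex g (reindex f i)"
    "comp_at (g \<cdot>\<^bsub>Fam \<K> p s C\<^esub> f) i = comp_at g (reindex f i) \<cdot>\<^bsub>C\<^esub> comp_at f i"
  using assms by (auto simp: Fam_def hom_def)

text \<open>\<open>Sigma_index\<close> is closure under unions over members of the class,
  transported along the pairing; it keeps tensor products, sums and derivatives of families inside
  the class. \<open>infinite_index\<close> supplies a second index beside \<open>s\<close>, from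
  which binary coproducts are built.\<close>

locale fam_completion = symmetric_monoidal_category C
  for C :: "('o, 'a, 'z) moncat_scheme" (structure) +
  fixes \<K> :: "'i set set" and p :: "'i \<times> 'i \<Rightarrow> 'i" and s :: 'i
  assumes inj_p: "inj p"
    and infinite_index: "infinite (UNIV :: 'i set)"
    and finite_index: "finite I \<Longrightarrow> I \<in> \<K>"
    and Sigma_index: "I \<in> \<K> \<Longrightarrow> (\<And>i. i \<in> I \<Longrightarrow> J i \<in> \<K>) \<Longrightarrow> p ` (SIGMA i:I. J i) \<in> \<K>"
begin

abbreviation "F \<equiv> Fam \<K> p s C"

lemma inv_p [simp]: "inv p (p k) = k"
  by (simp add: inj_p)

lemma p_eq [simp]: "p k = p l \<longleftrightarrow> k = l"
  by (rule inj_eq[OF inj_p])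

lemma ball_p [simp]: "(\<forall>k\<in>p ` (I \<times> J). P k) \<longleftrightarrow> (\<forall>i\<in>I. \<forall>j\<in>J. P (p (i, j)))"
  by auto

lemma fam_tens_simps [simp]:
  "idx (fam_tens p C X Y) = p ` (idx X \<times> idx Y)"
  "i \<in> idx X \<Longrightarrow> j \<in> idx Y \<Longrightarrow> fib (fam_tens p C X Y) (p (i, j)) = fib X i \<otimes> fib Y j"
  by (simp_all add: fam_tens_def)

lemma single_ob [simp]: "fam_single s A \<in> ob F \<longleftrightarrow> A \<in> ob C"
  by (simp add: fam_single_def fam_ob finite_index)

lemma fam_tens_ob [simp]: "X \<in> ob F \<Longrightarrow> Y \<in> ob F \<Longrightarrow> fam_tens p C X Y \<in> ob F"
  unfolding fam_tens_def fam_ob by (simp add: Fam_ob Sigma_index)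

lemma fib_ob [simp]: "X \<in> ob F \<Longrightarrow> i \<in> idx X \<Longrightarrow> fib X i \<in> ob C"
  by (simp add: Fam_ob)

lemma Fam_tensa [simp]:
  "tensa F (fam_arrow X X' u t) (fam_arrow Y Y' v w) =
     fam_arrow (fam_tens p C X Y) (fam_tens p C X' Y')
       (\<lambda>k. p (u (cfst p k), v (csnd p k))) (\<lambda>k. t (cfst p k) \<boxtimes> w (csnd p k))"
  by (simp add: Fam_def fam_arrow_eq)

text \<open>The inverse consists of the inverse bijection of indices and the inverse fibre arrows.
  With the converse \<open>Fam_isoD\<close>, isomorphisms of families are tested index by
  index.\<close>

lemma Fam_iso:
  assumes f: "f \<in> hom F X Y" and u: "bij_betw (reindex f) (idx X) (idx Y)"
    and t: "\<And>i. i \<in> idx X \<Longrightarrow> is_iso C (fib X i) (fib Y (reindex f i)) (comp_at f i)"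
  shows "is_iso F X Y f"
proof -
  let ?v = "inv_into (idx X) (reindex f)"
  have "\<forall>i\<in>idx X. \<exists>h. is_iso C (fib Y (reindex f i)) (fib X i) h \<and> h \<cdot> comp_at f i = idn C (fib X i)
      \<and> comp_at f i \<cdot> h = idn C (fib Y (reindex f i))"
    using t iso_inverse by metis
  then obtain w where w: "\<And>i. i \<in> idx X \<Longrightarrow> is_iso C (fib Y (reindex f i)) (fib X i) (w i)"
    "\<And>i. i \<in> idx X \<Longrightarrow> w i \<cdot> comp_at f i = idn C (fib X i)"
    "\<And>i. i \<in> idx X \<Longrightarrow> comp_at f i \<cdot> w i = idn C (fib Y (reindex f i))"
    by metis
  have v: "?v j \<in> idx X" "reindex f (?v j) = j" if "j \<in> idx Y" for j
    using that u bij_betw_inv_into_right[OF u] bij_betwE[OF bij_betw_inv_into[OF u]] by auto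
  have v': "?v (reindex f i) = i" if "i \<in> idx X" for i
    using that u bij_betw_inv_into_left by fastforce
  define g where "g = fam_arrow Y X ?v (\<lambda>j. w (?v j))"
  have g: "g \<in> hom F Y X"
    unfolding g_def using Fam_homD(2,3)[OF f] v is_iso_hom[OF w(1)] by simp (metis v)
  have "g \<cdot>\<^bsub>F\<^esub> f = idn F X"
    unfolding g_def by (subst Fam_homD(1)[OF f]) (use Fam_homD(4)[OF f] v' w in \<open>simp add: fam_arrow_eq\<close>)
  moreover have "f \<cdot>\<^bsub>F\<^esub> g = idn F Y"
    unfolding g_def by (subst Fam_homD(1)[OF f]) (use v w(3) in \<open>simp add: fam_arrow_eq\<close>)
  ultimately show ?thesis using f g unfolding is_iso_def by blast
qed

sublocale Fam: symmetric_monoidal_category F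
proof (unfold_locales, goal_cases)
  case (1 f) then show ?case by (auto elim: Fam_arE)
next
  case (2 f) then show ?case by (auto elim: Fam_arE)
next
  case (3 A) then show ?case by (simp add: idn_hom)
next
  case (4 f A B g D)
  then show ?case by (auto elim!: Fam_homE) (metis cmp_hom)
next
  case (5 f A B)
  then show ?case by (elim Fam_homE) (auto simp: hom_def fam_arrow_eq)
next
  case (6 f A B)
  then show ?case by (elim Fam_homE) (auto simp: hom_def fam_arrow_eq)
next
  case (7 f A B g D h E)
  then show ?case by (elim Fam_homE) (auto simp: hom_def fam_arrow_eq)
next
  case 8 show ?case by simp
next
  case 9 then show ?case by simp
next
  case 10 then show ?case by (auto elim!: Fam_homE intro!: tensa_hom)
next
  case 11 then show ?case by (simp add: fam_arrow_eq tensa_idn)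
next
  case 12 then show ?case by (elim Fam_homE) (auto simp: hom_def fam_arrow_eq tensa_cmp')
next
  case (13 A B D)
  show ?case
  proof (rule Fam_iso)
    show "asc F A B D \<in> hom F (tens F (tens F A B) D) (tens F A (tens F B D))"
      using 13 by (simp add: is_iso_hom[OF asc_iso])
    show "bij_betw (reindex (asc F A B D)) (idx (tens F (tens F A B) D)) (idx (tens F A (tens F B D)))"
      by (rule bij_betw_ballI[where g = "\<lambda>l. p (p (cfst p l, cfst p (csnd p l)), csnd p (csnd p l))"]) simp_all
  qed (use 13 in \<open>auto simp: asc_iso\<close>)
next
  case 14 then show ?case
    by (auto elim!: Fam_homE simp: fam_arrow_eq intro!: asc_natural)
next
  case (15 A)
  show ?case
  proof (rule Fam_iso)
    show "lun F A \<in> hom F (tens F (unt F) A) A"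
      using 15 lun_iso by (auto simp: is_iso_def)
    show "bij_betw (reindex (lun F A)) (idx (tens F (unt F) A)) (idx A)"
      by (rule bij_betw_ballI[where g = "\<lambda>l. p (s, l)"]) auto
  qed (use 15 in \<open>auto simp: lun_iso\<close>)
next
  case 16 then show ?case
    by (auto elim!: Fam_homE simp: fam_arrow_eq intro!: lun_natural)
next
  case (17 A)
  show ?case
  proof (rule Fam_iso)
    show "run F A \<in> hom F (tens F A (unt F)) A"
      using 17 run_iso by (auto simp: is_iso_def)
    show "bij_betw (reindex (run F A)) (idx (tens F A (unt F))) (idx A)"
      by (rule bij_betw_ballI[where g = "\<lambda>l. p (l, s)"]) auto
  qed (use 17 in \<open>auto simp: run_iso\<close>)
next
  case 18 then show ?case
    by (auto elim!: Fam_homE simp: fam_arrow_eq intro!: run_natural)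
next
  case (19 A B)
  then show ?case by (simp add: brd_hom)
next
  case 20 then show ?case
    by (auto elim!: Fam_homE simp: fam_arrow_eq intro!: brd_natural)
next
  case 21 then show ?case by (simp add: fam_arrow_eq brd_brd)
next
  case 22 then show ?case by (simp add: fam_arrow_eq pentagon)
next
  case 23 then show ?case by (simp add: fam_arrow_eq triangle)
next
  case 24 then show ?case by (simp add: fam_arrow_eq hexagon)
qed

lemma Fam_isoD:
  assumes "is_iso F X Y f"
  shows "bij_betw (reindex f) (idx X) (idx Y)"
    "i \<in> idx X \<Longrightarrow> is_iso C (fib X i) (fib Y (reindex f i)) (comp_at f i)"
proof -
  obtain g where f: "f \<in> hom F X Y" and g: "g \<in> hom F Y X"
    and gf: "cmp F g f = idn F X" and fg: "cmp F f g = idn F Y"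
    using assms by (auto simp: is_iso_def)
  have gf': "reindex g (reindex f i) = i" "comp_at g (reindex f i) \<cdot> comp_at f i = idn C (fib X i)"
    if "i \<in> idx X" for i
    using that Fam_cmp_eval[OF f g that] by (simp_all add: gf)
  have fg': "reindex f (reindex g i) = i" "comp_at f (reindex g i) \<cdot> comp_at g i = idn C (fib Y i)"
    if "i \<in> idx Y" for i
    using that Fam_cmp_eval[OF g f that] by (simp_all add: fg)
  show "bij_betw (reindex f) (idx X) (idx Y)"
    by (rule bij_betw_ballI[where g = "reindex g"]) (use Fam_homD(4)[OF f] Fam_homD(4)[OF g] gf' fg' in auto)
  assume i: "i \<in> idx X"
  note fi = Fam_homD(4,5)[OF f i]
  show "is_iso C (fib X i) (fib Y (reindex f i)) (comp_at f i)"
    using fi Fam_homD(5)[OF g fi(1)] gf'[OF i] fg'(2)[OF fi(1)] by (intro is_isoI) auto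
qed

text \<open>A coproduct cocone in concrete terms: every index of \<open>P\<close> comes from exactly
  one index of exactly one leg, along an isomorphism of fibres. The type of \<open>K\<close> is left
  free because Leibniz's rule concerns cocones indexed by \<open>bool\<close>.\<close>

definition fam_cover :: "'k set \<Rightarrow> ('k \<Rightarrow> ('i, 'o) family) \<Rightarrow> ('i, 'o) family
    \<Rightarrow> ('k \<Rightarrow> ('i, 'o, 'a) family_arrow) \<Rightarrow> bool" where
  "fam_cover K X P f \<longleftrightarrow> P \<in> ob F \<and> (\<forall>k\<in>K. f k \<in> hom F (X k) P) \<and>
     bij_betw (\<lambda>(k, x). reindex (f k) x) (SIGMA k:K. idx (X k)) (idx P) \<and>
     (\<forall>k\<in>K. \<forall>x\<in>idx (X k). is_iso C (fib (X k) x) (fib P (reindex (f k) x)) (comp_at (f k) x))"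

lemma fam_cover_index:
  assumes "fam_cover K X P f"
  obtains v where "\<And>k x. k \<in> K \<Longrightarrow> x \<in> idx (X k) \<Longrightarrow> v (reindex (f k) x) = (k, x)"
    "\<And>j. j \<in> idx P \<Longrightarrow> \<exists>k\<in>K. \<exists>x\<in>idx (X k). j = reindex (f k) x"
proof -
  let ?S = "SIGMA k:K. idx (X k)"
  have bij: "bij_betw (\<lambda>(k, x). reindex (f k) x) ?S (idx P)"
    using assms unfolding fam_cover_def by auto
  show ?thesis
  proof (rule that[of "inv_into ?S (\<lambda>(k, x). reindex (f k) x)"])
    show "inv_into ?S (\<lambda>(k, x). reindex (f k) x) (reindex (f k) x) = (k, x)"
      if "k \<in> K" "x \<in> idx (X k)" for k x
      using bij_betw_inv_into_left[OF bij, of "(k, x)"] that by simp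
    fix j assume "j \<in> idx P"
    then have "j \<in> (\<lambda>(k, x). reindex (f k) x) ` ?S" using bij by (simp add: bij_betw_def)
    then obtain q where "q \<in> ?S" "j = (\<lambda>(k, x). reindex (f k) x) q" by (rule imageE)
    then show "\<exists>k\<in>K. \<exists>x\<in>idx (X k). j = reindex (f k) x"
      by (cases q) auto
  qed
qed

text \<open>A decoder \<open>v\<close> that inverts the legs on indices, together with exhaustion of
  \<open>P\<close>, replaces the bijection, so that each use only has to write down
  \<open>v\<close>.\<close>

lemma fam_coverI:
  assumes "P \<in> ob F" "\<And>k. k \<in> K \<Longrightarrow> f k \<in> hom F (X k) P"
    "\<And>k x. k \<in> K \<Longrightarrow> x \<in> idx (X k) \<Longrightarrow> v (reindex (f k) x) = (k, x)"
    "\<And>j. j \<in> idx P \<Longrightarrow> \<exists>k\<in>K. \<exists>x\<in>idx (X k). j = reindex (f k) x"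
    "\<And>k x. k \<in> K \<Longrightarrow> x \<in> idx (X k)
      \<Longrightarrow> is_iso C (fib (X k) x) (fib P (reindex (f k) x)) (comp_at (f k) x)"
  shows "fam_cover K X P f"
proof -
  have "bij_betw (\<lambda>(k, x). reindex (f k) x) (SIGMA k:K. idx (X k)) (idx P)"
  proof (rule bij_betw_ballI[where g = v])
    show "\<forall>y\<in>idx P. v y \<in> (SIGMA k:K. idx (X k))"
      "\<forall>y\<in>idx P. (case v y of (k, x) \<Rightarrow> reindex (f k) x) = y"
      using assms(3,4) by fastforce+
  qed (use assms(3) Fam_homD(4)[OF assms(2)] in auto)
  then show ?thesis using assms unfolding fam_cover_def by blast
qed

lemma fam_coverD:
  assumes "fam_cover K X P f"
  shows "P \<in> ob F" "k \<in> K \<Longrightarrow> f k \<in> hom F (X k) P"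
    "k \<in> K \<Longrightarrow> x \<in> idx (X k) \<Longrightarrow> is_iso C (fib (X k) x) (fib P (reindex (f k) x)) (comp_at (f k) x)"
  using assms unfolding fam_cover_def by auto

text \<open>Each index of \<open>P\<close> is reached once and with an isomorphic fibre, so an arrow
  out of \<open>P\<close> amounts to one arrow out of each leg.\<close>

lemma fam_cover_coproduct:
  assumes "fam_cover K X P f"
  shows "is_coproduct F K X P f"
  unfolding is_coproduct_def
proof (intro conjI ballI allI impI)
  note P = fam_coverD(1)[OF assms] and f = fam_coverD(2)[OF assms] and iso = fam_coverD(3)[OF assms]
  obtain v where v: "\<And>k x. k \<in> K \<Longrightarrow> x \<in> idx (X k) \<Longrightarrow> v (reindex (f k) x) = (k, x)"
    and idx_P: "\<And>j. j \<in> idx P \<Longrightarrow> \<exists>k\<in>K. \<exists>x\<in>idx (X k). j = reindex (f k) x"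
    using fam_cover_index[OF assms] by blast
  show "P \<in> ob F" by (rule P)
  show "k \<in> K \<Longrightarrow> X k \<in> ob F" for k using Fam_homD(2)[OF f] .
  show "k \<in> K \<Longrightarrow> f k \<in> hom F (X k) P" for k by (rule f)
  have "\<forall>k x. \<exists>h. k \<in> K \<and> x \<in> idx (X k) \<longrightarrow>
      is_iso C (fib P (reindex (f k) x)) (fib (X k) x) h \<and> h \<cdot> comp_at (f k) x = idn C (fib (X k) x)
      \<and> comp_at (f k) x \<cdot> h = idn C (fib P (reindex (f k) x))"
    using iso iso_inverse by metis
  then obtain w where w: "\<And>k x. k \<in> K \<Longrightarrow> x \<in> idx (X k) \<Longrightarrow> is_iso C (fib P (reindex (f k) x)) (fib (X k) x) (w k x)"
    "\<And>k x. k \<in> K \<Longrightarrow> x \<in> idx (X k) \<Longrightarrow> w k x \<cdot> comp_at (f k) x = idn C (fib (X k) x)"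
    by metis
  fix Z g assume Z: "Z \<in> ob F" and g0: "\<forall>k\<in>K. g k \<in> hom F (X k) Z"
  then have g: "g k \<in> hom F (X k) Z" if "k \<in> K" for k using that by blast
  \<comment> \<open>Decode \<open>j\<close> as an index of a leg, go back along the inverse
    \<open>w\<close> of the fibre isomorphism, then apply the given arrow of that leg.\<close>
  define h where "h = fam_arrow P Z (\<lambda>j. reindex (g (fst (v j))) (snd (v j)))
    (\<lambda>j. comp_at (g (fst (v j))) (snd (v j)) \<cdot> w (fst (v j)) (snd (v j)))"
  have h: "h \<in> hom F P Z"
    unfolding h_def Fam_hom_iff
  proof (intro conjI refl P Z ballI)
    fix j assume "j \<in> idx P"
    then obtain k x where kx: "k \<in> K" "x \<in> idx (X k)" "j = reindex (f k) x" using idx_P by blast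
    then show "reindex (g (fst (v j))) (snd (v j)) \<in> idx Z"
      using v[OF kx(1,2)] Fam_homD(4)[OF g] by simp
    show "comp_at (g (fst (v j))) (snd (v j)) \<cdot> w (fst (v j)) (snd (v j))
        \<in> hom C (fib P j) (fib Z (reindex (g (fst (v j))) (snd (v j))))"
      using v[OF kx(1,2)] cmp_hom[OF is_iso_hom[OF w(1)[OF kx(1,2)]] Fam_homD(5)[OF g[OF kx(1)] kx(2)]]
      by (simp add: kx(3))
  qed
  show "\<exists>!h. h \<in> hom F P Z \<and> (\<forall>k\<in>K. cmp F h (f k) = g k)"
  proof (rule ex1I[of _ h], intro conjI ballI h)
    fix k assume k: "k \<in> K"
    show "cmp F h (f k) = g k"
    proof (rule Fam_ext[OF Fam.cmp_hom[OF f[OF k] h] g[OF k]])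
      fix x assume x: "x \<in> idx (X k)"
      note r = Fam_homD(4)[OF f[OF k] x]
      show "reindex (cmp F h (f k)) x = reindex (g k) x"
        using r v[OF k x] unfolding Fam_cmp_eval[OF f[OF k] h x] by (simp add: h_def)
      have "(comp_at (g k) x \<cdot> w k x) \<cdot> comp_at (f k) x = comp_at (g k) x"
        using homD[OF Fam_homD(5)[OF g[OF k] x]] homD[OF is_iso_hom[OF w(1)[OF k x]]]
          homD[OF is_iso_hom[OF iso[OF k x]]] w(2)[OF k x] by simp
      then show "comp_at (cmp F h (f k)) x = comp_at (g k) x"
        using r v[OF k x] unfolding Fam_cmp_eval[OF f[OF k] h x] by (simp add: h_def)
    qed
  next
    fix h' assume h': "h' \<in> hom F P Z \<and> (\<forall>k\<in>K. cmp F h' (f k) = g k)"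
    then have hP: "h' \<in> hom F P Z" by blast
    have eqs: "reindex h' j = reindex h j \<and> comp_at h' j = comp_at h j" if j: "j \<in> idx P" for j
    proof -
      obtain k x where kx: "k \<in> K" "x \<in> idx (X k)" "j = reindex (f k) x" using idx_P[OF j] by blast
      have eq: "cmp F h' (f k) = g k" using h' kx(1) by blast
      note ev = Fam_cmp_eval[OF f[OF kx(1)] hP kx(2)]
      note homs = homD[OF Fam_homD(5)[OF hP j]] homD[OF is_iso_hom[OF w(1)[OF kx(1,2)]]]
        homD[OF is_iso_hom[OF iso[OF kx(1,2)]]]
      obtain w' where w': "w' \<in> ar C" "src C w' = fib P j" "tgt C w' = fib (X k) x"
        "comp_at (f k) x \<cdot> w' = idn C (fib P j)"
        using iso[OF kx(1,2)] unfolding kx(3) by (rule is_isoE)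
      \<comment> \<open>\<open>w\<close> was chosen as a left inverse of the fibre arrow; it agrees
        with any right inverse.\<close>
      have "w' = w k x"
      proof -
        have "w k x = (w k x \<cdot> comp_at (f k) x) \<cdot> w'"
          using homs w' kx(3) by simp
        also have "\<dots> = w'" using homs w' w(2)[OF kx(1,2)] by simp
        finally show ?thesis ..
      qed
      with w' have "(comp_at h' j \<cdot> comp_at (f k) x) \<cdot> w k x = comp_at h' j"
        using homs kx(3) by simp
      then show ?thesis using j v[OF kx(1,2)] ev unfolding eq by (simp add: h_def kx(3))
    qed
    show "h' = h" by (rule Fam_ext[OF hP h]) (use eqs in auto)
  qed
qed

definition fam_sum :: "'i set \<Rightarrow> ('i \<Rightarrow> ('i, 'o) family) \<Rightarrow> ('i, 'o) family" where
  "fam_sum K X = fam (p ` (SIGMA k:K. idx (X k))) (\<lambda>j. fib (X (cfst p j)) (csnd p j))"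

lemma fam_sum_cover:
  assumes "K \<in> \<K>" "\<And>k. k \<in> K \<Longrightarrow> X k \<in> ob F"
  shows "fam_cover K X (fam_sum K X)
    (\<lambda>k. fam_arrow (X k) (fam_sum K X) (\<lambda>x. p (k, x)) (\<lambda>x. idn C (fib (X k) x)))"
  unfolding fam_cover_def
proof (intro conjI ballI)
  show S: "fam_sum K X \<in> ob F"
    unfolding fam_sum_def fam_ob using assms by (auto simp: Fam_ob intro!: Sigma_index)
  have ev: "p (k, x) \<in> idx (fam_sum K X)" "fib (fam_sum K X) (p (k, x)) = fib (X k) x"
    if "k \<in> K" "x \<in> idx (X k)" for k x
    using that by (auto simp: fam_sum_def)
  show "fam_arrow (X k) (fam_sum K X) (\<lambda>x. p (k, x)) (\<lambda>x. idn C (fib (X k) x)) \<in> hom F (X k) (fam_sum K X)"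
    if "k \<in> K" for k
    using that S assms(2) ev by (simp add: idn_hom)
  show "bij_betw (\<lambda>(k, x). reindex (fam_arrow (X k) (fam_sum K X) (\<lambda>x. p (k, x)) (\<lambda>x. idn C (fib (X k) x))) x)
     (SIGMA k:K. idx (X k)) (idx (fam_sum K X))"
    by (rule bij_betw_ballI[where g = "inv p"]) (auto simp: fam_sum_def)
  fix k x assume "k \<in> K" "x \<in> idx (X k)"
  then show "is_iso C (fib (X k) x) (fib (fam_sum K X) (reindex (fam_arrow (X k) (fam_sum K X) (\<lambda>x. p (k, x)) (\<lambda>x. idn C (fib (X k) x))) x))
     (comp_at (fam_arrow (X k) (fam_sum K X) (\<lambda>x. p (k, x)) (\<lambda>x. idn C (fib (X k) x))) x)"
    using ev assms(2) by (simp add: idn_iso)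
qed

lemma fam_cover_cmp_iso:
  assumes c: "fam_cover K X P f" and h: "is_iso F P P' h"
  shows "fam_cover K X P' (\<lambda>k. cmp F h (f k))"
  unfolding fam_cover_def
proof (intro conjI ballI)
  note hh = Fam.is_iso_hom[OF h]
  have f: "\<And>k. k \<in> K \<Longrightarrow> f k \<in> hom F (X k) P"
    and bij: "bij_betw (\<lambda>(k, x). reindex (f k) x) (SIGMA k:K. idx (X k)) (idx P)"
    and iso: "\<And>k x. k \<in> K \<Longrightarrow> x \<in> idx (X k)
      \<Longrightarrow> is_iso C (fib (X k) x) (fib P (reindex (f k) x)) (comp_at (f k) x)"
    using c unfolding fam_cover_def by auto
  show "P' \<in> ob F" using hh by (rule Fam_homD)
  show "k \<in> K \<Longrightarrow> cmp F h (f k) \<in> hom F (X k) P'" for k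
    using Fam.cmp_hom[OF f hh] .
  note ev = Fam_cmp_eval[OF f hh]
  have "bij_betw (reindex h \<circ> (\<lambda>(k, x). reindex (f k) x)) (SIGMA k:K. idx (X k)) (idx P')"
    by (rule bij_betw_trans[OF bij Fam_isoD(1)[OF h]])
  then show "bij_betw (\<lambda>(k, x). reindex (cmp F h (f k)) x) (SIGMA k:K. idx (X k)) (idx P')"
    by (rule bij_betw_cong[THEN iffD1, rotated]) (auto simp: ev)
  show "is_iso C (fib (X k) x) (fib P' (reindex (cmp F h (f k)) x)) (comp_at (cmp F h (f k)) x)"
    if "k \<in> K" "x \<in> idx (X k)" for k x
    using is_iso_cmp[OF iso Fam_isoD(2)[OF h]] Fam_homD(4)[OF f] that by (simp add: ev)
qed

text \<open>Two coproducts of the same diagram are isomorphic under it, and covers are transported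
  along isomorphisms. As a cover \<open>Q\<close> is all that is presupposed, this also serves
  diagrams indexed by \<open>bool\<close>.\<close>

lemma coproduct_fam_cover_if:
  assumes c: "fam_cover K X Q i" and P: "is_coproduct F K X P f"
  shows "fam_cover K X P f"
proof -
  note X = Fam.coproductD(2)[OF P]
  note S = fam_cover_coproduct[OF c]
  obtain h where h: "h \<in> hom F Q P" "\<And>k. k \<in> K \<Longrightarrow> cmp F h (i k) = f k"
    using Fam.coproduct_factor[OF S Fam.coproductD(1)[OF P] Fam.coproductD(3)[OF P]] by metis
  have "is_iso F Q P h"
  proof (rule Fam.coproduct_comparison_iso[OF S P Fam.idn_iso[OF X] h(1)])
    show "k \<in> K \<Longrightarrow> cmp F h (i k) = cmp F (f k) (idn F (X k))" for k
      using h(2) Fam.idn_right[OF Fam.coproductD(3)[OF P]] by metis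
  qed
  note c' = fam_cover_cmp_iso[OF c this]
  obtain v where v: "\<And>k x. k \<in> K \<Longrightarrow> x \<in> idx (X k) \<Longrightarrow> v (reindex (cmp F h (i k)) x) = (k, x)"
    and idx_P: "\<And>j. j \<in> idx P \<Longrightarrow> \<exists>k\<in>K. \<exists>x\<in>idx (X k). j = reindex (cmp F h (i k)) x"
    using fam_cover_index[OF c'] by blast
  show ?thesis
    by (rule fam_coverI[where v = v])
      (use v idx_P fam_coverD[OF c'] h(2) in \<open>auto simp: h(2)\<close>)
qed

text \<open>The preservation axioms quantify over every coproduct cocone and not only over chosen
  sums; this makes them checkable on indices.\<close>

lemma coproduct_fam_cover:
  assumes "K \<in> \<K>" "is_coproduct F K X P f"
  shows "fam_cover K X P f"
  by (rule coproduct_fam_cover_if[OF fam_sum_cover[OF assms(1) Fam.coproductD(2)[OF assms(2)]] assms(2)])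

section \<open>Families form a symmetric 2-rig\<close>

sublocale Fam: symmetric_2rig F \<K>
proof
  show "has_coproducts \<K> F"
    unfolding has_coproducts_def
    using fam_cover_coproduct[OF fam_sum_cover] by blast
  fix A assume A: "A \<in> ob F"
  show "preserves_coproducts \<K> F F (tens F A) (tensa F (idn F A))"
    unfolding preserves_coproducts_def
  proof (intro ballI allI impI fam_cover_coproduct)
    fix K X P f assume K: "K \<in> \<K>" and P_f: "is_coproduct F K X P f"
    note c = coproduct_fam_cover[OF K P_f]
    note P = fam_coverD(1)[OF c] and f = fam_coverD(2)[OF c] and iso = fam_coverD(3)[OF c]
    obtain v where v: "\<And>k x. k \<in> K \<Longrightarrow> x \<in> idx (X k) \<Longrightarrow> v (reindex (f k) x) = (k, x)"
      and idx_P: "\<And>j. j \<in> idx P \<Longrightarrow> \<exists>k\<in>K. \<exists>x\<in>idx (X k). j = reindex (f k) x"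
      using fam_cover_index[OF c] by blast
    have ev: "tensa F (idn F A) (f k) = fam_arrow (fam_tens p C A (X k)) (fam_tens p C A P)
        (\<lambda>j. p (cfst p j, reindex (f k) (csnd p j))) (\<lambda>j. idn C (fib A (cfst p j)) \<boxtimes> comp_at (f k) (csnd p j))"
      if "k \<in> K" for k
      by (subst Fam_homD(1)[OF f[OF that]]) simp
    note ev = ev[unfolded Fam_simps]
    show "fam_cover K (\<lambda>k. tens F A (X k)) (tens F A P) (\<lambda>k. tensa F (idn F A) (f k))"
    proof (rule fam_coverI)
      show "tens F A P \<in> ob F" using A P by simp
      show "k \<in> K \<Longrightarrow> tensa F (idn F A) (f k) \<in> hom F (tens F A (X k)) (tens F A P)" for k
        using Fam.tensa_hom[OF Fam.idn_hom[OF A] f] .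
      \<comment> \<open>An index of \<open>A \<otimes> P\<close> pairs an index of \<open>A\<close>
        with one of \<open>P\<close>; only the latter has to be decoded into a leg and an index of
        that leg.\<close>
      show "(\<lambda>j. (fst (v (csnd p j)), p (cfst p j, snd (v (csnd p j))))) (reindex (tensa F (idn F A) (f k)) x) = (k, x)"
        if "k \<in> K" "x \<in> idx (tens F A (X k))" for k x
        using that by (auto simp: ev v)
      show "\<exists>k\<in>K. \<exists>x\<in>idx (tens F A (X k)). j = reindex (tensa F (idn F A) (f k)) x"
        if "j \<in> idx (tens F A P)" for j
        using that by (auto simp: ev v dest!: idx_P)
      fix k x assume k: "k \<in> K" and "x \<in> idx (tens F A (X k))"
      then obtain a y where a: "a \<in> idx A" and y: "y \<in> idx (X k)" and x: "x = p (a, y)" by auto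
      show "is_iso C (fib (tens F A (X k)) x) (fib (tens F A P) (reindex (tensa F (idn F A) (f k)) x))
         (comp_at (tensa F (idn F A) (f k)) x)"
        using a y k A Fam_homD(4)[OF f[OF k] y] tensa_iso[OF idn_iso iso[OF k y]] by (simp add: ev x)
    qed
  qed
  show "preserves_coproducts \<K> F F (\<lambda>X. tens F X A) (\<lambda>f. tensa F f (idn F A))"
    unfolding preserves_coproducts_def
  proof (intro ballI allI impI fam_cover_coproduct)
    fix K X P f assume K: "K \<in> \<K>" and P_f: "is_coproduct F K X P f"
    note c = coproduct_fam_cover[OF K P_f]
    note P = fam_coverD(1)[OF c] and f = fam_coverD(2)[OF c] and iso = fam_coverD(3)[OF c]
    obtain v where v: "\<And>k x. k \<in> K \<Longrightarrow> x \<in> idx (X k) \<Longrightarrow> v (reindex (f k) x) = (k, x)"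
      and idx_P: "\<And>j. j \<in> idx P \<Longrightarrow> \<exists>k\<in>K. \<exists>x\<in>idx (X k). j = reindex (f k) x"
      using fam_cover_index[OF c] by blast
    have ev: "tensa F (f k) (idn F A) = fam_arrow (fam_tens p C (X k) A) (fam_tens p C P A)
        (\<lambda>j. p (reindex (f k) (cfst p j), csnd p j)) (\<lambda>j. comp_at (f k) (cfst p j) \<boxtimes> idn C (fib A (csnd p j)))"
      if "k \<in> K" for k
      by (subst Fam_homD(1)[OF f[OF that]]) simp
    note ev = ev[unfolded Fam_simps]
    show "fam_cover K (\<lambda>k. tens F (X k) A) (tens F P A) (\<lambda>k. tensa F (f k) (idn F A))"
    proof (rule fam_coverI)
      show "tens F P A \<in> ob F" using A P by simp
      show "k \<in> K \<Longrightarrow> tensa F (f k) (idn F A) \<in> hom F (tens F (X k) A) (tens F P A)" for k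
        using Fam.tensa_hom[OF f Fam.idn_hom[OF A]] .
      show "(\<lambda>j. (fst (v (cfst p j)), p (snd (v (cfst p j)), csnd p j))) (reindex (tensa F (f k) (idn F A)) x) = (k, x)"
        if "k \<in> K" "x \<in> idx (tens F (X k) A)" for k x
        using that by (auto simp: ev v)
      show "\<exists>k\<in>K. \<exists>x\<in>idx (tens F (X k) A). j = reindex (tensa F (f k) (idn F A)) x"
        if "j \<in> idx (tens F P A)" for j
        using that by (auto simp: ev v dest!: idx_P)
      fix k x assume k: "k \<in> K" and "x \<in> idx (tens F (X k) A)"
      then obtain a y where a: "a \<in> idx A" and y: "y \<in> idx (X k)" and x: "x = p (y, a)" by auto
      show "is_iso C (fib (tens F (X k) A) x) (fib (tens F P A) (reindex (tensa F (f k) (idn F A)) x))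
         (comp_at (tensa F (f k) (idn F A)) x)"
        using a y k A Fam_homD(4)[OF f[OF k] y] tensa_iso[OF iso[OF k y] idn_iso] by (simp add: ev x)
    qed
  qed
qed

end

section \<open>The derivation removing a point\<close>

lemma (in category) binary_coproduct_comparison_iso:
  assumes P: "is_binary_coproduct C A B P i j" and Q: "is_binary_coproduct C A' B' Q i' j'"
    and "is_iso C A A' f" "is_iso C B B' g" "h \<in> hom C P Q" "h \<cdot> i = i' \<cdot> f" "h \<cdot> j = j' \<cdot> g"
  shows "is_iso C P Q h"
  by (rule coproduct_comparison_iso[OF P[unfolded is_binary_coproduct_def] Q[unfolded is_binary_coproduct_def],
        where t = "\<lambda>b. if b then f else g"]) (use assms in auto)

lemma ball_Diff: "(\<forall>x\<in>A - B. P x) \<longleftrightarrow> (\<forall>x\<in>A. x \<notin> B \<longrightarrow> P x)"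
  by auto

text \<open>Leibniz's rule on a single set. As these are equalities, not just bijections, the fibres
  at both ends of a strength coincide, and the strengths can be identities on fibres.\<close>

lemma dsum_remove [simp]:
  "dsum A (B - {b}) = dsum A B - {inr b}" "dsum (A - {a}) B = dsum A B - {inl a}"
  by (auto simp: mem_dsum)

lemma bij_betw_remove:
  assumes "bij_betw f A B" "a \<in> A"
  shows "bij_betw f (A - {a}) (B - {f a})"
  using assms by (auto simp: bij_betw_def inj_on_def)

lemma bij_betw_amap [simp]:
  assumes "S \<subseteq> A"
  shows "bij_betw (amap (map_arrow A B f)) S T \<longleftrightarrow> bij_betw f S T"
  by (rule bij_betw_cong) (use assms in auto)

text \<open>The injection \<open>e\<close> codes points of finite sets as indices, so that an index
  with a marked point of its fibre can again be an index.\<close>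

locale species_completion = fam_completion FinBij \<K> p s
  for \<K> :: "'i set set" and p :: "'i \<times> 'i \<Rightarrow> 'i" and s :: 'i +
  fixes e :: "nat \<Rightarrow> 'i"
  assumes inj_e: "inj e"
begin

lemma inv_e [simp]: "inv e (e a) = a"
  by (simp add: inj_e)

lemma e_eq [simp]: "e a = e b \<longleftrightarrow> a = b"
  by (rule inj_eq[OF inj_e])

text \<open>Injectivity is recorded as an equivalence for the simplifier: it shows that an arrow
  maps the complement of a marked point into the complement of its image.\<close>

lemma Fam_FinBij_homE:
  assumes "f \<in> hom F X Y"
  obtains u \<tau> where "f = fam_arrow X Y u (\<lambda>i. map_arrow (fib X i) (fib Y (u i)) (\<tau> i))"
    "X \<in> ob F" "Y \<in> ob F" "\<forall>i\<in>idx X. u i \<in> idx Y"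
    "\<forall>i\<in>idx X. bij_betw (\<tau> i) (fib X i) (fib Y (u i))"
    "\<forall>i\<in>idx X. \<forall>x\<in>fib X i. \<tau> i x \<in> fib Y (u i)"
    "\<forall>i\<in>idx X. \<forall>x\<in>fib X i. \<forall>y\<in>fib X i. \<tau> i x = \<tau> i y \<longleftrightarrow> x = y"
proof (rule that[of "reindex f" "\<lambda>i. amap (comp_at f i)"])
  note f = Fam_homD[OF assms]
  note t = FinBij_hom_dest[OF f(5)]
  show "f = fam_arrow X Y (reindex f) (\<lambda>i. map_arrow (fib X i) (fib Y (reindex f i)) (amap (comp_at f i)))"
    by (subst f(1), unfold fam_arrow_eq) (use t(1) in auto)
  show "X \<in> ob F" "Y \<in> ob F" by fact+
  show "\<forall>i\<in>idx X. \<forall>x\<in>fib X i. \<forall>y\<in>fib X i. amap (comp_at f i) x = amap (comp_at f i) y \<longleftrightarrow> x = y"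
  proof (intro ballI)
    fix i x y assume "i \<in> idx X" "x \<in> fib X i" "y \<in> fib X i"
    then show "amap (comp_at f i) x = amap (comp_at f i) y \<longleftrightarrow> x = y"
      using bij_betw_imp_inj_on[OF t(4)] inj_on_eq_iff by metis
  qed
qed (use Fam_homD[OF assms] FinBij_hom_dest[OF Fam_homD(5)[OF assms]] in auto)

definition D_ob :: "('i, nat set) family \<Rightarrow> ('i, nat set) family" where
  "D_ob X = fam (p ` (SIGMA i:idx X. e ` fib X i)) (\<lambda>k. fib X (cfst p k) - {inv e (csnd p k)})"

text \<open>Arrows carry the marked point along. The left strength moves the mark into the right
  summand by \<open>inr\<close>, the right strength into the left summand by \<open>inl\<close>; the
  sets of unmarked points agree already, hence the identities.\<close>

definition std_deriv ::
  "(('i, nat set) family, ('i, nat set, (nat set, nat \<Rightarrow> nat) arrow) family_arrow) deriv" where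
  "std_deriv =
    \<lparr> dob = D_ob,
      dar = (\<lambda>f. fam_arrow (D_ob (asrc f)) (D_ob (atgt f))
        (\<lambda>k. p (reindex f (cfst p k), e (amap (comp_at f (cfst p k)) (inv e (csnd p k)))))
        (\<lambda>k. map_arrow (fib (asrc f) (cfst p k) - {inv e (csnd p k)})
           (fib (atgt f) (reindex f (cfst p k)) - {amap (comp_at f (cfst p k)) (inv e (csnd p k))})
           (amap (comp_at f (cfst p k))))),
      lstr = (\<lambda>R A. fam_arrow (fam_tens p FinBij R (D_ob A)) (D_ob (fam_tens p FinBij R A))
        (\<lambda>k. p (p (cfst p k, cfst p (csnd p k)), e (inr (inv e (csnd p (csnd p k))))))
        (\<lambda>k. idn FinBij (fib (fam_tens p FinBij R (D_ob A)) k))),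
      rstr = (\<lambda>A R. fam_arrow (fam_tens p FinBij (D_ob A) R) (D_ob (fam_tens p FinBij A R))
        (\<lambda>k. p (p (cfst p (cfst p k), csnd p k), e (inl (inv e (csnd p (cfst p k))))))
        (\<lambda>k. idn FinBij (fib (fam_tens p FinBij (D_ob A) R) k))) \<rparr>"

lemma ball_D_ob [simp]: "(\<forall>k\<in>idx (D_ob X). P k) \<longleftrightarrow> (\<forall>i\<in>idx X. \<forall>a\<in>fib X i. P (p (i, e a)))"
  by (auto simp: D_ob_def)

lemma mem_D_ob [simp]: "p (i, e a) \<in> idx (D_ob X) \<longleftrightarrow> i \<in> idx X \<and> a \<in> fib X i"
  by (auto simp: D_ob_def)

lemma D_obE:
  assumes "k \<in> idx (D_ob X)"
  obtains i a where "i \<in> idx X" "a \<in> fib X i" "k = p (i, e a)"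
  using assms by (auto simp: D_ob_def)

lemma fib_D_ob [simp]: "i \<in> idx X \<Longrightarrow> a \<in> fib X i \<Longrightarrow> fib (D_ob X) (p (i, e a)) = fib X i - {a}"
  unfolding D_ob_def by (subst fam_simps(2)) auto

lemma D_ob_ob [simp]: "X \<in> ob F \<Longrightarrow> D_ob X \<in> ob F"
  unfolding D_ob_def fam_ob by (auto simp: Fam_ob intro: finite_index intro!: Sigma_index)

lemma finite_fib [simp]: "X \<in> ob F \<Longrightarrow> i \<in> idx X \<Longrightarrow> finite (fib X i)"
  using fib_ob by simp

lemma std_deriv_simps [simp]:
  "dob std_deriv = D_ob"
  "dar std_deriv (fam_arrow X Y u t) = fam_arrow (D_ob X) (D_ob Y)
     (\<lambda>k. p (u (cfst p k), e (amap (t (cfst p k)) (inv e (csnd p k)))))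
     (\<lambda>k. map_arrow (fib X (cfst p k) - {inv e (csnd p k)})
        (fib Y (u (cfst p k)) - {amap (t (cfst p k)) (inv e (csnd p k))}) (amap (t (cfst p k))))"
  "lstr std_deriv R A = fam_arrow (fam_tens p FinBij R (D_ob A)) (D_ob (fam_tens p FinBij R A))
     (\<lambda>k. p (p (cfst p k, cfst p (csnd p k)), e (inr (inv e (csnd p (csnd p k))))))
     (\<lambda>k. idn FinBij (fib (fam_tens p FinBij R (D_ob A)) k))"
  "rstr std_deriv A R = fam_arrow (fam_tens p FinBij (D_ob A) R) (D_ob (fam_tens p FinBij A R))
     (\<lambda>k. p (p (cfst p (cfst p k), csnd p k), e (inl (inv e (csnd p (cfst p k))))))
     (\<lambda>k. idn FinBij (fib (fam_tens p FinBij (D_ob A) R) k))"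
  by (simp_all add: std_deriv_def fam_arrow_eq)

lemma empty_initial:
  assumes "X \<in> ob F" "idx X = {}"
  shows "is_initial F X"
  unfolding is_initial_def
proof (intro conjI ballI assms(1))
  fix A assume A: "A \<in> ob F"
  show "\<exists>!f. f \<in> hom F X A"
  proof (rule ex1I)
    show "fam_arrow X A undefined undefined \<in> hom F X A"
      using assms A by simp
    show "f = fam_arrow X A undefined undefined" if "f \<in> hom F X A" for f
      using that assms A by (intro Fam_ext) auto
  qed
qed

lemma std_functor: "cat_functor F F D_ob (dar std_deriv)"
proof (unfold_locales, goal_cases)
  case 1 then show ?case by simp
next
  case 2
  then show ?case by (auto elim!: Fam_FinBij_homE simp: bij_betw_remove)
next
  case 3 then show ?case by (simp add: fam_arrow_eq map_arrow_eq)
next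
  case 4
  then show ?case
    by (elim Fam_FinBij_homE) (simp add: fam_arrow_eq map_arrow_eq ball_Diff)
qed

lemma std_coproducts: "preserves_coproducts \<K> F F D_ob (dar std_deriv)"
  unfolding preserves_coproducts_def
proof (intro ballI allI impI fam_cover_coproduct)
  interpret std: cat_functor F F D_ob "dar std_deriv" by (rule std_functor)
  fix K X P f assume K: "K \<in> \<K>" and P_f: "is_coproduct F K X P f"
  note c = coproduct_fam_cover[OF K P_f]
  note P = fam_coverD(1)[OF c] and f = fam_coverD(2)[OF c]
  obtain v where v: "\<And>k x. k \<in> K \<Longrightarrow> x \<in> idx (X k) \<Longrightarrow> v (reindex (f k) x) = (k, x)"
    and idx_P: "\<And>j. j \<in> idx P \<Longrightarrow> \<exists>k\<in>K. \<exists>x\<in>idx (X k). j = reindex (f k) x"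
    using fam_cover_index[OF c] by blast
  note Df = std.fun_hom[OF f]
  have ev: "reindex (dar std_deriv (f k)) (p (i, e a)) = p (reindex (f k) i, e (amap (comp_at (f k) i) a))"
    if "k \<in> K" "i \<in> idx (X k)" "a \<in> fib (X k) i" for k i a
    using that by (subst Fam_homD(1)[OF f[OF that(1)]]) simp
  note bij = FinBij_hom_dest(4)[OF Fam_homD(5)[OF f]]
  show "fam_cover K (\<lambda>k. D_ob (X k)) (D_ob P) (\<lambda>k. dar std_deriv (f k))"
  proof (rule fam_coverI)
    show "D_ob P \<in> ob F" using P by simp
    show "k \<in> K \<Longrightarrow> dar std_deriv (f k) \<in> hom F (D_ob (X k)) (D_ob P)" for k using Df .
    fix k y assume k: "k \<in> K" and "y \<in> idx (D_ob (X k))"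
    then obtain i a where y: "i \<in> idx (X k)" "a \<in> fib (X k) i" "y = p (i, e a)" by (auto elim: D_obE)
    \<comment> \<open>The index is decoded by \<open>v\<close>, and the marked point is pulled back
      along the fibre bijection.\<close>
    show "(\<lambda>j. case v (cfst p j) of (k, i) \<Rightarrow>
        (k, p (i, e (inv_into (fib (X k) i) (amap (comp_at (f k) i)) (inv e (csnd p j))))))
        (reindex (dar std_deriv (f k)) y) = (k, y)"
      using y k v ev[OF k y(1,2)] bij_betw_inv_into_left[OF bij[OF k y(1)] y(2)] by simp
    show "is_iso FinBij (fib (D_ob (X k)) y) (fib (D_ob P) (reindex (dar std_deriv (f k)) y))
      (comp_at (dar std_deriv (f k)) y)"
      using Fam_homD(5)[OF Df[OF k] \<open>y \<in> _\<close>] by (rule FinBij_iso)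
  next
    fix j assume "j \<in> idx (D_ob P)"
    then obtain l b where j: "l \<in> idx P" "b \<in> fib P l" "j = p (l, e b)" by (auto elim: D_obE)
    obtain k i where ki: "k \<in> K" "i \<in> idx (X k)" "l = reindex (f k) i" using idx_P[OF j(1)] by blast
    have "b \<in> amap (comp_at (f k) i) ` fib (X k) i"
      using bij[OF ki(1,2)] j(2) ki(3) by (simp add: bij_betw_def)
    then obtain a where a: "a \<in> fib (X k) i" "b = amap (comp_at (f k) i) a" by blast
    have "j = reindex (dar std_deriv (f k)) (p (i, e a))"
      using ev[OF ki(1,2) a(1)] ki(3) j(3) a(2) by simp
    then show "\<exists>k\<in>K. \<exists>y\<in>idx (D_ob (X k)). j = reindex (dar std_deriv (f k)) y"
      using ki a mem_D_ob by blast
  qed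
qed

lemma std_strength_hom:
  assumes "R \<in> ob F" "A \<in> ob F"
  shows "lstr std_deriv R A \<in> hom F (tens F R (D_ob A)) (D_ob (tens F R A))"
    and "rstr std_deriv A R \<in> hom F (tens F (D_ob A) R) (D_ob (tens F A R))"
  using assms by (auto simp: bij_betw_id[unfolded id_def])

text \<open>A marked point of a disjoint union lies in exactly one summand.\<close>

lemma std_leibniz:
  assumes "A \<in> ob F" "B \<in> ob F"
  shows "is_binary_coproduct F (tens F (D_ob A) B) (tens F A (D_ob B)) (D_ob (tens F A B))
    (rstr std_deriv A B) (lstr std_deriv A B)"
  unfolding is_binary_coproduct_def
proof (rule fam_cover_coproduct, rule fam_coverI)
  note homs = std_strength_hom(1)[OF assms] std_strength_hom(2)[OF assms(2,1)]
  show "D_ob (tens F A B) \<in> ob F" using assms by simp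
  show hom: "(if b then rstr std_deriv A B else lstr std_deriv A B)
      \<in> hom F (if b then tens F (D_ob A) B else tens F A (D_ob B)) (D_ob (tens F A B))" for b
    using homs by simp
  fix b x assume x: "x \<in> idx (if b then tens F (D_ob A) B else tens F A (D_ob B))"
  \<comment> \<open>The summand containing the mark selects the leg: \<open>True\<close> is the
    right strength, with the mark in \<open>A\<close>, and \<open>False\<close> the left strength,
    with the mark in \<open>B\<close>.\<close>
  show "(\<lambda>k. dcase (\<lambda>a. (True, p (p (cfst p (cfst p k), e a), csnd p (cfst p k))))
      (\<lambda>a. (False, p (cfst p (cfst p k), p (csnd p (cfst p k), e a)))) (inv e (csnd p k)))
      (reindex (if b then rstr std_deriv A B else lstr std_deriv A B) x) = (b, x)"
    using x by (cases b) (auto elim!: D_obE)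
  show "is_iso FinBij (fib (if b then tens F (D_ob A) B else tens F A (D_ob B)) x)
     (fib (D_ob (tens F A B)) (reindex (if b then rstr std_deriv A B else lstr std_deriv A B) x))
     (comp_at (if b then rstr std_deriv A B else lstr std_deriv A B) x)"
    by (rule FinBij_iso[OF Fam_homD(5)[OF hom x]])
next
  fix j assume "j \<in> idx (D_ob (tens F A B))"
  then obtain i k x where j: "i \<in> idx A" "k \<in> idx B" "x \<in> dsum (fib A i) (fib B k)" "j = p (p (i, k), e x)"
    by (auto elim!: D_obE)
  from j(3) consider a where "a \<in> fib A i" "x = inl a" | b where "b \<in> fib B k" "x = inr b"
    by (auto simp: mem_dsum)
  then show "\<exists>b\<in>UNIV. \<exists>y\<in>idx (if b then tens F (D_ob A) B else tens F A (D_ob B)).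
      j = reindex (if b then rstr std_deriv A B else lstr std_deriv A B) y"
  proof cases
    case 1
    with j show ?thesis by (intro bexI[of _ True] bexI[of _ "p (p (i, e a), k)"]) auto
  next
    case 2
    with j show ?thesis by (intro bexI[of _ False] bexI[of _ "p (i, p (k, e b))"]) auto
  qed
qed

sublocale std: derivation F \<K> std_deriv
proof (intro derivation.intro derivation_axioms.intro, goal_cases)
  case 1 show ?case by (rule Fam.symmetric_2rig_axioms)
next
  case 2 show ?case using std_functor by simp
next
  case 3 show ?case using std_coproducts by simp
next
  case 4 then show ?case using std_strength_hom by simp
next
  case 5 then show ?case using std_strength_hom by simp
next
  case 6
  then show ?case
    by (elim Fam_FinBij_homE) (simp add: fam_arrow_eq map_arrow_eq ball_Diff ball_dsum)
next
  case 7
  then show ?case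
    by (elim Fam_FinBij_homE) (simp add: fam_arrow_eq map_arrow_eq ball_Diff ball_dsum)
next
  case 8 then show ?case by (simp add: fam_arrow_eq map_arrow_eq ball_Diff ball_dsum)
next
  case 9 then show ?case by (simp add: fam_arrow_eq map_arrow_eq ball_Diff ball_dsum)
next
  case 10 then show ?case by (simp add: fam_arrow_eq map_arrow_eq ball_Diff ball_dsum)
next
  case 11 then show ?case by (simp add: fam_arrow_eq map_arrow_eq ball_Diff ball_dsum)
next
  case 12 then show ?case by (simp add: fam_arrow_eq map_arrow_eq ball_Diff ball_dsum)
next
  \<comment> \<open>The axiom allows any coproduct \<open>P\<close>, which is therefore compared
    with the concrete one of \<open>std_leibniz\<close>.\<close>
  case (13 A B P i j h)
  note Q = std_leibniz[OF 13(1,2)]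
  have "h \<in> hom F P (D_ob (tens F A B))" using 13 by simp
  from Fam.binary_coproduct_comparison_iso[OF 13(3)[unfolded std_deriv_simps(1)] Q Fam.idn_iso Fam.idn_iso this]
  show ?case
    using 13 Fam.idn_right[OF std_strength_hom(1)[OF 13(1,2)]]
      Fam.idn_right[OF std_strength_hom(2)[OF 13(2,1)]] by simp
next
  \<comment> \<open>The only fibre of the unit is the empty set, so there is nothing to mark and its
    derivative has no indices.\<close>
  case (14 Z h)
  show ?case
    by (rule Fam.initial_iso[OF 14(1) empty_initial 14(2)])
      (auto simp: finite_index elim: D_obE)
qed

end

section \<open>Derivations sending the generator to the unit\<close>

context category
begin

text \<open>Composition with \<open>u\<close> and with the inverse of \<open>v\<close> loses
  nothing. Applied to the unit and to \<open>Y\<close>, this yields equations between arrows of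
  which only source and target are known.\<close>

lemma thin_transfer:
  assumes thin: "\<And>f g. f \<in> hom C A B \<Longrightarrow> g \<in> hom C A B \<Longrightarrow> f = g"
    and u: "is_iso C A A' u" and v: "is_iso C B B' v"
    and f: "f \<in> hom C A' B'" and g: "g \<in> hom C A' B'"
  shows "f = g"
proof -
  obtain v' where v': "is_iso C B' B v'" "v' \<cdot> v = idn C B" "v \<cdot> v' = idn C B'"
    using v by (rule iso_inverse)
  have "v' \<cdot> f \<cdot> u = v' \<cdot> g \<cdot> u"
    by (rule thin) (use f g homD[OF is_iso_hom[OF u]] homD[OF is_iso_hom[OF v'(1)]] in \<open>auto simp: hom_def\<close>)
  then have "f \<cdot> u = g \<cdot> u"
    by (rule iso_mono[OF v'(1) cmp_hom[OF is_iso_hom[OF u] f] cmp_hom[OF is_iso_hom[OF u] g]])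
  then show ?thesis by (rule iso_epi[OF u f g])
qed

end

section \<open>Symmetries of triple tensor products\<close>

context symmetric_monoidal_category
begin

text \<open>The record names only the associator, so its inverse is chosen.\<close>

definition asci :: "'o \<Rightarrow> 'o \<Rightarrow> 'o \<Rightarrow> 'a" where
  "asci A B D = (SOME g. is_iso C (A \<otimes> B \<otimes> D) ((A \<otimes> B) \<otimes> D) g \<and>
     g \<cdot> asc C A B D = idn C ((A \<otimes> B) \<otimes> D) \<and> asc C A B D \<cdot> g = idn C (A \<otimes> B \<otimes> D))"

lemma asci:
  assumes "A \<in> ob C" "B \<in> ob C" "D \<in> ob C"
  shows "is_iso C (A \<otimes> B \<otimes> D) ((A \<otimes> B) \<otimes> D) (asci A B D)"
    "asci A B D \<cdot> asc C A B D = idn C ((A \<otimes> B) \<otimes> D)"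
    "asc C A B D \<cdot> asci A B D = idn C (A \<otimes> B \<otimes> D)"
proof -
  have "\<exists>g. is_iso C (A \<otimes> B \<otimes> D) ((A \<otimes> B) \<otimes> D) g \<and>
     g \<cdot> asc C A B D = idn C ((A \<otimes> B) \<otimes> D) \<and> asc C A B D \<cdot> g = idn C (A \<otimes> B \<otimes> D)"
    using iso_inverse[OF asc_iso[OF assms]] by metis
  from someI_ex[OF this] show "is_iso C (A \<otimes> B \<otimes> D) ((A \<otimes> B) \<otimes> D) (asci A B D)"
    "asci A B D \<cdot> asc C A B D = idn C ((A \<otimes> B) \<otimes> D)"
    "asc C A B D \<cdot> asci A B D = idn C (A \<otimes> B \<otimes> D)"
    unfolding asci_def by auto
qed

lemma asci_simps [simp]:
  assumes "A \<in> ob C" "B \<in> ob C" "D \<in> ob C"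
  shows "asci A B D \<in> ar C" "src C (asci A B D) = A \<otimes> B \<otimes> D" "tgt C (asci A B D) = (A \<otimes> B) \<otimes> D"
  using is_iso_hom[OF asci(1)[OF assms]] by (auto simp: hom_def)

lemma asci_cancel [simp]:
  assumes "A \<in> ob C" "B \<in> ob C" "D \<in> ob C" "f \<in> ar C"
  shows "tgt C f = (A \<otimes> B) \<otimes> D \<Longrightarrow> asci A B D \<cdot> asc C A B D \<cdot> f = f"
    "tgt C f = A \<otimes> B \<otimes> D \<Longrightarrow> asc C A B D \<cdot> asci A B D \<cdot> f = f"
  using assms asci by (simp_all add: cancel_left)

lemma tensa_cmp_left: "f \<in> ar C \<Longrightarrow> g \<in> ar C \<Longrightarrow> tgt C f = src C g \<Longrightarrow> A \<in> ob C
    \<Longrightarrow> (g \<cdot> f) \<boxtimes> idn C A = (g \<boxtimes> idn C A) \<cdot> (f \<boxtimes> idn C A)"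
  and tensa_cmp_right: "f \<in> ar C \<Longrightarrow> g \<in> ar C \<Longrightarrow> tgt C f = src C g \<Longrightarrow> A \<in> ob C
    \<Longrightarrow> idn C A \<boxtimes> (g \<cdot> f) = (idn C A \<boxtimes> g) \<cdot> (idn C A \<boxtimes> f)"
  by (simp_all add: tensa_cmp')

text \<open>\<open>kap\<close> keeps the generator as the last factor, whereas a right strength
  appends a factor after it; this isomorphism restores the order between left-nested
  products.\<close>

definition swap_last :: "'o \<Rightarrow> 'o \<Rightarrow> 'o \<Rightarrow> 'a" where
  "swap_last R S Z = asci R Z S \<cdot> (idn C R \<boxtimes> brd C S Z) \<cdot> asc C R S Z"

lemma swap_last_simps [simp]:
  assumes "R \<in> ob C" "S \<in> ob C" "Z \<in> ob C"
  shows "swap_last R S Z \<in> ar C" "src C (swap_last R S Z) = (R \<otimes> S) \<otimes> Z"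
    "tgt C (swap_last R S Z) = (R \<otimes> Z) \<otimes> S"
  using assms by (simp_all add: swap_last_def)

lemma swap_last_iso:
  assumes "R \<in> ob C" "S \<in> ob C" "Z \<in> ob C"
  shows "is_iso C ((R \<otimes> S) \<otimes> Z) ((R \<otimes> Z) \<otimes> S) (swap_last R S Z)"
  unfolding swap_last_def
  using assms by (intro is_iso_cmp[OF is_iso_cmp[OF asc_iso]] tensa_iso idn_iso brd_iso asci
      is_iso_cmp[OF asc_iso] is_iso_cmp[where B = "R \<otimes> (Z \<otimes> S)"]) auto

text \<open>This is the second hexagon, for braiding a product past \<open>Z\<close>. By symmetry it
  follows from the first: both sides agree after composition with the invertible
  \<open>asc C S T Z\<close> and \<open>brd C Z (S \<otimes> T)\<close>.\<close>

lemma hexagon_swap_last: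
  assumes "S \<in> ob C" "T \<in> ob C" "Z \<in> ob C"
  shows "asc C Z S T \<cdot> (brd C S Z \<boxtimes> idn C T) \<cdot> swap_last S T Z = brd C (S \<otimes> T) Z"
proof -
  note [simp] = assms
  let ?h = "asc C Z S T \<cdot> (brd C S Z \<boxtimes> idn C T) \<cdot> swap_last S T Z"
  have c1: "(brd C Z S \<boxtimes> idn C T) \<cdot> (brd C S Z \<boxtimes> idn C T) = idn C ((S \<otimes> Z) \<otimes> T)"
    by (simp add: tensa_cmp' brd_brd tensa_idn)
  have c2: "(idn C S \<boxtimes> brd C Z T) \<cdot> (idn C S \<boxtimes> brd C T Z) = idn C (S \<otimes> T \<otimes> Z)"
    by (simp add: tensa_cmp' brd_brd tensa_idn)
  have "asc C S T Z \<cdot> brd C Z (S \<otimes> T) \<cdot> ?h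
      = (asc C S T Z \<cdot> brd C Z (S \<otimes> T) \<cdot> asc C Z S T) \<cdot> (brd C S Z \<boxtimes> idn C T) \<cdot> swap_last S T Z"
    by simp
  also have "\<dots> = (idn C S \<boxtimes> brd C Z T) \<cdot> asc C S Z T \<cdot>
      ((brd C Z S \<boxtimes> idn C T) \<cdot> (brd C S Z \<boxtimes> idn C T)) \<cdot> swap_last S T Z"
    by (simp add: hexagon)
  also have "\<dots> = ((idn C S \<boxtimes> brd C Z T) \<cdot> (idn C S \<boxtimes> brd C T Z)) \<cdot> asc C S T Z"
    by (simp only: c1) (simp add: swap_last_def)
  also have "\<dots> = asc C S T Z \<cdot> brd C Z (S \<otimes> T) \<cdot> brd C (S \<otimes> T) Z"
    by (simp add: c2 brd_brd)
  finally have "brd C Z (S \<otimes> T) \<cdot> ?h = brd C Z (S \<otimes> T) \<cdot> brd C (S \<otimes> T) Z"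
    by (rule iso_mono[OF asc_iso[OF assms], rotated 2]) (auto simp: hom_def)
  then show ?thesis
    by (rule iso_mono[OF brd_iso[OF assms(3) tens_ob[OF assms(1,2)]], rotated 2]) (auto simp: hom_def)
qed

text \<open>The hexagon expresses \<open>b \<cdot> a\<close> by the braiding of one factor past the
  other two, and naturality of that braiding moves the swap of those two through it.\<close>

lemma yang_baxter:
  assumes "A \<in> ob C"
  defines "a \<equiv> brd C A A \<boxtimes> idn C A" and "b \<equiv> swap_last A A A"
  shows "a \<cdot> b \<cdot> a = b \<cdot> a \<cdot> b"
proof -
  note [simp] = assms(1)
  have ba: "b \<cdot> a = brd C A (A \<otimes> A) \<cdot> asc C A A A"
  proof -
    have "b \<cdot> a = asci A A A \<cdot> (asc C A A A \<cdot> brd C A (A \<otimes> A) \<cdot> asc C A A A)"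
      by (simp add: hexagon a_def b_def swap_last_def)
    then show ?thesis by simp
  qed
  have nat: "brd C A (A \<otimes> A) \<cdot> (idn C A \<boxtimes> brd C A A) = a \<cdot> brd C A (A \<otimes> A)"
    unfolding a_def by (rule brd_natural) (simp_all add: hom_def)
  have "b \<cdot> a \<cdot> b = (b \<cdot> a) \<cdot> b" by (simp add: a_def b_def)
  also have "\<dots> = (brd C A (A \<otimes> A) \<cdot> (idn C A \<boxtimes> brd C A A)) \<cdot> asc C A A A"
    unfolding ba by (simp add: b_def swap_last_def)
  also have "\<dots> = a \<cdot> (b \<cdot> a)"
    unfolding nat ba by (simp add: a_def)
  finally show ?thesis by simp
qed

end

section \<open>Derivations on an arbitrary 2-rig\<close>

context derivation
begin

lemma dob_ob [simp]: "A \<in> ob C \<Longrightarrow> dob D A \<in> ob C"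
  by (rule fun_ob)

lemma dar_simps [simp]:
  assumes "f \<in> ar C"
  shows "dar D f \<in> ar C" "src C (dar D f) = dob D (src C f)" "tgt C (dar D f) = dob D (tgt C f)"
  using fun_hom[of f "src C f" "tgt C f"] assms by (auto simp: hom_def)

lemma dar_cmp: "f \<in> ar C \<Longrightarrow> g \<in> ar C \<Longrightarrow> tgt C f = src C g \<Longrightarrow> dar D g \<cdot> dar D f = dar D (g \<cdot> f)"
  by (rule fun_cmp[symmetric]) (auto simp: hom_def)

lemma lstr_simps [simp]:
  assumes "R \<in> ob C" "A \<in> ob C"
  shows "lstr D R A \<in> ar C" "src C (lstr D R A) = R \<otimes> dob D A" "tgt C (lstr D R A) = dob D (R \<otimes> A)"
  using lstr_hom[OF assms] by (auto simp: hom_def)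

lemma rstr_simps [simp]:
  assumes "A \<in> ob C" "R \<in> ob C"
  shows "rstr D A R \<in> ar C" "src C (rstr D A R) = dob D A \<otimes> R" "tgt C (rstr D A R) = dob D (A \<otimes> R)"
  using rstr_hom[OF assms] by (auto simp: hom_def)

lemma dar_iso:
  assumes "is_iso C A B f"
  shows "is_iso C (dob D A) (dob D B) (dar D f)"
proof -
  obtain g where "f \<in> ar C" "src C f = A" "tgt C f = B" "g \<in> ar C" "src C g = B" "tgt C g = A"
    "g \<cdot> f = idn C A" "f \<cdot> g = idn C B" "A \<in> ob C" "B \<in> ob C"
    using assms by (rule is_isoE)
  then show ?thesis
    by (intro is_isoI[where g = "dar D g"]) (simp_all add: hom_def dar_cmp fun_idn)
qed

text \<open>The axiom only says that the comparison out of a given coproduct is invertible;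
  composing with it makes the two strengths themselves a coproduct cocone. Some \<open>P\<close> has
  to be supplied, since a 2-rig only promises coproducts over members of
  \<open>\<K>\<close>.\<close>

lemma leibniz_coproduct:
  assumes A: "A \<in> ob C" and B: "B \<in> ob C"
    and P: "is_binary_coproduct C (dob D A \<otimes> B) (A \<otimes> dob D B) P i j"
  shows "is_binary_coproduct C (dob D A \<otimes> B) (A \<otimes> dob D B) (dob D (A \<otimes> B)) (rstr D A B) (lstr D A B)"
proof -
  let ?X = "\<lambda>b. if b then dob D A \<otimes> B else A \<otimes> dob D B"
  let ?i = "\<lambda>b. if b then i else j"
  have cop: "is_coproduct C UNIV ?X P ?i"
    using P unfolding is_binary_coproduct_def .
  obtain h where h: "h \<in> hom C P (dob D (A \<otimes> B))"
    "\<And>b. b \<in> UNIV \<Longrightarrow> h \<cdot> ?i b = (if b then rstr D A B else lstr D A B)"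
    by (rule coproduct_factor[OF cop, of "dob D (A \<otimes> B)" "\<lambda>b. if b then rstr D A B else lstr D A B"])
      (use A B lstr_hom rstr_hom in auto)
  have h': "h \<cdot> i = rstr D A B" "h \<cdot> j = lstr D A B"
    using h(2)[of True] h(2)[of False] by auto
  have "(\<lambda>b. h \<cdot> ?i b) = (\<lambda>b. if b then rstr D A B else lstr D A B)"
    using h' by auto
  with coproduct_cmp_iso[OF cop leibniz[OF A B P h(1) h']] show ?thesis
    unfolding is_binary_coproduct_def by simp
qed

lemma d_unit_initial:
  assumes "is_initial C Z"
  shows "is_initial C (dob D (unt C))"
proof -
  obtain h where h: "h \<in> hom C Z (dob D (unt C))"
    using initial_ex[OF assms dob_ob[OF unt_ob]] .
  show ?thesis by (rule initial_transfer[OF assms d_unit[OF assms h]])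
qed

end

text \<open>The facts about the free 2-rig from which uniqueness is derived. Thinness reflects that
  a set with at most one point has no symmetries, \<open>connected\<close> that the representable
  \<open>Y\<close> is connected, and \<open>swap_free\<close> that an injective map changes when two
  points are exchanged.\<close>

locale generated_2rig = symmetric_2rig C \<K>
  for C :: "('o, 'a, 'z) moncat_scheme" (structure) and \<K> :: "'k set set" +
  fixes Y :: 'o
  assumes Y_ob [simp]: "Y \<in> ob C"
    and unit_thin: "f \<in> hom C (unt C) (unt C) \<Longrightarrow> f = idn C (unt C)"
    and Y_thin: "f \<in> hom C Y Y \<Longrightarrow> f = idn C Y"
    and initial: "\<exists>Z. is_initial C Z"
    and binary_coproduct: "A \<in> ob C \<Longrightarrow> B \<in> ob C \<Longrightarrow> \<exists>P i j. is_binary_coproduct C A B P i j"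
    and connected: "is_binary_coproduct C A B P i j \<Longrightarrow> f \<in> hom C (Y \<otimes> unt C) P \<Longrightarrow>
      (\<exists>w \<in> hom C (Y \<otimes> unt C) A. f = i \<cdot> w) \<or> (\<exists>w \<in> hom C (Y \<otimes> unt C) B. f = j \<cdot> w)"
    and swap_free: "f \<in> hom C ((Y \<otimes> Y) \<otimes> unt C) Z \<Longrightarrow> f \<cdot> (brd C Y Y \<boxtimes> idn C (unt C)) \<noteq> f"
begin

text \<open>In the free 2-rigs these include all representables. The induction principle reduces
  claims to the unit, \<open>Y\<close> and tensor products, where the unit axiom, the chosen point
  and Leibniz's rule apply.\<close>

inductive generated :: "'o \<Rightarrow> bool" where
  generated_unit: "generated (unt C)"
| generated_Y: "generated Y"
| generated_tens: "generated A \<Longrightarrow> generated B \<Longrightarrow> generated (A \<otimes> B)"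
| generated_iso: "generated A \<Longrightarrow> is_iso C A B f \<Longrightarrow> generated B"

lemma generated_ob [simp]: "generated A \<Longrightarrow> A \<in> ob C"
  by (induction rule: generated.induct) (auto elim: is_isoE)

end

section \<open>Elements of a derivation and its right strength\<close>

locale pointed_derivation = generated_2rig C \<K> Y + derivation C \<K> D
  for C :: "('o, 'a, 'z) moncat_scheme" (structure) and \<K> :: "'k set set" and Y :: 'o
    and D :: "('o, 'a) deriv" +
  fixes \<phi> :: 'a
  assumes \<phi>_iso: "is_iso C (unt C) (dob D Y) \<phi>"
begin

lemma \<phi>_simps [simp]: "\<phi> \<in> ar C" "src C \<phi> = unt C" "tgt C \<phi> = dob D Y"
  using is_iso_hom[OF \<phi>_iso] by (auto simp: hom_def)

text \<open>For the derivative of species this is, by Yoneda, the passage from elements of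
  \<open>A\<close> at \<open>R + 1\<close> to elements of \<open>\<partial>A\<close> at
  \<open>R\<close>. The source is \<open>R \<otimes> I\<close> rather than \<open>R\<close> so that
  no unitor enters the equations.\<close>

definition kap :: "'o \<Rightarrow> 'a \<Rightarrow> 'a" where
  "kap R g = dar D g \<cdot> lstr D R Y \<cdot> (idn C R \<boxtimes> \<phi>)"

lemma kap_simps [simp]:
  assumes "R \<in> ob C" "g \<in> ar C" "src C g = R \<otimes> Y"
  shows "kap R g \<in> ar C" "src C (kap R g) = R \<otimes> unt C" "tgt C (kap R g) = dob D (tgt C g)"
  using assms by (simp_all add: kap_def)

lemma dar_kap:
  assumes "R \<in> ob C" "g \<in> ar C" "src C g = R \<otimes> Y" "h \<in> ar C" "src C h = tgt C g"
  shows "dar D h \<cdot> kap R g = kap R (h \<cdot> g)"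
proof -
  have "dar D h \<cdot> kap R g = (dar D h \<cdot> dar D g) \<cdot> lstr D R Y \<cdot> (idn C R \<boxtimes> \<phi>)"
    using assms by (simp add: kap_def)
  then show ?thesis using assms by (simp only: dar_cmp kap_def)
qed

lemma kap_idn: "R \<in> ob C \<Longrightarrow> kap R (idn C (R \<otimes> Y)) = lstr D R Y \<cdot> (idn C R \<boxtimes> \<phi>)"
  by (simp add: kap_def fun_idn)

text \<open>Change of parameter is naturality of the left strength in its first argument, since
  \<open>r\<close> and \<open>\<phi>\<close> act on different factors.\<close>

lemma kap_natural:
  assumes r: "r \<in> ar C" "src C r = R" "tgt C r = S" and g: "g \<in> ar C" "src C g = S \<otimes> Y"
  shows "kap S g \<cdot> (r \<boxtimes> idn C (unt C)) = kap R (g \<cdot> (r \<boxtimes> idn C Y))"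
proof -
  have [simp]: "R \<in> ob C" "S \<in> ob C" using r by auto
  have e1: "(idn C S \<boxtimes> \<phi>) \<cdot> (r \<boxtimes> idn C (unt C)) = (r \<boxtimes> dar D (idn C Y)) \<cdot> (idn C R \<boxtimes> \<phi>)"
    using r by (simp add: tensa_cmp' fun_idn)
  have e2: "lstr D S Y \<cdot> (r \<boxtimes> dar D (idn C Y)) = dar D (r \<boxtimes> idn C Y) \<cdot> lstr D R Y"
    by (rule lstr_natural) (use r in \<open>simp_all add: hom_def\<close>)
  have "kap S g \<cdot> (r \<boxtimes> idn C (unt C)) = dar D g \<cdot> lstr D S Y \<cdot> ((idn C S \<boxtimes> \<phi>) \<cdot> (r \<boxtimes> idn C (unt C)))"
    using r g by (simp add: kap_def)
  also have "\<dots> = dar D g \<cdot> (lstr D S Y \<cdot> (r \<boxtimes> dar D (idn C Y))) \<cdot> (idn C R \<boxtimes> \<phi>)"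
    unfolding e1 using r g by simp
  also have "\<dots> = dar D g \<cdot> kap R (r \<boxtimes> idn C Y)"
    unfolding e2 kap_def using r g by simp
  finally show ?thesis using r g by (simp add: dar_kap)
qed

text \<open>Associativity merges two successive left strengths into one, so a left strength turns
  elements into elements.\<close>

lemma lstr_kap:
  assumes "S \<in> ob C" "R \<in> ob C" and g: "g \<in> ar C" "src C g = R \<otimes> Y" "tgt C g = A"
  shows "lstr D S A \<cdot> (idn C S \<boxtimes> kap R g) \<cdot> asc C S R (unt C) = kap (S \<otimes> R) ((idn C S \<boxtimes> g) \<cdot> asc C S R Y)"
proof -
  note [simp] = assms
  have [simp]: "A \<in> ob C" using tgt_ob[OF g(1)] by simp
  have e1: "lstr D S A \<cdot> (idn C S \<boxtimes> dar D g) = dar D (idn C S \<boxtimes> g) \<cdot> lstr D S (R \<otimes> Y)"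
    by (rule lstr_natural) (simp_all add: hom_def)
  have e2: "(idn C S \<boxtimes> (idn C R \<boxtimes> \<phi>)) \<cdot> asc C S R (unt C) = asc C S R (dob D Y) \<cdot> ((idn C S \<boxtimes> idn C R) \<boxtimes> \<phi>)"
    by (rule asc_natural[symmetric]) (simp_all add: hom_def)
  have "lstr D S A \<cdot> (idn C S \<boxtimes> kap R g) \<cdot> asc C S R (unt C)
     = (lstr D S A \<cdot> (idn C S \<boxtimes> dar D g)) \<cdot> (idn C S \<boxtimes> lstr D R Y) \<cdot>
       ((idn C S \<boxtimes> (idn C R \<boxtimes> \<phi>)) \<cdot> asc C S R (unt C))"
    by (simp add: kap_def tensa_cmp_right)
  also have "\<dots> = dar D (idn C S \<boxtimes> g) \<cdot> (lstr D S (R \<otimes> Y) \<cdot> (idn C S \<boxtimes> lstr D R Y) \<cdot> asc C S R (dob D Y)) \<cdot>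
      ((idn C S \<boxtimes> idn C R) \<boxtimes> \<phi>)"
    unfolding e1 e2 by simp
  also have "\<dots> = dar D (idn C S \<boxtimes> g) \<cdot> kap (S \<otimes> R) (asc C S R Y)"
    unfolding lstr_assoc[OF assms(1,2) Y_ob, symmetric] by (simp add: kap_def tensa_idn)
  finally show ?thesis by (simp add: dar_kap)
qed

text \<open>Counterpart of \<open>kap\<close> in which the point is extended by the right strength,
  with the generator in front.\<close>

definition rho :: "'o \<Rightarrow> 'a" where
  "rho S = rstr D Y S \<cdot> (\<phi> \<boxtimes> idn C S)"

lemma rho_simps [simp]:
  assumes "S \<in> ob C"
  shows "rho S \<in> ar C" "src C (rho S) = unt C \<otimes> S" "tgt C (rho S) = dob D (Y \<otimes> S)"
  using assms by (simp_all add: rho_def)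

text \<open>Stated for the single element \<open>\<phi>\<close>; by \<open>rstr_kap\<close> this
  already controls the right strength with \<open>S\<close> on all elements.\<close>

definition symmetric_at :: "'o \<Rightarrow> bool" where
  "symmetric_at S \<longleftrightarrow> rho S \<cdot> brd C S (unt C) = kap S (brd C S Y)"

text \<open>Compatibility of the two strengths reduces the right strength of
  \<open>R \<otimes> Y\<close> with \<open>S\<close> to that of \<open>Y\<close> with
  \<open>S\<close>, where \<open>symmetric_at S\<close> turns it into a left strength.\<close>

lemma rstr_kap:
  assumes "symmetric_at S" "S \<in> ob C" "R \<in> ob C" and g: "g \<in> ar C" "src C g = R \<otimes> Y" "tgt C g = A"
  shows "rstr D A S \<cdot> (kap R g \<boxtimes> idn C S) \<cdot> swap_last R S (unt C)
    = kap (R \<otimes> S) ((g \<boxtimes> idn C S) \<cdot> swap_last R S Y)"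
proof -
  note [simp] = assms(2-)
  have [simp]: "A \<in> ob C" using tgt_ob[OF g(1)] by simp
  have e1: "rstr D A S \<cdot> (dar D g \<boxtimes> idn C S) = dar D (g \<boxtimes> idn C S) \<cdot> rstr D (R \<otimes> Y) S"
    by (rule rstr_natural) (simp_all add: hom_def)
  \<comment> \<open>This solves \<open>lstr_rstr\<close> for the right strength, by cancelling the
    image of the associator.\<close>
  have "dar D (asci R Y S) \<cdot> (dar D (asc C R Y S) \<cdot> rstr D (R \<otimes> Y) S \<cdot> (lstr D R Y \<boxtimes> idn C S))
      = (dar D (asci R Y S) \<cdot> dar D (asc C R Y S)) \<cdot> rstr D (R \<otimes> Y) S \<cdot> (lstr D R Y \<boxtimes> idn C S)"
    by simp
  also have "\<dots> = rstr D (R \<otimes> Y) S \<cdot> (lstr D R Y \<boxtimes> idn C S)"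
    by (simp add: dar_cmp asci fun_idn)
  finally have e2: "rstr D (R \<otimes> Y) S \<cdot> (lstr D R Y \<boxtimes> idn C S) =
      dar D (asci R Y S) \<cdot> lstr D R (Y \<otimes> S) \<cdot> (idn C R \<boxtimes> rstr D Y S) \<cdot> asc C R (dob D Y) S"
    by (simp add: lstr_rstr)
  have e3: "asc C R (dob D Y) S \<cdot> ((idn C R \<boxtimes> \<phi>) \<boxtimes> idn C S)
      = (idn C R \<boxtimes> (\<phi> \<boxtimes> idn C S)) \<cdot> asc C R (unt C) S"
    by (rule asc_natural) (simp_all add: hom_def)
  \<comment> \<open>Unfolding \<open>swap_last\<close> cancels the associators and leaves
    \<open>rho S \<cdot> brd C S (unt C)\<close> under \<open>R\<close>, the left side of
    \<open>symmetric_at S\<close>.\<close>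
  have e4: "(idn C R \<boxtimes> rstr D Y S) \<cdot> (idn C R \<boxtimes> (\<phi> \<boxtimes> idn C S)) \<cdot> asc C R (unt C) S \<cdot> swap_last R S (unt C)
      = (idn C R \<boxtimes> kap S (brd C S Y)) \<cdot> asc C R S (unt C)"
    by (simp add: swap_last_def flip: assms(1)[unfolded symmetric_at_def])
      (simp add: rho_def tensa_cmp_right)
  have "rstr D A S \<cdot> (kap R g \<boxtimes> idn C S) \<cdot> swap_last R S (unt C)
      = (rstr D A S \<cdot> (dar D g \<boxtimes> idn C S)) \<cdot> (lstr D R Y \<boxtimes> idn C S) \<cdot> ((idn C R \<boxtimes> \<phi>) \<boxtimes> idn C S)
        \<cdot> swap_last R S (unt C)"
    by (simp add: kap_def tensa_cmp_left)
  also have "\<dots> = dar D (g \<boxtimes> idn C S) \<cdot> (rstr D (R \<otimes> Y) S \<cdot> (lstr D R Y \<boxtimes> idn C S)) \<cdot>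
      ((idn C R \<boxtimes> \<phi>) \<boxtimes> idn C S) \<cdot> swap_last R S (unt C)"
    unfolding e1 by simp
  also have "\<dots> = dar D (g \<boxtimes> idn C S) \<cdot> dar D (asci R Y S) \<cdot> lstr D R (Y \<otimes> S) \<cdot> (idn C R \<boxtimes> rstr D Y S) \<cdot>
      (asc C R (dob D Y) S \<cdot> ((idn C R \<boxtimes> \<phi>) \<boxtimes> idn C S)) \<cdot> swap_last R S (unt C)"
    unfolding e2 by simp
  also have "\<dots> = dar D (g \<boxtimes> idn C S) \<cdot> dar D (asci R Y S) \<cdot> lstr D R (Y \<otimes> S) \<cdot>
      ((idn C R \<boxtimes> rstr D Y S) \<cdot> (idn C R \<boxtimes> (\<phi> \<boxtimes> idn C S)) \<cdot> asc C R (unt C) S \<cdot> swap_last R S (unt C))"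
    unfolding e3 by simp
  also have "\<dots> = dar D (g \<boxtimes> idn C S) \<cdot> dar D (asci R Y S) \<cdot>
      kap (R \<otimes> S) ((idn C R \<boxtimes> brd C S Y) \<cdot> asc C R S Y)"
    unfolding e4 by (simp add: lstr_kap)
  finally show ?thesis by (simp add: dar_kap swap_last_def)
qed

text \<open>Associativity of the right strength adds \<open>S\<close> and \<open>T\<close> one after
  the other: \<open>symmetric_at S\<close> handles the first, \<open>rstr_kap\<close> at
  \<open>T\<close> the second, and the second hexagon joins the two braidings.\<close>

lemma symmetric_at_tens:
  assumes "symmetric_at S" "symmetric_at T" "S \<in> ob C" "T \<in> ob C"
  shows "symmetric_at (S \<otimes> T)"
proof -
  note [simp] = assms(3,4)
  have e1: "(\<phi> \<boxtimes> idn C (S \<otimes> T)) \<cdot> asc C (unt C) S T = asc C (dob D Y) S T \<cdot> ((\<phi> \<boxtimes> idn C S) \<boxtimes> idn C T)"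
    by (subst tensa_idn[symmetric], simp, simp, rule asc_natural[symmetric]) (simp_all add: hom_def)
  have "rho (S \<otimes> T) \<cdot> asc C (unt C) S T = rstr D Y (S \<otimes> T) \<cdot> ((\<phi> \<boxtimes> idn C (S \<otimes> T)) \<cdot> asc C (unt C) S T)"
    by (simp add: rho_def)
  also have "\<dots> = (rstr D Y (S \<otimes> T) \<cdot> asc C (dob D Y) S T) \<cdot> ((\<phi> \<boxtimes> idn C S) \<boxtimes> idn C T)"
    unfolding e1 by simp
  also have "\<dots> = dar D (asc C Y S T) \<cdot> rstr D (Y \<otimes> S) T \<cdot> (rho S \<boxtimes> idn C T)"
    by (simp add: rstr_assoc rho_def tensa_cmp_left)
  finally have e2: "rho (S \<otimes> T) \<cdot> asc C (unt C) S T = dar D (asc C Y S T) \<cdot> rstr D (Y \<otimes> S) T \<cdot> (rho S \<boxtimes> idn C T)" .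
  have "rho (S \<otimes> T) \<cdot> brd C (S \<otimes> T) (unt C)
      = (rho (S \<otimes> T) \<cdot> asc C (unt C) S T) \<cdot> (brd C S (unt C) \<boxtimes> idn C T) \<cdot> swap_last S T (unt C)"
    by (simp flip: hexagon_swap_last)
  also have "\<dots> = dar D (asc C Y S T) \<cdot> rstr D (Y \<otimes> S) T \<cdot>
      ((rho S \<cdot> brd C S (unt C)) \<boxtimes> idn C T) \<cdot> swap_last S T (unt C)"
    unfolding e2 by (simp add: tensa_cmp_left)
  also have "\<dots> = dar D (asc C Y S T) \<cdot> kap (S \<otimes> T) ((brd C S Y \<boxtimes> idn C T) \<cdot> swap_last S T Y)"
    unfolding assms(1)[unfolded symmetric_at_def] by (simp add: rstr_kap assms(2))
  also have "\<dots> = kap (S \<otimes> T) (brd C (S \<otimes> T) Y)"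
    by (simp add: dar_kap hexagon_swap_last)
  finally show ?thesis unfolding symmetric_at_def .
qed

lemma symmetric_at_iso:
  assumes S: "symmetric_at S" and r: "is_iso C S S' r"
  shows "symmetric_at S'"
proof -
  note [simp] = homD[OF is_iso_hom[OF r]]
  have [simp]: "S \<in> ob C" "S' \<in> ob C" using hom_ob[OF is_iso_hom[OF r]] by auto
  have e1: "brd C S' (unt C) \<cdot> (r \<boxtimes> idn C (unt C)) = (idn C (unt C) \<boxtimes> r) \<cdot> brd C S (unt C)"
    by (rule brd_natural) (simp_all add: hom_def)
  have e2: "rstr D Y S' \<cdot> (dar D (idn C Y) \<boxtimes> r) = dar D (idn C Y \<boxtimes> r) \<cdot> rstr D Y S"
    by (rule rstr_natural) (simp_all add: hom_def)
  have e3: "(idn C Y \<boxtimes> r) \<cdot> brd C S Y = brd C S' Y \<cdot> (r \<boxtimes> idn C Y)"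
    by (rule brd_natural[symmetric]) (simp_all add: hom_def)
  have "rho S' \<cdot> (idn C (unt C) \<boxtimes> r) = (rstr D Y S' \<cdot> (dar D (idn C Y) \<boxtimes> r)) \<cdot> (\<phi> \<boxtimes> idn C S)"
    by (simp add: rho_def tensa_cmp' fun_idn)
  then have e4: "rho S' \<cdot> (idn C (unt C) \<boxtimes> r) = dar D (idn C Y \<boxtimes> r) \<cdot> rho S"
    unfolding e2 by (simp add: rho_def)
  have "(rho S' \<cdot> brd C S' (unt C)) \<cdot> (r \<boxtimes> idn C (unt C)) = (rho S' \<cdot> (idn C (unt C) \<boxtimes> r)) \<cdot> brd C S (unt C)"
    by (simp add: e1)
  also have "\<dots> = dar D (idn C Y \<boxtimes> r) \<cdot> (rho S \<cdot> brd C S (unt C))"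
    unfolding e4 by simp
  also have "\<dots> = kap S' (brd C S' Y) \<cdot> (r \<boxtimes> idn C (unt C))"
    unfolding S[unfolded symmetric_at_def] by (simp add: dar_kap e3 kap_natural)
  finally show ?thesis
    unfolding symmetric_at_def
    by (rule iso_epi[OF tensa_iso[OF r idn_iso[OF unt_ob]], rotated 2]) (simp_all add: hom_def)
qed

lemma thin_unit:
  assumes "is_iso C (unt C) A u" "is_iso C (unt C) B v" "f \<in> hom C A B" "g \<in> hom C A B"
  shows "f = g"
  by (rule thin_transfer[OF _ assms]) (use unit_thin in blast)

lemma thin_Y:
  assumes "is_iso C Y A u" "is_iso C Y B v" "f \<in> hom C A B" "g \<in> hom C A B"
  shows "f = g"
  by (rule thin_transfer[OF _ assms]) (use Y_thin in blast)

text \<open>Both sides run between copies of the unit, as \<open>\<partial>(Y \<otimes> I)\<close>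
  is isomorphic to \<open>\<partial>Y\<close>, so they cannot differ.\<close>

lemma symmetric_at_unit: "symmetric_at (unt C)"
proof -
  obtain u where u: "is_iso C (unt C) (unt C \<otimes> unt C) u"
    using iso_inverse[OF run_iso[OF unt_ob]] .
  obtain v where v: "is_iso C Y (Y \<otimes> unt C) v"
    using iso_inverse[OF run_iso[OF Y_ob]] .
  show ?thesis
    unfolding symmetric_at_def
    by (rule thin_unit[OF u is_iso_cmp[OF \<phi>_iso dar_iso[OF v]]]) (simp_all add: hom_def)
qed

lemma symmetric_at_Y: "symmetric_at Y"
proof (rule ccontr)
  assume not_sym: "\<not> symmetric_at Y"
  obtain v where v: "is_iso C Y (Y \<otimes> unt C) v"
    using iso_inverse[OF run_iso[OF Y_ob]] .
  \<comment> \<open>Both summands of \<open>\<partial>(Y \<otimes> Y)\<close> are copies of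
    \<open>Y\<close>, so a factorisation through either one is forced by thinness.\<close>
  have left: "is_iso C Y (Y \<otimes> dob D Y) ((idn C Y \<boxtimes> \<phi>) \<cdot> v)"
    by (rule is_iso_cmp[OF v tensa_iso[OF idn_iso[OF Y_ob] \<phi>_iso]])
  have right: "is_iso C Y (dob D Y \<otimes> Y) ((\<phi> \<boxtimes> idn C Y) \<cdot> brd C Y (unt C) \<cdot> v)"
    by (rule is_iso_cmp[OF is_iso_cmp[OF v brd_iso[OF Y_ob unt_ob]] tensa_iso[OF \<phi>_iso idn_iso[OF Y_ob]]])
  obtain P i j where P: "is_binary_coproduct C (dob D Y \<otimes> Y) (Y \<otimes> dob D Y) P i j"
    using binary_coproduct[of "dob D Y \<otimes> Y" "Y \<otimes> dob D Y"] by auto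
  note cop = leibniz_coproduct[OF Y_ob Y_ob P]
  have khom: "kap Y (brd C Y Y) \<in> hom C (Y \<otimes> unt C) (dob D (Y \<otimes> Y))"
    by (simp add: hom_def)
  \<comment> \<open>A factorisation through the right strength would be the denied symmetry, so the
    left strength absorbs the braiding.\<close>
  have K: "kap Y (brd C Y Y) = kap Y (idn C (Y \<otimes> Y))"
    using connected[OF cop khom]
  proof (elim disjE bexE)
    fix w assume w: "w \<in> hom C (Y \<otimes> unt C) (dob D Y \<otimes> Y)" "kap Y (brd C Y Y) = rstr D Y Y \<cdot> w"
    have "w = (\<phi> \<boxtimes> idn C Y) \<cdot> brd C Y (unt C)"
      by (rule thin_Y[OF v right w(1)]) (simp add: hom_def)
    with w(2) have "symmetric_at Y" by (simp add: symmetric_at_def rho_def)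
    with not_sym show ?thesis by blast
  next
    fix w assume w: "w \<in> hom C (Y \<otimes> unt C) (Y \<otimes> dob D Y)" "kap Y (brd C Y Y) = lstr D Y Y \<cdot> w"
    have "w = idn C Y \<boxtimes> \<phi>"
      by (rule thin_Y[OF v left w(1)]) (simp add: hom_def)
    with w(2) show ?thesis by (simp add: kap_idn)
  qed
  define T where "T = Y \<otimes> Y"
  have T [simp]: "T \<in> ob C" by (simp add: T_def)
  define a where "a = brd C Y Y \<boxtimes> idn C Y"
  define b where "b = swap_last Y Y Y"
  define \<sigma> where "\<sigma> = brd C Y Y \<boxtimes> idn C (unt C)"
  have a [simp]: "a \<in> ar C" "src C a = T \<otimes> Y" "tgt C a = T \<otimes> Y" by (simp_all add: a_def T_def)
  have b [simp]: "b \<in> ar C" "src C b = T \<otimes> Y" "tgt C b = T \<otimes> Y" by (simp_all add: b_def T_def)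
  have \<sigma> [simp]: "\<sigma> \<in> ar C" "src C \<sigma> = T \<otimes> unt C" "tgt C \<sigma> = T \<otimes> unt C" by (simp_all add: \<sigma>_def T_def)
  \<comment> \<open>As \<open>b\<close> braids the last two factors, \<open>lstr_kap\<close> exposes
    \<open>kap Y (brd C Y Y)\<close> under the outer \<open>Y\<close>, and there \<open>K\<close>
    removes the braiding.\<close>
  have "kap T b = dar D (asci Y Y Y) \<cdot> lstr D Y (Y \<otimes> Y) \<cdot> (idn C Y \<boxtimes> kap Y (brd C Y Y)) \<cdot> asc C Y Y (unt C)"
    by (simp add: lstr_kap dar_kap b_def swap_last_def T_def)
  also have "\<dots> = kap T (idn C (T \<otimes> Y))"
    unfolding K by (simp add: lstr_kap dar_kap T_def tensa_idn asci)
  finally have kb: "kap T b = kap T (idn C (T \<otimes> Y))" .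
  have kap_b: "kap T (g \<cdot> b) = kap T g" if "g \<in> ar C" "src C g = T \<otimes> Y" for g
    using that dar_kap[of T b g] dar_kap[of T "idn C (T \<otimes> Y)" g] by (simp add: kb)
  \<comment> \<open>\<open>a\<close> acts on the parameter \<open>T\<close> only, so it leaves
    \<open>kap\<close> as \<open>\<sigma>\<close>.\<close>
  have kap_a: "kap T (g \<cdot> a) = kap T g \<cdot> \<sigma>" if "g \<in> ar C" "src C g = T \<otimes> Y" for g
    unfolding a_def \<sigma>_def using that by (subst kap_natural) (simp_all add: T_def)
  define k where "k = kap T (idn C (T \<otimes> Y))"
  have k [simp]: "k \<in> ar C" "src C k = T \<otimes> unt C" by (simp_all add: k_def)
  have ka: "kap T a = k \<cdot> \<sigma>" using kap_a[of "idn C (T \<otimes> Y)"] by (simp add: k_def)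
  have \<sigma>\<sigma>: "\<sigma> \<cdot> \<sigma> = idn C (T \<otimes> unt C)"
    by (simp add: \<sigma>_def tensa_cmp' brd_brd tensa_idn T_def)
  \<comment> \<open>In \<open>a \<cdot> b \<cdot> a\<close> two factors \<open>\<sigma>\<close>
    cancel, whereas \<open>b \<cdot> a \<cdot> b\<close> leaves one; the braid relation equates the
    results.\<close>
  have "kap T (a \<cdot> b \<cdot> a) = kap T ((a \<cdot> b) \<cdot> a)" by simp
  also have "\<dots> = kap T (a \<cdot> b) \<cdot> \<sigma>" by (rule kap_a) simp_all
  also have "\<dots> = k \<cdot> \<sigma> \<cdot> \<sigma>" by (simp add: kap_b ka)
  also have "\<dots> = k" by (simp add: \<sigma>\<sigma>)
  finally have aba: "kap T (a \<cdot> b \<cdot> a) = k" .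
  have "kap T (b \<cdot> a \<cdot> b) = kap T ((b \<cdot> a) \<cdot> b)" by simp
  also have "\<dots> = kap T (b \<cdot> a)" by (rule kap_b) simp_all
  also have "\<dots> = k \<cdot> \<sigma>" by (simp add: kap_a kb k_def)
  finally have bab: "kap T (b \<cdot> a \<cdot> b) = k \<cdot> \<sigma>" .
  have "k \<cdot> \<sigma> = k"
    using aba bab yang_baxter[OF Y_ob] by (simp add: a_def b_def)
  moreover have "k \<in> hom C ((Y \<otimes> Y) \<otimes> unt C) (tgt C k)"
    using k by (simp add: hom_def T_def)
  ultimately show False using swap_free unfolding \<sigma>_def by blast
qed

lemma symmetric_at_generated: "generated S \<Longrightarrow> symmetric_at S"
  by (induction rule: generated.induct)
    (auto intro: symmetric_at_unit symmetric_at_Y symmetric_at_tens symmetric_at_iso)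

end

section \<open>Comparing two derivations\<close>

text \<open>In \<open>points\<close> the arrows \<open>g k\<close> act as universal elements: their
  \<open>kap\<close> arrows present \<open>\<partial>A\<close> as a coproduct, and every arrow from
  \<open>S \<otimes> Y\<close> with \<open>S\<close> generated comes from some \<open>g k\<close> by
  change of parameter. Generated parameters keep \<open>symmetric_at\<close> available.\<close>

locale dense_derivation = pointed_derivation C \<K> Y E \<psi>
  for C :: "('o, 'a, 'z) moncat_scheme" (structure) and \<K> :: "'k set set" and Y :: 'o
    and E :: "('o, 'a) deriv" and \<psi> :: 'a +
  assumes generated_cover: "A \<in> ob C \<Longrightarrow>
      \<exists>K\<in>\<K>. \<exists>R i. (\<forall>k\<in>K. generated (R k)) \<and> is_coproduct C K R A i"
    and points: "A \<in> ob C \<Longrightarrow> \<exists>K\<in>\<K>. \<exists>R g.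
      (\<forall>k\<in>K. generated (R k) \<and> g k \<in> hom C (R k \<otimes> Y) A) \<and>
      is_coproduct C K (\<lambda>k. R k \<otimes> unt C) (dob E A) (\<lambda>k. kap (R k) (g k)) \<and>
      (\<forall>S h. generated S \<longrightarrow> h \<in> hom C (S \<otimes> Y) A \<longrightarrow>
        (\<exists>k\<in>K. \<exists>r\<in>hom C S (R k). h = g k \<cdot> (r \<boxtimes> idn C Y)))"

begin

lemma pointsE:
  assumes "A \<in> ob C"
  obtains K R g where "K \<in> \<K>" "\<forall>k\<in>K. generated (R k)" "\<forall>k\<in>K. g k \<in> hom C (R k \<otimes> Y) A"
    "is_coproduct C K (\<lambda>k. R k \<otimes> unt C) (dob E A) (\<lambda>k. kap (R k) (g k))"
    "\<forall>S h. generated S \<longrightarrow> h \<in> hom C (S \<otimes> Y) A \<longrightarrow>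
        (\<exists>k\<in>K. \<exists>r\<in>hom C S (R k). h = g k \<cdot> (r \<boxtimes> idn C Y))"
proof -
  from points[OF assms] obtain K R g where K: "K \<in> \<K>" and *: "(\<forall>k\<in>K. generated (R k) \<and> g k \<in> hom C (R k \<otimes> Y) A) \<and>
      is_coproduct C K (\<lambda>k. R k \<otimes> unt C) (dob E A) (\<lambda>k. kap (R k) (g k)) \<and>
      (\<forall>S h. generated S \<longrightarrow> h \<in> hom C (S \<otimes> Y) A \<longrightarrow>
        (\<exists>k\<in>K. \<exists>r\<in>hom C S (R k). h = g k \<cdot> (r \<boxtimes> idn C Y)))"
    by (elim bexE exE) (rule that)
  show ?thesis by (rule that[of K R g]) (use K * in simp_all)
qed

end

locale comparison = generated_2rig C \<K> Y + E: dense_derivation C \<K> Y E \<psi> + D: pointed_derivation C \<K> Y D \<phi>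
  for C :: "('o, 'a, 'z) moncat_scheme" (structure) and \<K> :: "'k set set" and Y :: 'o
    and E :: "('o, 'a) deriv" and \<psi> :: 'a and D :: "('o, 'a) deriv" and \<phi> :: 'a
begin

lemma point_ext:
  assumes A: "A \<in> ob C" and f: "f \<in> hom C (dob E A) Z" and f': "f' \<in> hom C (dob E A) Z"
    and eq: "\<And>S g. generated S \<Longrightarrow> g \<in> hom C (S \<otimes> Y) A \<Longrightarrow> f \<cdot> E.kap S g = f' \<cdot> E.kap S g"
  shows "f = f'"
proof -
  obtain K R g where K: "K \<in> \<K>"
    and gens: "\<forall>k\<in>K. generated (R k)" "\<forall>k\<in>K. g k \<in> hom C (R k \<otimes> Y) A"
    and c: "is_coproduct C K (\<lambda>k. R k \<otimes> unt C) (dob E A) (\<lambda>k. E.kap (R k) (g k))"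
    and fac: "\<forall>S h. generated S \<longrightarrow> h \<in> hom C (S \<otimes> Y) A \<longrightarrow>
        (\<exists>k\<in>K. \<exists>r\<in>hom C S (R k). h = g k \<cdot> (r \<boxtimes> idn C Y))"
    by (rule E.pointsE[OF A])
  note g = bspec[OF gens(1)] bspec[OF gens(2)]
  show ?thesis by (rule coproduct_epi[OF c f f']) (rule eq[OF g])
qed

text \<open>The coproduct prescribes values on the universal elements only; naturality in the
  parameter spreads the equation to all \<open>g\<close>.\<close>

lemma ex_theta:
  assumes A: "A \<in> ob C"
  shows "\<exists>h. h \<in> hom C (dob E A) (dob D A) \<and>
    (\<forall>S g. generated S \<longrightarrow> g \<in> hom C (S \<otimes> Y) A \<longrightarrow> h \<cdot> E.kap S g = D.kap S g)"
proof -
  obtain K R g where K: "K \<in> \<K>"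
    and gens: "\<forall>k\<in>K. generated (R k)" "\<forall>k\<in>K. g k \<in> hom C (R k \<otimes> Y) A"
    and c: "is_coproduct C K (\<lambda>k. R k \<otimes> unt C) (dob E A) (\<lambda>k. E.kap (R k) (g k))"
    and fac: "\<forall>S h. generated S \<longrightarrow> h \<in> hom C (S \<otimes> Y) A \<longrightarrow>
        (\<exists>k\<in>K. \<exists>r\<in>hom C S (R k). h = g k \<cdot> (r \<boxtimes> idn C Y))"
    by (rule E.pointsE[OF A])
  note g = bspec[OF gens(1)] bspec[OF gens(2)]
  have "D.kap (R k) (g k) \<in> hom C (R k \<otimes> unt C) (dob D A)" if "k \<in> K" for k
    using g[OF that] by (auto simp: hom_def)
  then obtain h where h: "h \<in> hom C (dob E A) (dob D A)"
    "\<And>k. k \<in> K \<Longrightarrow> h \<cdot> E.kap (R k) (g k) = D.kap (R k) (g k)"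
    using coproduct_factor[OF c D.dob_ob[OF A], of "\<lambda>k. D.kap (R k) (g k)"] by blast
  have "h \<cdot> E.kap S f = D.kap S f" if S: "generated S" and f: "f \<in> hom C (S \<otimes> Y) A" for S f
  proof -
    obtain k r where k: "k \<in> K" and r: "r \<in> hom C S (R k)" and eq: "f = g k \<cdot> (r \<boxtimes> idn C Y)"
      using fac[rule_format, OF S f] by blast
    note [simp] = homD[OF r] homD[OF g(2)[OF k]] homD[OF h(1)] generated_ob[OF S] generated_ob[OF g(1)[OF k]]
    have "E.kap S f = E.kap (R k) (g k) \<cdot> (r \<boxtimes> idn C (unt C))"
      by (simp add: eq E.kap_natural)
    then have "h \<cdot> E.kap S f = (h \<cdot> E.kap (R k) (g k)) \<cdot> (r \<boxtimes> idn C (unt C))"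
      by simp
    then show ?thesis by (simp add: h(2)[OF k] eq D.kap_natural)
  qed
  with h(1) show ?thesis by blast
qed

definition theta :: "'o \<Rightarrow> 'a" where
  "theta A = (SOME h. h \<in> hom C (dob E A) (dob D A) \<and>
    (\<forall>S g. generated S \<longrightarrow> g \<in> hom C (S \<otimes> Y) A \<longrightarrow> h \<cdot> E.kap S g = D.kap S g))"

lemma theta_hom: "A \<in> ob C \<Longrightarrow> theta A \<in> hom C (dob E A) (dob D A)"
  and theta_kap: "generated S \<Longrightarrow> g \<in> hom C (S \<otimes> Y) A \<Longrightarrow> theta A \<cdot> E.kap S g = D.kap S g"
  using someI_ex[OF ex_theta] hom_ob(2)[of g "S \<otimes> Y" A] unfolding theta_def by blast+

lemma theta_simps [simp]:
  assumes "A \<in> ob C"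
  shows "theta A \<in> ar C" "src C (theta A) = dob E A" "tgt C (theta A) = dob D A"
  using theta_hom[OF assms] by (auto simp: hom_def)

lemma theta_natural:
  assumes f: "f \<in> hom C A B"
  shows "theta B \<cdot> dar E f = dar D f \<cdot> theta A"
proof (rule point_ext)
  note ob [simp] = hom_ob[OF f]
  note [simp] = homD[OF f]
  show "A \<in> ob C" "theta B \<cdot> dar E f \<in> hom C (dob E A) (dob D B)" "dar D f \<cdot> theta A \<in> hom C (dob E A) (dob D B)"
    by (simp_all add: hom_def)
  fix S g assume S: "generated S" and g: "g \<in> hom C (S \<otimes> Y) A"
  note [simp] = homD[OF g] generated_ob[OF S]
  have fg: "f \<cdot> g \<in> hom C (S \<otimes> Y) B" by (rule cmp_hom[OF g f])
  show "(theta B \<cdot> dar E f) \<cdot> E.kap S g = (dar D f \<cdot> theta A) \<cdot> E.kap S g"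
    using theta_kap[OF S g] theta_kap[OF S fg] by (simp add: E.dar_kap D.dar_kap)
qed

text \<open>On the universal elements of \<open>\<partial>A\<close> both sides become
  \<open>kap\<close> arrows by \<open>lstr_kap\<close>. Their parameter is
  \<open>S \<otimes> R k\<close>, which is why \<open>S\<close> is taken generated first.\<close>

lemma theta_lstr_generated:
  assumes S: "generated S" and A: "A \<in> ob C"
  shows "theta (S \<otimes> A) \<cdot> lstr E S A = lstr D S A \<cdot> (idn C S \<boxtimes> theta A)"
proof -
  note Sob [simp] = generated_ob[OF S]
  note [simp] = A
  obtain K R g where K: "K \<in> \<K>"
    and gens: "\<forall>k\<in>K. generated (R k)" "\<forall>k\<in>K. g k \<in> hom C (R k \<otimes> Y) A"
    and c: "is_coproduct C K (\<lambda>k. R k \<otimes> unt C) (dob E A) (\<lambda>k. E.kap (R k) (g k))"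
    and fac: "\<forall>S h. generated S \<longrightarrow> h \<in> hom C (S \<otimes> Y) A \<longrightarrow>
        (\<exists>k\<in>K. \<exists>r\<in>hom C S (R k). h = g k \<cdot> (r \<boxtimes> idn C Y))"
    by (rule E.pointsE[OF A])
  note g = bspec[OF gens(1)] bspec[OF gens(2)]
  have c': "is_coproduct C K (\<lambda>k. S \<otimes> R k \<otimes> unt C) (S \<otimes> dob E A) (\<lambda>k. idn C S \<boxtimes> E.kap (R k) (g k))"
    using tens_left_coproducts[OF generated_ob[OF S]] K c unfolding preserves_coproducts_def by blast
  show ?thesis
  proof (rule coproduct_epi[OF c'])
    fix k assume k: "k \<in> K"
    note Rob [simp] = generated_ob[OF g(1)[OF k]]
    note [simp] = homD[OF g(2)[OF k]]
    have h: "(idn C S \<boxtimes> g k) \<cdot> asc C S (R k) Y \<in> hom C ((S \<otimes> R k) \<otimes> Y) (S \<otimes> A)"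
      by (simp add: hom_def)
    have e: "(idn C S \<boxtimes> theta A) \<cdot> (idn C S \<boxtimes> E.kap (R k) (g k)) = idn C S \<boxtimes> D.kap (R k) (g k)"
      by (simp add: tensa_cmp' theta_kap[OF g(1)[OF k] g(2)[OF k]])
    have "theta (S \<otimes> A) \<cdot> lstr E S A \<cdot> (idn C S \<boxtimes> E.kap (R k) (g k)) \<cdot> asc C S (R k) (unt C)
        = lstr D S A \<cdot> (idn C S \<boxtimes> D.kap (R k) (g k)) \<cdot> asc C S (R k) (unt C)"
      using theta_kap[OF generated_tens[OF S g(1)[OF k]] h] by (simp add: E.lstr_kap D.lstr_kap)
    also have "\<dots> = lstr D S A \<cdot> ((idn C S \<boxtimes> theta A) \<cdot> (idn C S \<boxtimes> E.kap (R k) (g k))) \<cdot> asc C S (R k) (unt C)"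
      by (simp only: e)
    finally have "((theta (S \<otimes> A) \<cdot> lstr E S A) \<cdot> (idn C S \<boxtimes> E.kap (R k) (g k))) \<cdot> asc C S (R k) (unt C)
        = ((lstr D S A \<cdot> (idn C S \<boxtimes> theta A)) \<cdot> (idn C S \<boxtimes> E.kap (R k) (g k))) \<cdot> asc C S (R k) (unt C)"
      by simp
    then show "(theta (S \<otimes> A) \<cdot> lstr E S A) \<cdot> (idn C S \<boxtimes> E.kap (R k) (g k))
        = (lstr D S A \<cdot> (idn C S \<boxtimes> theta A)) \<cdot> (idn C S \<boxtimes> E.kap (R k) (g k))"
      by (rule iso_epi[OF asc_iso[OF Sob Rob unt_ob], rotated 2]) (simp_all add: hom_def)
  qed (simp_all add: hom_def)
qed

text \<open>The argument for left strengths is repeated with \<open>rstr_kap\<close>, which applies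
  because generated \<open>S\<close> satisfy \<open>symmetric_at S\<close> for both
  derivations.\<close>

lemma theta_rstr_generated:
  assumes S: "generated S" and A: "A \<in> ob C"
  shows "theta (A \<otimes> S) \<cdot> rstr E A S = rstr D A S \<cdot> (theta A \<boxtimes> idn C S)"
proof -
  note Sob [simp] = generated_ob[OF S]
  note [simp] = A
  obtain K R g where K: "K \<in> \<K>"
    and gens: "\<forall>k\<in>K. generated (R k)" "\<forall>k\<in>K. g k \<in> hom C (R k \<otimes> Y) A"
    and c: "is_coproduct C K (\<lambda>k. R k \<otimes> unt C) (dob E A) (\<lambda>k. E.kap (R k) (g k))"
    and fac: "\<forall>S h. generated S \<longrightarrow> h \<in> hom C (S \<otimes> Y) A \<longrightarrow>
        (\<exists>k\<in>K. \<exists>r\<in>hom C S (R k). h = g k \<cdot> (r \<boxtimes> idn C Y))"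
    by (rule E.pointsE[OF A])
  note g = bspec[OF gens(1)] bspec[OF gens(2)]
  have c': "is_coproduct C K (\<lambda>k. (R k \<otimes> unt C) \<otimes> S) (dob E A \<otimes> S) (\<lambda>k. E.kap (R k) (g k) \<boxtimes> idn C S)"
    using tens_right_coproducts[OF generated_ob[OF S]] K c unfolding preserves_coproducts_def by blast
  show ?thesis
  proof (rule coproduct_epi[OF c'])
    fix k assume k: "k \<in> K"
    note Rob [simp] = generated_ob[OF g(1)[OF k]]
    note [simp] = homD[OF g(2)[OF k]]
    have h: "(g k \<boxtimes> idn C S) \<cdot> swap_last (R k) S Y \<in> hom C ((R k \<otimes> S) \<otimes> Y) (A \<otimes> S)"
      by (simp add: hom_def)
    have e: "(theta A \<boxtimes> idn C S) \<cdot> (E.kap (R k) (g k) \<boxtimes> idn C S) = D.kap (R k) (g k) \<boxtimes> idn C S"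
      by (simp add: tensa_cmp' theta_kap[OF g(1)[OF k] g(2)[OF k]])
    have "theta (A \<otimes> S) \<cdot> rstr E A S \<cdot> (E.kap (R k) (g k) \<boxtimes> idn C S) \<cdot> swap_last (R k) S (unt C)
        = rstr D A S \<cdot> (D.kap (R k) (g k) \<boxtimes> idn C S) \<cdot> swap_last (R k) S (unt C)"
      using theta_kap[OF generated_tens[OF g(1)[OF k] S] h]
      by (simp add: E.rstr_kap D.rstr_kap E.symmetric_at_generated D.symmetric_at_generated S)
    also have "\<dots> = rstr D A S \<cdot> ((theta A \<boxtimes> idn C S) \<cdot> (E.kap (R k) (g k) \<boxtimes> idn C S)) \<cdot> swap_last (R k) S (unt C)"
      by (simp only: e)
    finally have "((theta (A \<otimes> S) \<cdot> rstr E A S) \<cdot> (E.kap (R k) (g k) \<boxtimes> idn C S)) \<cdot> swap_last (R k) S (unt C)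
        = ((rstr D A S \<cdot> (theta A \<boxtimes> idn C S)) \<cdot> (E.kap (R k) (g k) \<boxtimes> idn C S)) \<cdot> swap_last (R k) S (unt C)"
      by simp
    then show "(theta (A \<otimes> S) \<cdot> rstr E A S) \<cdot> (E.kap (R k) (g k) \<boxtimes> idn C S)
        = (rstr D A S \<cdot> (theta A \<boxtimes> idn C S)) \<cdot> (E.kap (R k) (g k) \<boxtimes> idn C S)"
      by (rule iso_epi[OF swap_last_iso[OF Rob Sob unt_ob], rotated 2]) (simp_all add: hom_def)
  qed (simp_all add: hom_def)
qed

text \<open>An arbitrary \<open>R\<close> is a coproduct of generated objects; tensoring preserves
  it, and naturality of the strengths reduces the equation to each summand.\<close>

lemma theta_lstr:
  assumes R: "R \<in> ob C" and A: "A \<in> ob C"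
  shows "theta (R \<otimes> A) \<cdot> lstr E R A = lstr D R A \<cdot> (idn C R \<boxtimes> theta A)"
proof -
  note [simp] = R A
  obtain K S i where K: "K \<in> \<K>" and S: "\<And>k. k \<in> K \<Longrightarrow> generated (S k)" and c: "is_coproduct C K S R i"
    using E.generated_cover[OF R] by blast
  have c': "is_coproduct C K (\<lambda>k. S k \<otimes> dob E A) (R \<otimes> dob E A) (\<lambda>k. i k \<boxtimes> idn C (dob E A))"
    using tens_right_coproducts[OF E.dob_ob[OF A]] K c unfolding preserves_coproducts_def by blast
  show ?thesis
  proof (rule coproduct_epi[OF c'])
    fix k assume k: "k \<in> K"
    note [simp] = homD[OF coproductD(3)[OF c k]] generated_ob[OF S[OF k]]
    have "i k \<boxtimes> idn C A \<in> hom C (S k \<otimes> A) (R \<otimes> A)" by (simp add: hom_def)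
    note nat = theta_natural[OF this]
    have "(theta (R \<otimes> A) \<cdot> lstr E R A) \<cdot> (i k \<boxtimes> idn C (dob E A))
        = theta (R \<otimes> A) \<cdot> (lstr E R A \<cdot> (i k \<boxtimes> dar E (idn C A)))"
      by (simp add: E.fun_idn)
    also have "\<dots> = (theta (R \<otimes> A) \<cdot> dar E (i k \<boxtimes> idn C A)) \<cdot> lstr E (S k) A"
      by (subst E.lstr_natural[of _ "S k" R _ A A]) (simp_all add: hom_def)
    also have "\<dots> = dar D (i k \<boxtimes> idn C A) \<cdot> theta (S k \<otimes> A) \<cdot> lstr E (S k) A"
      unfolding nat by simp
    also have "\<dots> = (dar D (i k \<boxtimes> idn C A) \<cdot> lstr D (S k) A) \<cdot> (idn C (S k) \<boxtimes> theta A)"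
      by (simp add: theta_lstr_generated S k)
    also have "\<dots> = (lstr D R A \<cdot> (i k \<boxtimes> dar D (idn C A))) \<cdot> (idn C (S k) \<boxtimes> theta A)"
      by (subst D.lstr_natural[of _ "S k" R _ A A]) (simp_all add: hom_def)
    also have "\<dots> = (lstr D R A \<cdot> (idn C R \<boxtimes> theta A)) \<cdot> (i k \<boxtimes> idn C (dob E A))"
      by (simp add: D.fun_idn tensa_cmp')
    finally show "(theta (R \<otimes> A) \<cdot> lstr E R A) \<cdot> (i k \<boxtimes> idn C (dob E A))
        = (lstr D R A \<cdot> (idn C R \<boxtimes> theta A)) \<cdot> (i k \<boxtimes> idn C (dob E A))" .
  qed (simp_all add: hom_def)
qed

lemma theta_rstr:
  assumes A: "A \<in> ob C" and R: "R \<in> ob C"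
  shows "theta (A \<otimes> R) \<cdot> rstr E A R = rstr D A R \<cdot> (theta A \<boxtimes> idn C R)"
proof -
  note [simp] = R A
  obtain K S i where K: "K \<in> \<K>" and S: "\<And>k. k \<in> K \<Longrightarrow> generated (S k)" and c: "is_coproduct C K S R i"
    using E.generated_cover[OF R] by blast
  have c': "is_coproduct C K (\<lambda>k. dob E A \<otimes> S k) (dob E A \<otimes> R) (\<lambda>k. idn C (dob E A) \<boxtimes> i k)"
    using tens_left_coproducts[OF E.dob_ob[OF A]] K c unfolding preserves_coproducts_def by blast
  show ?thesis
  proof (rule coproduct_epi[OF c'])
    fix k assume k: "k \<in> K"
    note [simp] = homD[OF coproductD(3)[OF c k]] generated_ob[OF S[OF k]]
    have "idn C A \<boxtimes> i k \<in> hom C (A \<otimes> S k) (A \<otimes> R)" by (simp add: hom_def)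
    note nat = theta_natural[OF this]
    have "(theta (A \<otimes> R) \<cdot> rstr E A R) \<cdot> (idn C (dob E A) \<boxtimes> i k)
        = theta (A \<otimes> R) \<cdot> (rstr E A R \<cdot> (dar E (idn C A) \<boxtimes> i k))"
      by (simp add: E.fun_idn)
    also have "\<dots> = (theta (A \<otimes> R) \<cdot> dar E (idn C A \<boxtimes> i k)) \<cdot> rstr E A (S k)"
      by (subst E.rstr_natural[of _ A A _ "S k" R]) (simp_all add: hom_def)
    also have "\<dots> = dar D (idn C A \<boxtimes> i k) \<cdot> theta (A \<otimes> S k) \<cdot> rstr E A (S k)"
      unfolding nat by simp
    also have "\<dots> = (dar D (idn C A \<boxtimes> i k) \<cdot> rstr D A (S k)) \<cdot> (theta A \<boxtimes> idn C (S k))"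
      by (simp add: theta_rstr_generated S k)
    also have "\<dots> = (rstr D A R \<cdot> (dar D (idn C A) \<boxtimes> i k)) \<cdot> (theta A \<boxtimes> idn C (S k))"
      by (subst D.rstr_natural[of _ A A _ "S k" R]) (simp_all add: hom_def)
    also have "\<dots> = (rstr D A R \<cdot> (theta A \<boxtimes> idn C R)) \<cdot> (idn C (dob E A) \<boxtimes> i k)"
      by (simp add: D.fun_idn tensa_cmp')
    finally show "(theta (A \<otimes> R) \<cdot> rstr E A R) \<cdot> (idn C (dob E A) \<boxtimes> i k)
        = (rstr D A R \<cdot> (theta A \<boxtimes> idn C R)) \<cdot> (idn C (dob E A) \<boxtimes> i k)" .
  qed (simp_all add: hom_def)
qed

text \<open>Both derivatives of \<open>Y\<close> are copies of the unit, so thinness identifies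
  \<open>theta Y\<close> with the evident isomorphism between them.\<close>

lemma theta_Y_iso: "is_iso C (dob E Y) (dob D Y) (theta Y)"
proof -
  obtain \<phi>' where \<phi>': "is_iso C (dob D Y) (unt C) \<phi>'" "\<phi>' \<cdot> \<phi> = idn C (unt C)" "\<phi> \<cdot> \<phi>' = idn C (dob D Y)"
    using iso_inverse[OF D.\<phi>_iso] .
  obtain \<psi>' where \<psi>': "is_iso C (dob E Y) (unt C) \<psi>'" "\<psi>' \<cdot> \<psi> = idn C (unt C)" "\<psi> \<cdot> \<psi>' = idn C (dob E Y)"
    using iso_inverse[OF E.\<phi>_iso] .
  have iso: "is_iso C (dob E Y) (dob D Y) (\<phi> \<cdot> \<psi>')"
    by (rule is_iso_cmp[OF \<psi>'(1) D.\<phi>_iso])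
  have "theta Y = \<phi> \<cdot> \<psi>'"
    by (rule E.thin_unit[OF E.\<phi>_iso D.\<phi>_iso theta_hom[OF Y_ob] is_iso_hom[OF iso]])
  with iso show ?thesis by simp
qed

text \<open>At the unit both derivatives are initial. At a tensor product Leibniz's rule presents
  both as coproducts, and compatibility with the two strengths makes \<open>theta\<close> a sum of
  isomorphisms.\<close>

lemma theta_generated_iso: "generated S \<Longrightarrow> is_iso C (dob E S) (dob D S) (theta S)"
proof (induction rule: generated.induct)
  case generated_unit
  obtain Z where Z: "is_initial C Z" using initial by blast
  show ?case
    by (rule initial_iso[OF E.d_unit_initial[OF Z] D.d_unit_initial[OF Z] theta_hom[OF unt_ob]])
next
  case generated_Y
  show ?case by (rule theta_Y_iso)
next
  case (generated_tens A B)
  note ob [simp] = generated_ob[OF generated_tens.hyps(1)] generated_ob[OF generated_tens.hyps(2)]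
  obtain P i j where P: "is_binary_coproduct C (dob E A \<otimes> B) (A \<otimes> dob E B) P i j"
    using binary_coproduct[of "dob E A \<otimes> B" "A \<otimes> dob E B"] by auto
  obtain P' i' j' where P': "is_binary_coproduct C (dob D A \<otimes> B) (A \<otimes> dob D B) P' i' j'"
    using binary_coproduct[of "dob D A \<otimes> B" "A \<otimes> dob D B"] by auto
  show ?case
    by (rule binary_coproduct_comparison_iso[OF E.leibniz_coproduct[OF ob P] D.leibniz_coproduct[OF ob P']
          tensa_iso[OF generated_tens.IH(1) idn_iso] tensa_iso[OF idn_iso generated_tens.IH(2)]])
      (simp_all add: theta_hom theta_lstr theta_rstr)
next
  case (generated_iso A B f)
  have f: "f \<in> hom C A B" using generated_iso.hyps(2) by (rule is_iso_hom)
  note [simp] = hom_ob[OF f] homD[OF f]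
  obtain g where g: "is_iso C B A g" "f \<cdot> g = idn C B"
    using iso_inverse[OF generated_iso.hyps(2)] by metis
  note [simp] = homD[OF is_iso_hom[OF g(1)]]
  have "theta B = (theta B \<cdot> dar E f) \<cdot> dar E g"
    by (simp add: E.dar_cmp g(2) E.fun_idn)
  also have "\<dots> = dar D f \<cdot> theta A \<cdot> dar E g"
    by (simp add: theta_natural[OF f])
  finally show ?case
    using is_iso_cmp[OF is_iso_cmp[OF E.dar_iso[OF g(1)] generated_iso.IH] D.dar_iso[OF generated_iso.hyps(2)]]
    by simp
qed

lemma theta_iso:
  assumes A: "A \<in> ob C"
  shows "is_iso C (dob E A) (dob D A) (theta A)"
proof -
  obtain K S i where K: "K \<in> \<K>" and S: "\<And>k. k \<in> K \<Longrightarrow> generated (S k)" and c: "is_coproduct C K S A i"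
    using E.generated_cover[OF A] by blast
  have cE: "is_coproduct C K (\<lambda>k. dob E (S k)) (dob E A) (\<lambda>k. dar E (i k))"
    using E.d_coproducts K c unfolding preserves_coproducts_def by blast
  have cD: "is_coproduct C K (\<lambda>k. dob D (S k)) (dob D A) (\<lambda>k. dar D (i k))"
    using D.d_coproducts K c unfolding preserves_coproducts_def by blast
  show ?thesis
    by (rule coproduct_comparison_iso[OF cE cD theta_generated_iso[OF S] theta_hom[OF A]
          theta_natural[OF coproductD(3)[OF c]]])
qed

theorem derivation_iso_theta: "derivation_iso C E D theta"
  unfolding derivation_iso_def
  using theta_iso theta_natural theta_lstr theta_rstr by blast

end

text \<open>Comparisons are constructed only out of a dense derivation, so two other derivations are
  related by inverting one leg of a span.\<close>

lemma derivation_iso_common_source: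
  assumes "derivation C \<K> E" "derivation C \<K> D" "derivation C \<K> D'"
    and \<theta>: "derivation_iso C E D \<theta>" and \<theta>': "derivation_iso C E D' \<theta>'"
  shows "derivations_isomorphic C D D'"
proof -
  interpret E: derivation C \<K> E by fact
  interpret D: derivation C \<K> D by fact
  interpret D': derivation C \<K> D' by fact
  have "\<forall>A. \<exists>h. A \<in> ob C \<longrightarrow> is_iso C (dob D A) (dob E A) h \<and> h \<cdot>\<^bsub>C\<^esub> \<theta> A = idn C (dob E A) \<and>
      \<theta> A \<cdot>\<^bsub>C\<^esub> h = idn C (dob D A)"
    using \<theta> E.iso_inverse unfolding derivation_iso_def by metis
  then obtain \<eta> where \<eta>: "\<And>A. A \<in> ob C \<Longrightarrow> is_iso C (dob D A) (dob E A) (\<eta> A)"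
    "\<And>A. A \<in> ob C \<Longrightarrow> \<eta> A \<cdot>\<^bsub>C\<^esub> \<theta> A = idn C (dob E A)"
    "\<And>A. A \<in> ob C \<Longrightarrow> \<theta> A \<cdot>\<^bsub>C\<^esub> \<eta> A = idn C (dob D A)"
    by metis
  have iso: "\<And>A. A \<in> ob C \<Longrightarrow> is_iso C (dob E A) (dob D A) (\<theta> A)"
    "\<And>A. A \<in> ob C \<Longrightarrow> is_iso C (dob E A) (dob D' A) (\<theta>' A)"
    and nat: "\<And>A B f. f \<in> hom C A B \<Longrightarrow> \<theta> B \<cdot>\<^bsub>C\<^esub> dar E f = dar D f \<cdot>\<^bsub>C\<^esub> \<theta> A"
    "\<And>A B f. f \<in> hom C A B \<Longrightarrow> \<theta>' B \<cdot>\<^bsub>C\<^esub> dar E f = dar D' f \<cdot>\<^bsub>C\<^esub> \<theta>' A"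
    and l: "\<And>R A. R \<in> ob C \<Longrightarrow> A \<in> ob C \<Longrightarrow>
      \<theta> (R \<otimes>\<^bsub>C\<^esub> A) \<cdot>\<^bsub>C\<^esub> lstr E R A = lstr D R A \<cdot>\<^bsub>C\<^esub> (idn C R \<boxtimes>\<^bsub>C\<^esub> \<theta> A)"
    "\<And>R A. R \<in> ob C \<Longrightarrow> A \<in> ob C \<Longrightarrow>
      \<theta>' (R \<otimes>\<^bsub>C\<^esub> A) \<cdot>\<^bsub>C\<^esub> lstr E R A = lstr D' R A \<cdot>\<^bsub>C\<^esub> (idn C R \<boxtimes>\<^bsub>C\<^esub> \<theta>' A)"
    and r: "\<And>R A. R \<in> ob C \<Longrightarrow> A \<in> ob C \<Longrightarrow>
      \<theta> (A \<otimes>\<^bsub>C\<^esub> R) \<cdot>\<^bsub>C\<^esub> rstr E A R = rstr D A R \<cdot>\<^bsub>C\<^esub> (\<theta> A \<boxtimes>\<^bsub>C\<^esub> idn C R)"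
    "\<And>R A. R \<in> ob C \<Longrightarrow> A \<in> ob C \<Longrightarrow>
      \<theta>' (A \<otimes>\<^bsub>C\<^esub> R) \<cdot>\<^bsub>C\<^esub> rstr E A R = rstr D' A R \<cdot>\<^bsub>C\<^esub> (\<theta>' A \<boxtimes>\<^bsub>C\<^esub> idn C R)"
    using \<theta> \<theta>' unfolding derivation_iso_def by blast+
  note h = homD[OF E.is_iso_hom[OF iso(1)]] homD[OF E.is_iso_hom[OF iso(2)]] homD[OF E.is_iso_hom[OF \<eta>(1)]]
  text \<open>Both sides of each square below are compared after precomposition with \<open>\<theta>\<close>.\<close>
  have "derivation_iso C D D' (\<lambda>A. \<theta>' A \<cdot>\<^bsub>C\<^esub> \<eta> A)"
    unfolding derivation_iso_def
  proof (intro conjI ballI allI impI)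
    show "is_iso C (dob D A) (dob D' A) (\<theta>' A \<cdot>\<^bsub>C\<^esub> \<eta> A)" if "A \<in> ob C" for A
      by (rule E.is_iso_cmp[OF \<eta>(1)[OF that] iso(2)[OF that]])
    show "(\<theta>' B \<cdot>\<^bsub>C\<^esub> \<eta> B) \<cdot>\<^bsub>C\<^esub> dar D f = dar D' f \<cdot>\<^bsub>C\<^esub> \<theta>' A \<cdot>\<^bsub>C\<^esub> \<eta> A" if f: "f \<in> hom C A B" for A B f
    proof (rule E.iso_epi[OF iso(1)])
      note [simp] = E.hom_ob[OF f] homD[OF f] h
      show "A \<in> ob C" "(\<theta>' B \<cdot>\<^bsub>C\<^esub> \<eta> B) \<cdot>\<^bsub>C\<^esub> dar D f \<in> hom C (dob D A) (dob D' B)"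
        "dar D' f \<cdot>\<^bsub>C\<^esub> \<theta>' A \<cdot>\<^bsub>C\<^esub> \<eta> A \<in> hom C (dob D A) (dob D' B)"
        by (simp_all add: hom_def)
      have "((\<theta>' B \<cdot>\<^bsub>C\<^esub> \<eta> B) \<cdot>\<^bsub>C\<^esub> dar D f) \<cdot>\<^bsub>C\<^esub> \<theta> A = \<theta>' B \<cdot>\<^bsub>C\<^esub> (\<eta> B \<cdot>\<^bsub>C\<^esub> \<theta> B) \<cdot>\<^bsub>C\<^esub> dar E f"
        by (simp flip: nat(1)[OF f])
      also have "\<dots> = dar D' f \<cdot>\<^bsub>C\<^esub> \<theta>' A" by (simp add: \<eta>(2) nat(2)[OF f])
      finally show "((\<theta>' B \<cdot>\<^bsub>C\<^esub> \<eta> B) \<cdot>\<^bsub>C\<^esub> dar D f) \<cdot>\<^bsub>C\<^esub> \<theta> A = (dar D' f \<cdot>\<^bsub>C\<^esub> \<theta>' A \<cdot>\<^bsub>C\<^esub> \<eta> A) \<cdot>\<^bsub>C\<^esub> \<theta> A"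
        by (simp add: \<eta>(2))
    qed
    fix R A assume ob [simp]: "R \<in> ob C" "A \<in> ob C"
    note [simp] = h
    show "(\<theta>' (R \<otimes>\<^bsub>C\<^esub> A) \<cdot>\<^bsub>C\<^esub> \<eta> (R \<otimes>\<^bsub>C\<^esub> A)) \<cdot>\<^bsub>C\<^esub> lstr D R A
        = lstr D' R A \<cdot>\<^bsub>C\<^esub> (idn C R \<boxtimes>\<^bsub>C\<^esub> (\<theta>' A \<cdot>\<^bsub>C\<^esub> \<eta> A))"
    proof (rule E.iso_epi[OF E.tensa_iso[OF E.idn_iso[OF ob(1)] iso(1)[OF ob(2)]]])
      have "((\<theta>' (R \<otimes>\<^bsub>C\<^esub> A) \<cdot>\<^bsub>C\<^esub> \<eta> (R \<otimes>\<^bsub>C\<^esub> A)) \<cdot>\<^bsub>C\<^esub> lstr D R A) \<cdot>\<^bsub>C\<^esub> (idn C R \<boxtimes>\<^bsub>C\<^esub> \<theta> A)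
         = \<theta>' (R \<otimes>\<^bsub>C\<^esub> A) \<cdot>\<^bsub>C\<^esub> (\<eta> (R \<otimes>\<^bsub>C\<^esub> A) \<cdot>\<^bsub>C\<^esub> \<theta> (R \<otimes>\<^bsub>C\<^esub> A)) \<cdot>\<^bsub>C\<^esub> lstr E R A"
        by (simp flip: l(1))
      also have "\<dots> = lstr D' R A \<cdot>\<^bsub>C\<^esub> (idn C R \<boxtimes>\<^bsub>C\<^esub> \<theta>' A)" by (simp add: \<eta>(2) l(2))
      finally show "((\<theta>' (R \<otimes>\<^bsub>C\<^esub> A) \<cdot>\<^bsub>C\<^esub> \<eta> (R \<otimes>\<^bsub>C\<^esub> A)) \<cdot>\<^bsub>C\<^esub> lstr D R A) \<cdot>\<^bsub>C\<^esub> (idn C R \<boxtimes>\<^bsub>C\<^esub> \<theta> A)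
          = (lstr D' R A \<cdot>\<^bsub>C\<^esub> (idn C R \<boxtimes>\<^bsub>C\<^esub> (\<theta>' A \<cdot>\<^bsub>C\<^esub> \<eta> A))) \<cdot>\<^bsub>C\<^esub> (idn C R \<boxtimes>\<^bsub>C\<^esub> \<theta> A)"
        by (simp add: E.tensa_cmp' \<eta>(2))
    qed (simp_all add: hom_def)
  next
    fix A R assume ob [simp]: "A \<in> ob C" "R \<in> ob C"
    note [simp] = h
    show "(\<theta>' (A \<otimes>\<^bsub>C\<^esub> R) \<cdot>\<^bsub>C\<^esub> \<eta> (A \<otimes>\<^bsub>C\<^esub> R)) \<cdot>\<^bsub>C\<^esub> rstr D A R
        = rstr D' A R \<cdot>\<^bsub>C\<^esub> ((\<theta>' A \<cdot>\<^bsub>C\<^esub> \<eta> A) \<boxtimes>\<^bsub>C\<^esub> idn C R)"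
    proof (rule E.iso_epi[OF E.tensa_iso[OF iso(1)[OF ob(1)] E.idn_iso[OF ob(2)]]])
      have "((\<theta>' (A \<otimes>\<^bsub>C\<^esub> R) \<cdot>\<^bsub>C\<^esub> \<eta> (A \<otimes>\<^bsub>C\<^esub> R)) \<cdot>\<^bsub>C\<^esub> rstr D A R) \<cdot>\<^bsub>C\<^esub> (\<theta> A \<boxtimes>\<^bsub>C\<^esub> idn C R)
         = \<theta>' (A \<otimes>\<^bsub>C\<^esub> R) \<cdot>\<^bsub>C\<^esub> (\<eta> (A \<otimes>\<^bsub>C\<^esub> R) \<cdot>\<^bsub>C\<^esub> \<theta> (A \<otimes>\<^bsub>C\<^esub> R)) \<cdot>\<^bsub>C\<^esub> rstr E A R"
        by (simp flip: r(1))
      also have "\<dots> = rstr D' A R \<cdot>\<^bsub>C\<^esub> (\<theta>' A \<boxtimes>\<^bsub>C\<^esub> idn C R)" by (simp add: \<eta>(2) r(2))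
      finally show "((\<theta>' (A \<otimes>\<^bsub>C\<^esub> R) \<cdot>\<^bsub>C\<^esub> \<eta> (A \<otimes>\<^bsub>C\<^esub> R)) \<cdot>\<^bsub>C\<^esub> rstr D A R) \<cdot>\<^bsub>C\<^esub> (\<theta> A \<boxtimes>\<^bsub>C\<^esub> idn C R)
          = (rstr D' A R \<cdot>\<^bsub>C\<^esub> ((\<theta>' A \<cdot>\<^bsub>C\<^esub> \<eta> A) \<boxtimes>\<^bsub>C\<^esub> idn C R)) \<cdot>\<^bsub>C\<^esub> (\<theta> A \<boxtimes>\<^bsub>C\<^esub> idn C R)"
        by (simp add: E.tensa_cmp' \<eta>(2))
    qed (simp_all add: hom_def)
  qed
  then show ?thesis unfolding derivations_isomorphic_def by blast
qed

section \<open>The free symmetric 2-rigs\<close>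

context fam_completion
begin

lemma fam_cover_reindex:
  assumes c: "fam_cover K X P f" and r: "bij_betw r L K"
  shows "fam_cover L (\<lambda>l. X (r l)) P (\<lambda>l. f (r l))"
proof -
  obtain v where v: "\<And>k x. k \<in> K \<Longrightarrow> x \<in> idx (X k) \<Longrightarrow> v (reindex (f k) x) = (k, x)"
    and idx_P: "\<And>j. j \<in> idx P \<Longrightarrow> \<exists>k\<in>K. \<exists>x\<in>idx (X k). j = reindex (f k) x"
    using fam_cover_index[OF c] by blast
  have rK: "r l \<in> K" if "l \<in> L" for l using that r by (auto simp: bij_betw_def)
  show ?thesis
  proof (rule fam_coverI)
    show "(\<lambda>j. (inv_into L r (fst (v j)), snd (v j))) (reindex (f (r l)) x) = (l, x)"
      if "l \<in> L" "x \<in> idx (X (r l))" for l x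
      using that v[OF rK] bij_betw_inv_into_left[OF r] by simp
    show "\<exists>l\<in>L. \<exists>x\<in>idx (X (r l)). j = reindex (f (r l)) x" if j: "j \<in> idx P" for j
    proof -
      obtain k x where "k \<in> K" "x \<in> idx (X k)" "j = reindex (f k) x" using idx_P[OF j] by blast
      moreover obtain l where "l \<in> L" "r l = k" using \<open>k \<in> K\<close> r by (auto simp: bij_betw_def)
      ultimately show ?thesis by blast
    qed
  qed (use fam_coverD[OF c] rK in auto)
qed

text \<open>A two-element set of indices lies in the class and carries a sum; relabelling its
  elements by \<open>bool\<close> gives the form used in Leibniz's rule.\<close>

lemma ex_binary_fam_cover:
  assumes "A \<in> ob F" "B \<in> ob F"
  shows "\<exists>P f. fam_cover (UNIV :: bool set) (\<lambda>b. if b then A else B) P f"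
proof -
  have "\<exists>l. l \<noteq> s" using infinite_index by (metis UNIV_eq_I finite.simps insertCI singletonD)
  then obtain l where l: "l \<noteq> s" by blast
  have c: "fam_cover {s, l} (\<lambda>k. if k = s then A else B) (fam_sum {s, l} (\<lambda>k. if k = s then A else B))
    (\<lambda>k. fam_arrow (if k = s then A else B) (fam_sum {s, l} (\<lambda>k. if k = s then A else B))
      (\<lambda>x. p (k, x)) (\<lambda>x. idn C (fib (if k = s then A else B) x)))"
    by (rule fam_sum_cover) (use assms finite_index in auto)
  have "bij_betw (\<lambda>b. if b then s else l) (UNIV :: bool set) {s, l}"
    using l by (auto simp: bij_betw_def inj_on_def)
  from fam_cover_reindex[OF c this]
  have "\<exists>P f. fam_cover (UNIV :: bool set) (\<lambda>b. if (if b then s else l) = s then A else B) P f"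
    by blast
  moreover have "(\<lambda>b. if (if b then s else l) = s then A else B) = (\<lambda>b. if b then A else B)"
    using l by auto
  ultimately show ?thesis by simp
qed

lemma binary_fam_cover:
  assumes "is_binary_coproduct F A B P i j"
  shows "fam_cover (UNIV :: bool set) (\<lambda>b. if b then A else B) P (\<lambda>b. if b then i else j)"
proof -
  note P = assms[unfolded is_binary_coproduct_def]
  have "A \<in> ob F" "B \<in> ob F"
    using Fam.coproductD(2)[OF P, of True] Fam.coproductD(2)[OF P, of False] by auto
  then show ?thesis using ex_binary_fam_cover coproduct_fam_cover_if[OF _ P] by blast
qed

text \<open>Representables are connected: the single index of \<open>S\<close> lands in one leg,
  where the fibre isomorphism can be inverted.\<close>

lemma fam_cover_lift:
  assumes c: "fam_cover K X P g" and S: "idx S = {x}" and f: "f \<in> hom F S P"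
  shows "\<exists>k\<in>K. \<exists>w\<in>hom F S (X k). f = cmp F (g k) w"
proof -
  have x: "x \<in> idx S" by (simp add: S)
  note fx = Fam_homD(4,5)[OF f x]
  obtain v where "\<And>k x. k \<in> K \<Longrightarrow> x \<in> idx (X k) \<Longrightarrow> v (reindex (g k) x) = (k, x)"
    and idx_P: "\<And>j. j \<in> idx P \<Longrightarrow> \<exists>k\<in>K. \<exists>x\<in>idx (X k). j = reindex (g k) x"
    using fam_cover_index[OF c] by blast
  then obtain k y where k: "k \<in> K" and y: "y \<in> idx (X k)" and eq: "reindex f x = reindex (g k) y"
    using fx(1) by blast
  note gk = fam_coverD(2)[OF c k]
  obtain h where h: "is_iso C (fib P (reindex (g k) y)) (fib (X k) y) h"
    "comp_at (g k) y \<cdot> h = idn C (fib P (reindex (g k) y))"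
    using iso_inverse[OF fam_coverD(3)[OF c k y]] by metis
  define w where "w = fam_arrow S (X k) (\<lambda>_. y) (\<lambda>_. h \<cdot> comp_at f x)"
  have w: "w \<in> hom F S (X k)"
    unfolding w_def Fam_hom_iff
    using Fam_homD(2)[OF f] Fam_homD(2)[OF gk] y S cmp_hom[OF fx(2) is_iso_hom[OF h(1), folded eq]] by simp
  have "(comp_at (g k) y \<cdot> h) \<cdot> comp_at f x = comp_at f x"
    unfolding h(2) using homD[OF fx(2)] tgt_ob by (simp add: eq)
  then have "comp_at (g k) y \<cdot> h \<cdot> comp_at f x = comp_at f x"
    using homD[OF fx(2)] homD[OF is_iso_hom[OF h(1)]] homD[OF Fam_homD(5)[OF gk y]] by (simp add: eq)
  then have "f = cmp F (g k) w"
    using S eq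
    by (intro Fam_ext[OF f Fam.cmp_hom[OF w gk]]) (auto simp: Fam_cmp_eval[OF w gk], auto simp: w_def)
  with k w show ?thesis by blast
qed

end

section \<open>Families of finite sets meet the abstract assumptions\<close>

context species_completion
begin

abbreviation "Y \<equiv> fam_single s {0 :: nat}"

sublocale Fam: generated_2rig F \<K> Y
proof
  show "Y \<in> ob F" by simp
  \<comment> \<open>The only fibre of the unit is empty and that of \<open>Y\<close> is a single
    point, so each has one bijection to itself.\<close>
  show "f = idn F (unt F)" if "f \<in> hom F (unt F) (unt F)" for f
    using that by (elim Fam_FinBij_homE) (simp add: fam_arrow_eq map_arrow_eq)
  show "f = idn F Y" if "f \<in> hom F Y Y" for f
    using that by (elim Fam_FinBij_homE) (simp add: fam_arrow_eq map_arrow_eq)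
  show "\<exists>Z. is_initial F Z"
    by (intro exI[of _ "fam {} undefined"] empty_initial) (simp_all add: fam_ob finite_index)
  show "\<exists>P i j. is_binary_coproduct F A B P i j" if AB: "A \<in> ob F" "B \<in> ob F" for A B
  proof -
    obtain P f where "fam_cover (UNIV :: bool set) (\<lambda>b. if b then A else B) P f"
      using ex_binary_fam_cover[OF AB] by blast
    moreover have "f = (\<lambda>b. if b then f True else f False)" by auto
    ultimately have "is_binary_coproduct F A B P (f True) (f False)"
      unfolding is_binary_coproduct_def using fam_cover_coproduct by metis
    then show ?thesis by blast
  qed
  show "(\<exists>w\<in>hom F (tens F Y (unt F)) A. f = cmp F i w) \<or> (\<exists>w\<in>hom F (tens F Y (unt F)) B. f = cmp F j w)"
    if P: "is_binary_coproduct F A B P i j" and f: "f \<in> hom F (tens F Y (unt F)) P" for A B P i j f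
  proof -
    have "idx (tens F Y (unt F)) = {p (s, s)}" by simp
    from fam_cover_lift[OF binary_fam_cover[OF P] this f] show ?thesis
      by (auto split: if_splits)
  qed
  \<comment> \<open>Equality would give the two points of \<open>Y \<otimes> Y\<close> the same
    image, against injectivity of the fibre bijection.\<close>
  show "cmp F f (tensa F (brd F Y Y) (idn F (unt F))) \<noteq> f"
    if "f \<in> hom F (tens F (tens F Y Y) (unt F)) Z" for f Z
    using that by (elim Fam_FinBij_homE) (auto simp: fam_arrow_eq map_arrow_eq ball_dsum)
qed

lemma generated_index: "Fam.generated X \<Longrightarrow> \<exists>x. idx X = {x}"
proof (induction rule: Fam.generated.induct)
  case (generated_iso A B f)
  then obtain x where "idx A = {x}" by blast
  moreover have "idx B = reindex f ` idx A"
    using Fam_isoD(1)[OF generated_iso.hyps(2)] by (simp add: bij_betw_def)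
  ultimately show ?case by simp
qed auto

lemma ex_single_iso:
  assumes "X \<in> ob F" "Z \<in> ob F" "idx X = {x}" "idx Z = {z}" "bij_betw f (fib X x) (fib Z z)"
  shows "\<exists>h. is_iso F X Z h"
proof -
  let ?h = "fam_arrow X Z (\<lambda>_. z) (\<lambda>_. map_arrow (fib X x) (fib Z z) f)"
  have h: "?h \<in> hom F X Z" using assms by simp
  have "is_iso F X Z ?h"
    by (rule Fam_iso[OF h]) (use assms in \<open>auto simp: bij_betw_def intro!: FinBij_iso\<close>)
  then show ?thesis by blast
qed

text \<open>Adding a point to a set is tensoring with \<open>Y\<close>, up to isomorphism.\<close>

lemma generated_single: "finite A \<Longrightarrow> Fam.generated (fam_single s A)"
proof (induction rule: finite_induct)
  case empty
  then show ?case using Fam.generated_unit by simp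
next
  case (insert a A)
  have "bij_betw (dcase (\<lambda>x. x) (\<lambda>_. a)) (dsum A {0}) (insert a A)"
    by (rule bij_betw_ballI[where g = "\<lambda>x. if x = a then inr 0 else inl x"])
      (use insert in \<open>auto simp: ball_dsum\<close>)
  then obtain h where "is_iso F (tens F (fam_single s A) Y) (fam_single s (insert a A)) h"
    using insert ex_single_iso[of "tens F (fam_single s A) Y" "fam_single s (insert a A)" "p (s, s)" s]
    by auto
  with Fam.generated_tens[OF insert.IH Fam.generated_Y] show ?case
    by (rule Fam.generated_iso)
qed

text \<open>The derivative of \<open>Y\<close> has one index, marked at \<open>0\<close>; removing
  that point leaves the empty set, the fibre of the unit.\<close>

definition std_point :: "('i, nat set, (nat set, nat \<Rightarrow> nat) arrow) family_arrow" where
  "std_point = fam_arrow (unt F) (D_ob Y) (\<lambda>_. p (s, e 0)) (\<lambda>_. idn FinBij {})"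

lemma idx_D_ob_Y: "idx (D_ob Y) = {p (s, e 0)}"
  by (auto simp: D_ob_def)

lemma std_point_iso: "is_iso F (unt F) (D_ob Y) std_point"
proof -
  have h: "std_point \<in> hom F (unt F) (D_ob Y)"
    unfolding std_point_def by (simp add: bij_betw_def)
  show ?thesis
    by (rule Fam_iso[OF h])
      (auto simp: std_point_def idx_D_ob_Y bij_betw_def intro!: FinBij_iso)
qed

sublocale std: pointed_derivation F \<K> Y std_deriv std_point
  by unfold_locales (use std_point_iso in simp)

definition point_fib :: "('i, nat set) family \<Rightarrow> 'i \<Rightarrow> ('i, nat set) family" where
  "point_fib A k = fam_single s (fib (D_ob A) k)"

text \<open>The universal element belonging to \<open>k\<close>: the point removed in
  \<open>\<partial>A\<close> is put back as the image of the added generator.\<close>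

definition point :: "('i, nat set) family \<Rightarrow> 'i \<Rightarrow> ('i, nat set, (nat set, nat \<Rightarrow> nat) arrow) family_arrow" where
  "point A k = fam_arrow (tens F (point_fib A k) Y) A (\<lambda>_. cfst p k)
     (\<lambda>_. map_arrow (dsum (fib (D_ob A) k) {0}) (fib A (cfst p k)) (dcase (\<lambda>x. x) (\<lambda>_. inv e (csnd p k))))"

lemma point_fib_simps [simp]: "idx (point_fib A k) = {s}" "fib (point_fib A k) s = fib (D_ob A) k"
  by (simp_all add: point_fib_def)

lemma bij_betw_point:
  assumes "a \<in> A"
  shows "bij_betw (dcase (\<lambda>x. x) (\<lambda>_. a)) (dsum A {0} - {inl a}) A"
  by (rule bij_betw_ballI[where g = "\<lambda>x. if x = a then inr 0 else inl x"])
    (use assms in \<open>auto simp: ball_dsum ball_Diff\<close>)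

lemma point_hom:
  assumes A: "A \<in> ob F" and k: "k \<in> idx (D_ob A)"
  shows "point_fib A k \<in> ob F" "point A k \<in> hom F (tens F (point_fib A k) Y) A"
proof -
  show ob: "point_fib A k \<in> ob F" using fib_ob[OF D_ob_ob[OF A] k] by (simp add: point_fib_def)
  obtain i a where "i \<in> idx A" "a \<in> fib A i" "k = p (i, e a)" using k by (rule D_obE)
  then show "point A k \<in> hom F (tens F (point_fib A k) Y) A"
    unfolding point_def using A ob by (simp add: bij_betw_point)
qed

text \<open>Each universal element hits its own index, so together they cover
  \<open>\<partial>A\<close> without repetition.\<close>

lemma kap_point_index:
  assumes A: "A \<in> ob F" and k: "k \<in> idx (D_ob A)"
  shows "reindex (std.kap (point_fib A k) (point A k)) (p (s, s)) = k"
proof -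
  obtain i a where "i \<in> idx A" "a \<in> fib A i" "k = p (i, e a)" using k by (rule D_obE)
  then show ?thesis
    unfolding std.kap_def unfolding point_def std_point_def by (simp add: ball_Diff)
qed

text \<open>An arrow from \<open>S + 1\<close> to \<open>A\<close> consists of an index
  \<open>i\<close>, the image \<open>a\<close> of the added point, and a bijection from the fibre of
  \<open>S\<close> to the remaining points; \<open>i\<close> and \<open>a\<close> select the
  universal element.\<close>

lemma point_factor:
  assumes S: "Fam.generated S" and h: "h \<in> hom F (tens F S Y) A"
  shows "\<exists>k\<in>idx (D_ob A). \<exists>r\<in>hom F S (point_fib A k). h = cmp F (point A k) (tensa F r (idn F Y))"
proof -
  obtain x where x: "idx S = {x}" using generated_index[OF S] by blast
  have Sob: "S \<in> ob F" using S by (rule Fam.generated_ob)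
  obtain u \<tau> where h_eq: "h = fam_arrow (tens F S Y) A u
      (\<lambda>i. map_arrow (fib (tens F S Y) i) (fib A (u i)) (\<tau> i))" and A: "A \<in> ob F"
    and u: "\<forall>i\<in>idx (tens F S Y). u i \<in> idx A"
    and bij: "\<forall>i\<in>idx (tens F S Y). bij_betw (\<tau> i) (fib (tens F S Y) i) (fib A (u i))"
    and maps: "\<forall>i\<in>idx (tens F S Y). \<forall>x\<in>fib (tens F S Y) i. \<tau> i x \<in> fib A (u i)"
    using h by (rule Fam_FinBij_homE)
  define i where "i = u (p (x, s))"
  define t where "t = \<tau> (p (x, s))"
  define a where "a = t (inr 0)"
  define k where "k = p (i, e a)"
  have i: "i \<in> idx A" and t: "bij_betw t (dsum (fib S x) {0}) (fib A i)" and a: "a \<in> fib A i"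
    using u bij maps by (simp_all add: x i_def t_def a_def)
  then have k: "k \<in> idx (D_ob A)" by (simp add: k_def)
  have "bij_betw inl (fib S x) (dsum (fib S x) {0} - {inr 0})"
    by (rule bij_betw_ballI[where g = "dcase (\<lambda>x. x) undefined"]) (simp_all add: ball_dsum ball_Diff)
  moreover have "bij_betw t (dsum (fib S x) {0} - {inr 0}) (fib A i - {a})"
    using bij_betw_remove[OF t] by (simp add: a_def)
  ultimately have "bij_betw (t \<circ> inl) (fib S x) (fib A i - {a})"
    by (rule bij_betw_trans)
  then have tl: "bij_betw (\<lambda>y. t (inl y)) (fib S x) (fib A i - {a})" by (simp add: comp_def)
  then have tl': "\<forall>y\<in>fib S x. t (inl y) \<in> fib A i \<and> t (inl y) \<noteq> a" by (auto simp: bij_betw_def)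
  let ?r = "fam_arrow S (point_fib A k) (\<lambda>_. s) (\<lambda>_. map_arrow (fib S x) (fib A i - {a}) (\<lambda>y. t (inl y)))"
  have r: "?r \<in> hom F S (point_fib A k)"
    using Sob point_hom(1)[OF A k] i a tl A by (simp add: x k_def)
  have "h = cmp F (point A k) (tensa F ?r (idn F Y))"
    unfolding h_eq point_def using i a tl'
    by (simp add: fam_arrow_eq x k_def map_arrow_eq ball_dsum ball_Diff i_def[symmetric] t_def[symmetric])
      (simp add: a_def)
  with k r show ?thesis by blast
qed

sublocale std: dense_derivation F \<K> Y std_deriv std_point
proof
  fix A assume A: "A \<in> ob F"
  define i where "i k = fam_arrow (fam_single s (fib A k)) A (\<lambda>_. k) (\<lambda>_. idn FinBij (fib A k))" for k
  have i: "i k \<in> hom F (fam_single s (fib A k)) A" if "k \<in> idx A" for k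
    unfolding i_def using that A FinBij.idn_hom[of "fib A k"] by simp
  have "fam_cover (idx A) (\<lambda>k. fam_single s (fib A k)) A i"
  proof (rule fam_coverI[where v = "\<lambda>j. (j, s)"])
    show "is_iso FinBij (fib (fam_single s (fib A k)) x) (fib A (reindex (i k) x)) (comp_at (i k) x)"
      if k: "k \<in> idx A" and x: "x \<in> idx (fam_single s (fib A k))" for k x
      by (rule FinBij_iso[OF Fam_homD(5)[OF i[OF k] x]])
  qed (use A i in \<open>auto simp: i_def\<close>)
  from fam_cover_coproduct[OF this]
  show "\<exists>K\<in>\<K>. \<exists>R i. (\<forall>k\<in>K. Fam.generated (R k)) \<and> is_coproduct F K R A i"
    using A generated_single finite_fib[OF A]
    by (intro bexI[of _ "idx A"] exI[of _ "\<lambda>k. fam_single s (fib A k)"] exI[of _ i]) (auto simp: Fam_ob)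
  have kap: "std.kap (point_fib A k) (point A k) \<in> hom F (tens F (point_fib A k) (unt F)) (dob std_deriv A)"
    if k: "k \<in> idx (D_ob A)" for k
    using homD[OF point_hom(2)[OF A k]] std.kap_simps[OF point_hom(1)[OF A k]] by (intro homI) simp_all
  have "fam_cover (idx (D_ob A)) (\<lambda>k. tens F (point_fib A k) (unt F)) (dob std_deriv A)
    (\<lambda>k. std.kap (point_fib A k) (point A k))"
  proof (rule fam_coverI[where v = "\<lambda>j. (j, p (s, s))"])
    show "is_iso FinBij (fib (tens F (point_fib A k) (unt F)) x)
        (fib (dob std_deriv A) (reindex (std.kap (point_fib A k) (point A k)) x))
        (comp_at (std.kap (point_fib A k) (point A k)) x)"
      if k: "k \<in> idx (D_ob A)" and x: "x \<in> idx (tens F (point_fib A k) (unt F))" for k x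
      by (rule FinBij_iso[OF Fam_homD(5)[OF kap[OF k] x]])
    show "\<exists>k\<in>idx (D_ob A). \<exists>x\<in>idx (tens F (point_fib A k) (unt F)).
        j = reindex (std.kap (point_fib A k) (point A k)) x"
      if "j \<in> idx (dob std_deriv A)" for j
      using that kap_point_index[OF A, of j] by (intro bexI[of _ j] bexI[of _ "p (s, s)"]) simp_all
  qed (use A kap kap_point_index[OF A] in auto)
  note cop = fam_cover_coproduct[OF this]
  have gen: "Fam.generated (point_fib A k)" if "k \<in> idx (D_ob A)" for k
    using generated_single finite_fib[OF D_ob_ob[OF A] that] by (simp add: point_fib_def)
  have "idx (D_ob A) \<in> \<K>" using D_ob_ob[OF A] by (simp add: Fam_ob)
  then show "\<exists>K\<in>\<K>. \<exists>R g.
      (\<forall>k\<in>K. Fam.generated (R k) \<and> g k \<in> hom F (tens F (R k) Y) A) \<and>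
      is_coproduct F K (\<lambda>k. tens F (R k) (unt F)) (dob std_deriv A) (\<lambda>k. std.kap (R k) (g k)) \<and>
      (\<forall>S h. Fam.generated S \<longrightarrow> h \<in> hom F (tens F S Y) A \<longrightarrow>
        (\<exists>k\<in>K. \<exists>r\<in>hom F S (R k). h = cmp F (g k) (tensa F r (idn F Y))))"
    by (rule bexI[rotated], intro exI[of _ "point_fib A"] exI[of _ "point A"])
      (use gen cop point_hom(2)[OF A] point_factor in blast)
qed

text \<open>If the derivative of \<open>Y\<close> were initial it would map to the empty family,
  where its index has no possible image.\<close>

theorem std_deriv_nontrivial: "\<not> trivial_derivation F std_deriv"
proof
  assume "trivial_derivation F std_deriv"
  then have "is_initial F (D_ob Y)"
    unfolding trivial_derivation_def using Fam.Y_ob by simp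
  moreover have "fam {} undefined \<in> ob F" by (simp add: fam_ob finite_index)
  ultimately obtain f where "f \<in> hom F (D_ob Y) (fam {} undefined)"
    by (rule Fam.initial_ex)
  from Fam_homD(4)[OF this, of "p (s, e 0)"] show False by simp
qed

theorem std_deriv_Y: "isomorphic F (dob std_deriv Y) (unt F)"
  using Fam.iso_inverse[OF std_point_iso] unfolding isomorphic_def by auto

lemma ex_derivation_iso_std:
  assumes "derivation F \<K> D" and Y: "isomorphic F (dob D Y) (unt F)"
  shows "\<exists>\<theta>. derivation_iso F std_deriv D \<theta>"
proof -
  interpret D: derivation F \<K> D by fact
  obtain f where "is_iso F (dob D Y) (unt F) f" using Y unfolding isomorphic_def by blast
  then obtain \<phi> where \<phi>: "is_iso F (unt F) (dob D Y) \<phi>" using Fam.iso_inverse by metis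
  interpret D: pointed_derivation F \<K> Y D \<phi>
    by unfold_locales (rule \<phi>)
  interpret comparison F \<K> Y std_deriv std_point D \<phi> ..
  show ?thesis using derivation_iso_theta by blast
qed

theorem derivations_isomorphic:
  assumes "derivation F \<K> D" "isomorphic F (dob D Y) (unt F)"
    and "derivation F \<K> D'" "isomorphic F (dob D' Y) (unt F)"
  shows "derivations_isomorphic F D D'"
  using derivation_iso_common_source[OF std.derivation_axioms assms(1,3)]
    ex_derivation_iso_std[OF assms(1,2)] ex_derivation_iso_std[OF assms(3,4)] by blast

end

section \<open>Finite and small index sets\<close>

lemma species_completion_finite: "species_completion finite_sets prod_encode (\<lambda>n. n)"
  by unfold_locales (auto simp: finite_sets_def inj_prod_encode inj_on_def)

text \<open>Regularity makes small sets stable under small unions, which is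
  \<open>Sigma_index\<close>; infinity gives the pairing and makes finite sets small.\<close>

lemma species_completion_small:
  assumes inf: "infinite (UNIV :: 'u set)" and reg: "regularCard (card_of (UNIV :: 'u set))"
    and e: "inj (e :: nat \<Rightarrow> 'u)"
  shows "species_completion (small_sets :: 'u set set) upair e"
proof unfold_locales
  have "\<exists>f. bij_betw f ((UNIV :: 'u set) \<times> (UNIV :: 'u set)) (UNIV :: 'u set)"
    by (rule card_of_ordIso[THEN iffD2, OF card_of_Times_same_infinite[OF inf]])
  then have "\<exists>f :: 'u \<times> 'u \<Rightarrow> 'u. inj f" unfolding bij_betw_def UNIV_Times_UNIV by blast
  then show "inj (upair :: 'u \<times> 'u \<Rightarrow> 'u)" unfolding upair_def by (rule someI_ex)
  show "infinite (UNIV :: 'u set)" by fact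
  show "I \<in> small_sets" if "finite I" for I :: "'u set"
    using finite_ordLess_infinite[OF card_of_Well_order card_of_Well_order, of I "UNIV :: 'u set"] that inf
    by (simp add: small_sets_def Field_card_of)
  have "stable (card_of (UNIV :: 'u set))"
    using regularCard_stable[OF card_of_Card_order _ reg] inf by (simp add: Field_card_of)
  then have Sigma: "(card_of (SIGMA i:I. J i), card_of (UNIV :: 'u set)) \<in> ordLess"
    if "I \<in> small_sets" "\<And>i. i \<in> I \<Longrightarrow> J i \<in> small_sets" for I :: "'u set" and J :: "'u \<Rightarrow> 'u set"
    using that unfolding stable_def small_sets_def by blast
  show "upair ` (SIGMA i:I. J i) \<in> small_sets"
    if "I \<in> small_sets" "\<And>i. i \<in> I \<Longrightarrow> J i \<in> small_sets" for I :: "'u set" and J :: "'u \<Rightarrow> 'u set"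
    unfolding small_sets_def using ordLeq_ordLess_trans[OF card_of_image Sigma[OF that]] by simp
  show "inj e" by fact
qed

theorem proposition5p13:
  assumes "infinite (UNIV :: 'u set)"
    and "regularCard (card_of (UNIV :: 'u set))"
  shows
    "(\<exists>D. derivation SigmaFin finite_sets D \<and> \<not> trivial_derivation SigmaFin D \<and>
          isomorphic SigmaFin (dob D Y_Fin) (unt SigmaFin)) \<and>
     (\<forall>D D'. derivation SigmaFin finite_sets D \<and>
             isomorphic SigmaFin (dob D Y_Fin) (unt SigmaFin) \<and>
             derivation SigmaFin finite_sets D' \<and>
             isomorphic SigmaFin (dob D' Y_Fin) (unt SigmaFin)
             \<longrightarrow> derivations_isomorphic SigmaFin D D') \<and>
     (\<exists>D. derivation SigmaSmall (small_sets :: 'u set set) D \<and>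
          \<not> trivial_derivation SigmaSmall D \<and>
          isomorphic SigmaSmall (dob D (Y_Small :: ('u, nat set) family)) (unt SigmaSmall)) \<and>
     (\<forall>D D'. derivation SigmaSmall (small_sets :: 'u set set) D \<and>
             isomorphic SigmaSmall (dob D (Y_Small :: ('u, nat set) family)) (unt SigmaSmall) \<and>
             derivation SigmaSmall (small_sets :: 'u set set) D' \<and>
             isomorphic SigmaSmall (dob D' Y_Small) (unt SigmaSmall)
             \<longrightarrow> derivations_isomorphic SigmaSmall D D')"
proof -
  \<comment> \<open>An infinite type contains a copy of the natural numbers, which codes the marked
    points.\<close>
  obtain e :: "nat \<Rightarrow> 'u" where e: "inj e"
    using infinite_countable_subset[OF assms(1)] by blast
  interpret fin: species_completion finite_sets prod_encode 0 "\<lambda>n. n"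
    by (rule species_completion_finite)
  interpret small: species_completion "small_sets :: 'u set set" upair upoint e
    by (rule species_completion_small[OF assms e])
  show ?thesis
    unfolding SigmaFin_def SigmaSmall_def Y_Fin_def Y_Small_def
    using fin.std.derivation_axioms fin.std_deriv_nontrivial fin.std_deriv_Y fin.derivations_isomorphic
      small.std.derivation_axioms small.std_deriv_nontrivial small.std_deriv_Y small.derivations_isomorphic
    by blast
qed

end
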